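(* Let $M=B\times_f\overline{F}$ be an $m$-dimensional nontrivial warped product proper pointwise semi-slant submanifold of a $(2n+1)$-dimensional Kenmotsu manifold $(N,\phi,\xi,\eta,g)$ with the semi-slant function $\theta$ such that $\mathcal{D}_1=TB$, $\mathcal{D}_2=T\overline{F}$, and $\xi$ is tangent to $M$. Write $\dim\mathcal{D}_1=2m_1+1$ and $\dim\mathcal{D}_2=2m_2$ (so $m=2m_1+2m_2+1$). Assume that $n=m_1+2m_2$. Then $$\|h\|^2\ \ge\ 4m_2(\csc^2\theta+\cot^2\theta)\,\|\phi\nabla(\ln f)\|^2,$$ with equality holding if and only if $g(h(Z,W),V)=0$ for all $Z,W\in\Gamma(T\overline{F})$ and $V\in\Gamma(TM^{\perp})$.
   Context: An almost contact metric manifold $(N,\phi,\xi,\eta,g)$ is a smooth manifold $N$ of dimension $2n+1$ with a tensor field $\phi$ of type $(1,1)$, a vector field $\xi$, a $1$-form $\eta$ and a Riemannian metric $g$ such that $\phi^2=-I+\eta\otimes\xi$, $\eta(\xi)=1$ and $g(\phi X,\phi Y)=g(X,Y)-\eta(X)\eta(Y)$ for all vector fields $X,Y$ (hence $\phi\xi=0$, $\eta\circ\phi=0$, $\eta(X)=g(X,\xi)$). With $\overline{\nabla}$ the Levi-Civita connection of $(N,g)$, it is Kenmotsu iff $(\overline{\nabla}_X\phi)Y=g(\phi X,Y)\xi-\eta(Y)\phi X$ for all vector fields $X,Y$ on $N$. A submanifold $M$ of $N$ is a pointwise semi-slant submanifold if there is a distribution $\mathcal{D}_1\subset TM$ such that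 $TM=\mathcal{D}_1\oplus\mathcal{D}_2$, $\phi(\mathcal{D}_1)\subset\mathcal{D}_1$, and at each given point $p\in M$ the angle $\theta=\theta(X)$ between $\phi X$ and $(\mathcal{D}_2)_p$ is constant for nonzero $X\in(\mathcal{D}_2)_p$, where $\mathcal{D}_2$ is the orthogonal complement of $\mathcal{D}_1$ in $TM$. The function $\theta$ on $M$ is the semi-slant function; $M$ is proper if $\theta$ takes values in $(0,\frac{\pi}{2})$. When $\xi$ is tangent to $M$, $\xi\in\Gamma(\mathcal{D}_1)$, $\dim\mathcal{D}_1$ is odd, and (for $M$ proper) $\dim\mathcal{D}_2$ is even. For Riemannian manifolds $(B,g_B)$, $(\overline{F},g_{\overline{F}})$ and a positive smooth function $f$ on $B$, the warped product $B\times_f\overline{F}$ is $B\times\overline{F}$ with metric $g_B+f^2g_{\overline{F}}$; it is trivial if the warping function $f$ is constant. Here $M$ with the induced metric is such a warped product, and $TB$, $T\overline{F}$ are identified with the corresponding subbundles of $TM$. $h$ is the second fundamental form of $M$ in $N$, $\|h\|^2=\sum_{i,j=1}^m g(h(e_i,e_j),h(e_i,e_j))$ for a local orthonormal frame $e_1,\dots,e_m$ of $TM$; $TM^\perp$ is the normal bundle; $\nabla(\ln f)$ is the gradient on $M$ of $\ln f$ (with $f$ regarded as a function on $M$). *)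

theory Defs
  imports "HOL-Analysis.Analysis"
begin

section \<open>Smooth maps between open subsets of Euclidean spaces\<close>

text \<open>Only used for open sets \<open>S\<close>; then \<open>at x within S\<close> and \<open>at x\<close> agree for \<open>x \<in> S\<close>.\<close>

primrec Ck_on :: "nat \<Rightarrow> 'e::euclidean_space set \<Rightarrow> ('e \<Rightarrow> 'f::real_normed_vector) \<Rightarrow> bool" where
  "Ck_on 0 S f = continuous_on S f"
| "Ck_on (Suc k) S f =
     (f differentiable_on S \<and> (\<forall>v. Ck_on k S (\<lambda>x. frechet_derivative f (at x) v)))"

definition smooth_on :: "'e::euclidean_space set \<Rightarrow> ('e \<Rightarrow> 'f::real_normed_vector) \<Rightarrow> bool" where
  "smooth_on S f \<longleftrightarrow> (\<forall>k. Ck_on k S f)"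


section \<open>Smooth manifolds\<close>

text \<open>The manifold is a whole type \<open>'a\<close> (Hausdorff, second countable), with model space \<open>'e\<close>, so
  its dimension is \<open>DIM('e)\<close>. A chart consists of its domain and the coordinate map.\<close>

type_synonym ('a, 'e) chart = "'a set \<times> ('a \<Rightarrow> 'e)"

abbreviation cdom :: "('a, 'e) chart \<Rightarrow> 'a set" where "cdom c \<equiv> fst c"
abbreviation cmap :: "('a, 'e) chart \<Rightarrow> 'a \<Rightarrow> 'e" where "cmap c \<equiv> snd c"
abbreviation cinv :: "('a, 'e) chart \<Rightarrow> 'e \<Rightarrow> 'a" where "cinv c \<equiv> inv_into (fst c) (snd c)"

definition is_chart :: "('a::topological_space, 'e::euclidean_space) chart \<Rightarrow> bool" where
  "is_chart c \<longleftrightarrow> open (cdom c) \<and> open (cmap c ` cdom c) \<and>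
     homeomorphism (cdom c) (cmap c ` cdom c) (cmap c) (cinv c)"

definition smooth_manifold ::
    "('a::{t2_space,second_countable_topology}, 'e::euclidean_space) chart set \<Rightarrow> bool" where
  "smooth_manifold A \<longleftrightarrow>
     (\<forall>c\<in>A. is_chart c) \<and> (\<Union>c\<in>A. cdom c) = UNIV \<and>
     (\<forall>c\<in>A. \<forall>d\<in>A. smooth_on (cmap c ` (cdom c \<inter> cdom d)) (cmap d \<circ> cinv c))"

definition prod_atlas :: "('a, 'e) chart set \<Rightarrow> ('b, 'f) chart set \<Rightarrow> ('a \<times> 'b, 'e \<times> 'f) chart set" where
  "prod_atlas A B = (\<lambda>(c, d). (cdom c \<times> cdom d, map_prod (cmap c) (cmap d))) ` (A \<times> B)"

definition smooth_fun :: "('a, 'e::euclidean_space) chart set \<Rightarrow> 'a set \<Rightarrow> ('a \<Rightarrow> real) \<Rightarrow> bool" where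
  "smooth_fun A U u \<longleftrightarrow> (\<forall>c\<in>A. smooth_on (cmap c ` (cdom c \<inter> U)) (u \<circ> cinv c))"

definition smooth_map ::
    "('a::topological_space, 'e::euclidean_space) chart set \<Rightarrow>
     ('b::topological_space, 'f::euclidean_space) chart set \<Rightarrow> ('a \<Rightarrow> 'b) \<Rightarrow> bool" where
  "smooth_map A B F \<longleftrightarrow> continuous_on UNIV F \<and>
     (\<forall>c\<in>A. \<forall>d\<in>B. smooth_on (cmap c ` (cdom c \<inter> F -` cdom d)) (cmap d \<circ> F \<circ> cinv c))"


section \<open>Tangent vectors and vector fields\<close>

text \<open>Each tangent space is identified with the model space \<open>'e\<close>: an element of \<open>'e\<close>, regarded as a
  tangent vector at \<open>p\<close>, lists its components in the preferred chart \<open>chart_at A p\<close>. Since that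
  chart varies arbitrarily with \<open>p\<close>, a vector field \<open>'a \<Rightarrow> 'e\<close> must not be differentiated directly;
  \<open>tcoord A c p\<close> converts to components in a fixed chart \<open>c\<close> around \<open>p\<close>, and
  \<open>coord_field A c a\<close> is the field on \<open>cdom c\<close> with constant components \<open>a\<close> in \<open>c\<close>.\<close>

definition chart_at :: "('a, 'e) chart set \<Rightarrow> 'a \<Rightarrow> ('a, 'e) chart" where
  "chart_at A p = (SOME c. c \<in> A \<and> p \<in> cdom c)"

definition tcoord ::
    "('a, 'e::euclidean_space) chart set \<Rightarrow> ('a, 'e) chart \<Rightarrow> 'a \<Rightarrow> 'e \<Rightarrow> 'e" where
  "tcoord A c p v =
     frechet_derivative (cmap c \<circ> cinv (chart_at A p)) (at (cmap (chart_at A p) p)) v"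

definition coord_field ::
    "('a, 'e::euclidean_space) chart set \<Rightarrow> ('a, 'e) chart \<Rightarrow> 'e \<Rightarrow> 'a \<Rightarrow> 'e" where
  "coord_field A c a p =
     frechet_derivative (cmap (chart_at A p) \<circ> cinv c) (at (cmap c p)) a"

definition tangent_map ::
    "('a, 'e::euclidean_space) chart set \<Rightarrow> ('b, 'f::euclidean_space) chart set \<Rightarrow>
     ('a \<Rightarrow> 'b) \<Rightarrow> 'a \<Rightarrow> 'e \<Rightarrow> 'f" where
  "tangent_map A B F p v =
     frechet_derivative (cmap (chart_at B (F p)) \<circ> F \<circ> cinv (chart_at A p))
       (at (cmap (chart_at A p) p)) v"

definition dir_deriv ::
    "('a, 'e::euclidean_space) chart set \<Rightarrow> 'a \<Rightarrow> 'e \<Rightarrow> ('a \<Rightarrow> real) \<Rightarrow> real" where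
  "dir_deriv A p v u =
     frechet_derivative (u \<circ> cinv (chart_at A p)) (at (cmap (chart_at A p) p)) v"

text \<open>\<open>vfields A U\<close> is \<open>\<Gamma>(TU)\<close> for \<open>U\<close> open; values outside \<open>U\<close> are irrelevant.\<close>

definition vfields :: "('a, 'e::euclidean_space) chart set \<Rightarrow> 'a set \<Rightarrow> ('a \<Rightarrow> 'e) set" where
  "vfields A U = {X. \<forall>c\<in>A. smooth_on (cmap c ` (cdom c \<inter> U))
     (\<lambda>x. tcoord A c (cinv c x) (X (cinv c x)))}"

definition distribution ::
    "('a::topological_space, 'e::euclidean_space) chart set \<Rightarrow> ('a \<Rightarrow> 'e set) \<Rightarrow> bool" where
  "distribution A D \<longleftrightarrow> (\<exists>k. \<forall>p. subspace (D p) \<and> dim (D p) = k \<and>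
     (\<exists>U X. open U \<and> p \<in> U \<and> (\<forall>i<k. X i \<in> vfields A U) \<and>
        (\<forall>q\<in>U. D q = span ((\<lambda>i::nat. X i q) ` {..<k}))))"


section \<open>Riemannian metrics and the Levi-Civita connection\<close>

definition riemannian_metric ::
    "('a::topological_space, 'e::euclidean_space) chart set \<Rightarrow> ('a \<Rightarrow> 'e \<Rightarrow> 'e \<Rightarrow> real) \<Rightarrow> bool" where
  "riemannian_metric A g \<longleftrightarrow>
     (\<forall>p. bilinear (g p) \<and> (\<forall>v w. g p v w = g p w v) \<and> (\<forall>v. v \<noteq> 0 \<longrightarrow> g p v v > 0)) \<and>
     (\<forall>U X Y. open U \<longrightarrow> X \<in> vfields A U \<longrightarrow> Y \<in> vfields A U \<longrightarrow>
        smooth_fun A U (\<lambda>p. g p (X p) (Y p)))"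

definition riemannian_manifold ::
    "('a::{t2_space,second_countable_topology}, 'e::euclidean_space) chart set \<Rightarrow>
     ('a \<Rightarrow> 'e \<Rightarrow> 'e \<Rightarrow> real) \<Rightarrow> bool" where
  "riemannian_manifold A g \<longleftrightarrow> smooth_manifold A \<and> riemannian_metric A g"

text \<open>\<open>nabla p v Y\<close> is the covariant derivative at \<open>p\<close>, in direction \<open>v\<close>, of a vector field \<open>Y\<close> that is
  smooth near \<open>p\<close>. Using fields on all open sets loses nothing, because connections are local
  operators. Dependence on the germ of \<open>Y\<close> only is implied by the Leibniz rule, with \<open>u\<close> the indicator
  function of \<open>U\<close>.\<close>

definition linear_connection ::
    "('a::topological_space, 'e::euclidean_space) chart set \<Rightarrow>
     ('a \<Rightarrow> 'e \<Rightarrow> ('a \<Rightarrow> 'e) \<Rightarrow> 'e) \<Rightarrow> bool" where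
  "linear_connection A nabla \<longleftrightarrow> (\<forall>U. open U \<longrightarrow>
     (\<forall>Y\<in>vfields A U.
        (\<forall>p\<in>U. linear (\<lambda>v. nabla p v Y)) \<and>
        (\<forall>Z\<in>vfields A U. \<forall>p\<in>U. \<forall>v. nabla p v (\<lambda>q. Y q + Z q) = nabla p v Y + nabla p v Z) \<and>
        (\<forall>u. smooth_fun A U u \<longrightarrow> (\<forall>p\<in>U. \<forall>v. nabla p v (\<lambda>q. u q *\<^sub>R Y q) =
           dir_deriv A p v u *\<^sub>R Y p + u p *\<^sub>R nabla p v Y)) \<and>
        (\<forall>X\<in>vfields A U. (\<lambda>p. nabla p (X p) Y) \<in> vfields A U)))"

text \<open>\<open>\<nabla>\<^sub>X Y - \<nabla>\<^sub>Y X = [X, Y]\<close>, where \<open>[X, Y]\<close> is the derivation \<open>u \<mapsto> X (Y u) - Y (X u)\<close>.\<close>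

definition torsion_free ::
    "('a::topological_space, 'e::euclidean_space) chart set \<Rightarrow>
     ('a \<Rightarrow> 'e \<Rightarrow> ('a \<Rightarrow> 'e) \<Rightarrow> 'e) \<Rightarrow> bool" where
  "torsion_free A nabla \<longleftrightarrow> (\<forall>U. open U \<longrightarrow>
     (\<forall>X\<in>vfields A U. \<forall>Y\<in>vfields A U. \<forall>u. smooth_fun A U u \<longrightarrow> (\<forall>p\<in>U.
        dir_deriv A p (nabla p (X p) Y - nabla p (Y p) X) u =
        dir_deriv A p (X p) (\<lambda>q. dir_deriv A q (Y q) u) -
        dir_deriv A p (Y p) (\<lambda>q. dir_deriv A q (X q) u))))"

definition metric_connection ::
    "('a::topological_space, 'e::euclidean_space) chart set \<Rightarrow> ('a \<Rightarrow> 'e \<Rightarrow> 'e \<Rightarrow> real) \<Rightarrow>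
     ('a \<Rightarrow> 'e \<Rightarrow> ('a \<Rightarrow> 'e) \<Rightarrow> 'e) \<Rightarrow> bool" where
  "metric_connection A g nabla \<longleftrightarrow> (\<forall>U. open U \<longrightarrow>
     (\<forall>Y\<in>vfields A U. \<forall>Z\<in>vfields A U. \<forall>p\<in>U. \<forall>v.
        dir_deriv A p v (\<lambda>q. g q (Y q) (Z q)) =
        g p (nabla p v Y) (Z p) + g p (Y p) (nabla p v Z)))"

definition levi_civita ::
    "('a::topological_space, 'e::euclidean_space) chart set \<Rightarrow> ('a \<Rightarrow> 'e \<Rightarrow> 'e \<Rightarrow> real) \<Rightarrow>
     ('a \<Rightarrow> 'e \<Rightarrow> ('a \<Rightarrow> 'e) \<Rightarrow> 'e) \<Rightarrow> bool" where
  "levi_civita A g nabla \<longleftrightarrow>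
     linear_connection A nabla \<and> torsion_free A nabla \<and> metric_connection A g nabla"

definition gradient ::
    "('a, 'e::euclidean_space) chart set \<Rightarrow> ('a \<Rightarrow> 'e \<Rightarrow> 'e \<Rightarrow> real) \<Rightarrow> ('a \<Rightarrow> real) \<Rightarrow> 'a \<Rightarrow> 'e" where
  "gradient A g u p = (THE v. \<forall>w. g p v w = dir_deriv A p w u)"


section \<open>Kenmotsu manifolds\<close>

definition almost_contact_metric ::
    "('a::{t2_space,second_countable_topology}, 'e::euclidean_space) chart set \<Rightarrow>
     ('a \<Rightarrow> 'e \<Rightarrow> 'e) \<Rightarrow> ('a \<Rightarrow> 'e) \<Rightarrow> ('a \<Rightarrow> 'e \<Rightarrow> real) \<Rightarrow> ('a \<Rightarrow> 'e \<Rightarrow> 'e \<Rightarrow> real) \<Rightarrow> bool" where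
  "almost_contact_metric A \<phi> \<xi> \<eta> g \<longleftrightarrow>
     riemannian_manifold A g \<and>
     (\<forall>p. linear (\<phi> p)) \<and>
     (\<forall>U X. open U \<longrightarrow> X \<in> vfields A U \<longrightarrow> (\<lambda>p. \<phi> p (X p)) \<in> vfields A U) \<and>
     \<xi> \<in> vfields A UNIV \<and>
     (\<forall>p. linear (\<eta> p)) \<and>
     (\<forall>U X. open U \<longrightarrow> X \<in> vfields A U \<longrightarrow> smooth_fun A U (\<lambda>p. \<eta> p (X p))) \<and>
     (\<forall>p v. \<phi> p (\<phi> p v) = - v + \<eta> p v *\<^sub>R \<xi> p) \<and>
     (\<forall>p. \<eta> p (\<xi> p) = 1) \<and>
     (\<forall>p v w. g p (\<phi> p v) (\<phi> p w) = g p v w - \<eta> p v * \<eta> p w)"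

text \<open>The covariant derivative of \<open>\<phi>\<close> is \<open>(\<nabla>\<^sub>X \<phi>) Y = \<nabla>\<^sub>X (\<phi> Y) - \<phi> (\<nabla>\<^sub>X Y)\<close>.\<close>

definition kenmotsu ::
    "('a::{t2_space,second_countable_topology}, 'e::euclidean_space) chart set \<Rightarrow>
     ('a \<Rightarrow> 'e \<Rightarrow> 'e) \<Rightarrow> ('a \<Rightarrow> 'e) \<Rightarrow> ('a \<Rightarrow> 'e \<Rightarrow> real) \<Rightarrow> ('a \<Rightarrow> 'e \<Rightarrow> 'e \<Rightarrow> real) \<Rightarrow>
     ('a \<Rightarrow> 'e \<Rightarrow> ('a \<Rightarrow> 'e) \<Rightarrow> 'e) \<Rightarrow> bool" where
  "kenmotsu A \<phi> \<xi> \<eta> g nabla \<longleftrightarrow>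
     almost_contact_metric A \<phi> \<xi> \<eta> g \<and> levi_civita A g nabla \<and>
     (\<forall>U. open U \<longrightarrow> (\<forall>X\<in>vfields A U. \<forall>Y\<in>vfields A U. \<forall>p\<in>U.
        nabla p (X p) (\<lambda>q. \<phi> q (Y q)) - \<phi> p (nabla p (X p) Y) =
        g p (\<phi> p (X p)) (Y p) *\<^sub>R \<xi> p - \<eta> p (Y p) *\<^sub>R \<phi> p (X p)))"


section \<open>Submanifolds\<close>

text \<open>A submanifold is given by an immersion \<open>\<iota>\<close>; at \<open>p\<close> its tangent space inside the ambient one is the
  range of \<open>tangent_map AM AN \<iota> p\<close>.\<close>

definition immersion ::
    "('a::topological_space, 'e::euclidean_space) chart set \<Rightarrow>
     ('b::topological_space, 'f::euclidean_space) chart set \<Rightarrow> ('a \<Rightarrow> 'b) \<Rightarrow> bool" where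
  "immersion AM AN \<iota> \<longleftrightarrow> smooth_map AM AN \<iota> \<and> (\<forall>p. inj (tangent_map AM AN \<iota> p))"

definition induced_metric ::
    "('a, 'e::euclidean_space) chart set \<Rightarrow> ('b, 'f::euclidean_space) chart set \<Rightarrow>
     ('a \<Rightarrow> 'b) \<Rightarrow> ('b \<Rightarrow> 'f \<Rightarrow> 'f \<Rightarrow> real) \<Rightarrow> 'a \<Rightarrow> 'e \<Rightarrow> 'e \<Rightarrow> real" where
  "induced_metric AM AN \<iota> g p v w =
     g (\<iota> p) (tangent_map AM AN \<iota> p v) (tangent_map AM AN \<iota> p w)"

definition normal_vectors ::
    "('a, 'e::euclidean_space) chart set \<Rightarrow> ('b, 'f::euclidean_space) chart set \<Rightarrow>
     ('a \<Rightarrow> 'b) \<Rightarrow> ('b \<Rightarrow> 'f \<Rightarrow> 'f \<Rightarrow> real) \<Rightarrow> 'a \<Rightarrow> 'f set" where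
  "normal_vectors AM AN \<iota> g p = {V. \<forall>x. g (\<iota> p) V (tangent_map AM AN \<iota> p x) = 0}"

definition normal_part ::
    "('a, 'e::euclidean_space) chart set \<Rightarrow> ('b, 'f::euclidean_space) chart set \<Rightarrow>
     ('a \<Rightarrow> 'b) \<Rightarrow> ('b \<Rightarrow> 'f \<Rightarrow> 'f \<Rightarrow> real) \<Rightarrow> 'a \<Rightarrow> 'f \<Rightarrow> 'f" where
  "normal_part AM AN \<iota> g p V =
     (THE W. W \<in> normal_vectors AM AN \<iota> g p \<and> V - W \<in> range (tangent_map AM AN \<iota> p))"

text \<open>The covariant derivative, in direction \<open>x\<close>, of a vector field \<open>W\<close> along \<open>\<iota>\<close> (so \<open>W q\<close> is tangent to
  the ambient manifold at \<open>\<iota> q\<close>): writing \<open>W = \<Sum>\<^sub>k W\<^sup>k (\<partial>\<^sub>k \<circ> \<iota>)\<close> in a chart around \<open>\<iota> p\<close>, it is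
  \<open>\<Sum>\<^sub>k x(W\<^sup>k) \<partial>\<^sub>k + \<Sum>\<^sub>k W\<^sup>k(p) \<nabla>\<^bsub>\<iota>\<^sub>* x\<^esub> \<partial>\<^sub>k\<close>. For \<open>W = Y \<circ> \<iota>\<close> with an ambient field \<open>Y\<close> it is the ambient
  covariant derivative of \<open>Y\<close> in direction \<open>\<iota>\<^sub>* x\<close>. The chart is the preferred one at \<open>\<iota> p\<close>, in
  which the components of \<open>W p\<close> are \<open>W p\<close> itself.\<close>

definition covariant_along ::
    "('a, 'e::euclidean_space) chart set \<Rightarrow> ('b, 'f::euclidean_space) chart set \<Rightarrow>
     ('a \<Rightarrow> 'b) \<Rightarrow> ('b \<Rightarrow> 'f \<Rightarrow> ('b \<Rightarrow> 'f) \<Rightarrow> 'f) \<Rightarrow> 'a \<Rightarrow> 'e \<Rightarrow> ('a \<Rightarrow> 'f) \<Rightarrow> 'f" where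
  "covariant_along AM AN \<iota> nabla p x W =
     (let b = chart_at AM p; c = chart_at AN (\<iota> p) in
        frechet_derivative (\<lambda>y. tcoord AN c (\<iota> (cinv b y)) (W (cinv b y))) (at (cmap b p)) x
        + nabla (\<iota> p) (tangent_map AM AN \<iota> p x) (coord_field AN c (W p)))"

text \<open>Gauss formula: \<open>h(x, y)\<close> is the normal part of the ambient covariant derivative in direction \<open>x\<close> of
  any local tangent vector field \<open>Y\<close> of the submanifold extending \<open>y\<close>.\<close>

definition second_fundamental_form ::
    "('a::topological_space, 'e::euclidean_space) chart set \<Rightarrow> ('b, 'f::euclidean_space) chart set \<Rightarrow>
     ('a \<Rightarrow> 'b) \<Rightarrow> ('b \<Rightarrow> 'f \<Rightarrow> 'f \<Rightarrow> real) \<Rightarrow> ('b \<Rightarrow> 'f \<Rightarrow> ('b \<Rightarrow> 'f) \<Rightarrow> 'f) \<Rightarrow>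
     'a \<Rightarrow> 'e \<Rightarrow> 'e \<Rightarrow> 'f" where
  "second_fundamental_form AM AN \<iota> g nabla p x y =
     (THE w. \<forall>U Y. open U \<longrightarrow> p \<in> U \<longrightarrow> Y \<in> vfields AM U \<longrightarrow> Y p = y \<longrightarrow>
        w = normal_part AM AN \<iota> g p
              (covariant_along AM AN \<iota> nabla p x (\<lambda>q. tangent_map AM AN \<iota> q (Y q))))"

definition orthonormal_basis :: "('e::euclidean_space \<Rightarrow> 'e \<Rightarrow> real) \<Rightarrow> 'e set \<Rightarrow> bool" where
  "orthonormal_basis G E \<longleftrightarrow>
     (\<forall>x\<in>E. \<forall>y\<in>E. G x y = (if x = y then 1 else 0)) \<and> span E = UNIV"

text \<open>The value does not depend on the orthonormal basis chosen.\<close>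

definition sff_norm_sq ::
    "('a::topological_space, 'e::euclidean_space) chart set \<Rightarrow> ('b, 'f::euclidean_space) chart set \<Rightarrow>
     ('a \<Rightarrow> 'b) \<Rightarrow> ('b \<Rightarrow> 'f \<Rightarrow> 'f \<Rightarrow> real) \<Rightarrow> ('b \<Rightarrow> 'f \<Rightarrow> ('b \<Rightarrow> 'f) \<Rightarrow> 'f) \<Rightarrow> 'a \<Rightarrow> real" where
  "sff_norm_sq AM AN \<iota> g nabla p =
     (let h = second_fundamental_form AM AN \<iota> g nabla p;
          E = (SOME E. orthonormal_basis (induced_metric AM AN \<iota> g p) E)
      in \<Sum>x\<in>E. \<Sum>y\<in>E. g (\<iota> p) (h x y) (h x y))"


section \<open>Pointwise semi-slant submanifolds\<close>

definition vec_angle :: "('e \<Rightarrow> 'e \<Rightarrow> real) \<Rightarrow> 'e \<Rightarrow> 'e \<Rightarrow> real" where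
  "vec_angle G v w = arccos (G v w / (sqrt (G v v) * sqrt (G w w)))"

text \<open>The angle between a vector and a nonzero subspace is the least angle between the vector and the
  nonzero elements of the subspace (\<open>\<pi>/2\<close> if the vector is orthogonal to the subspace).\<close>

definition subspace_angle ::
    "('e::zero \<Rightarrow> 'e \<Rightarrow> real) \<Rightarrow> 'e \<Rightarrow> 'e set \<Rightarrow> real" where
  "subspace_angle G v W = Inf {vec_angle G v w | w. w \<in> W \<and> w \<noteq> 0}"

definition pointwise_semi_slant ::
    "('a::topological_space, 'e::euclidean_space) chart set \<Rightarrow>
     ('b::topological_space, 'f::euclidean_space) chart set \<Rightarrow> ('a \<Rightarrow> 'b) \<Rightarrow>
     ('b \<Rightarrow> 'f \<Rightarrow> 'f) \<Rightarrow> ('b \<Rightarrow> 'f \<Rightarrow> 'f \<Rightarrow> real) \<Rightarrow>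
     ('a \<Rightarrow> 'e set) \<Rightarrow> ('a \<Rightarrow> 'e set) \<Rightarrow> ('a \<Rightarrow> real) \<Rightarrow> bool" where
  "pointwise_semi_slant AM AN \<iota> \<phi> g D1 D2 \<theta> \<longleftrightarrow>
     immersion AM AN \<iota> \<and> distribution AM D1 \<and>
     (\<forall>p. D2 p = {w. \<forall>v\<in>D1 p. induced_metric AM AN \<iota> g p v w = 0}) \<and>
     (\<forall>p. D1 p \<inter> D2 p = {0} \<and> {v + w | v w. v \<in> D1 p \<and> w \<in> D2 p} = UNIV) \<and>
     (\<forall>p. \<phi> (\<iota> p) ` tangent_map AM AN \<iota> p ` D1 p \<subseteq> tangent_map AM AN \<iota> p ` D1 p) \<and>
     (\<forall>p. \<forall>X\<in>D2 p. X \<noteq> 0 \<longrightarrow>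
        subspace_angle (g (\<iota> p)) (\<phi> (\<iota> p) (tangent_map AM AN \<iota> p X))
          (tangent_map AM AN \<iota> p ` D2 p) = \<theta> p)"


section \<open>Warped products\<close>

text \<open>\<open>g\<^sub>B + f\<^sup>2 g\<^sub>F\<close> on \<open>B \<times> F\<close>, the summands being pulled back along the projections.\<close>

definition warped_metric ::
    "('b, 'e::euclidean_space) chart set \<Rightarrow> ('f, 'd::euclidean_space) chart set \<Rightarrow>
     ('b \<Rightarrow> 'e \<Rightarrow> 'e \<Rightarrow> real) \<Rightarrow> ('f \<Rightarrow> 'd \<Rightarrow> 'd \<Rightarrow> real) \<Rightarrow> ('b \<Rightarrow> real) \<Rightarrow>
     'b \<times> 'f \<Rightarrow> 'e \<times> 'd \<Rightarrow> 'e \<times> 'd \<Rightarrow> real" where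
  "warped_metric AB AF gB gF f p v w =
     gB (fst p) (tangent_map (prod_atlas AB AF) AB fst p v)
                (tangent_map (prod_atlas AB AF) AB fst p w) +
     (f (fst p))\<^sup>2 *
     gF (snd p) (tangent_map (prod_atlas AB AF) AF snd p v)
                (tangent_map (prod_atlas AB AF) AF snd p w)"

definition base_tangent ::
    "('b, 'e::euclidean_space) chart set \<Rightarrow> ('f, 'd::euclidean_space) chart set \<Rightarrow>
     'b \<times> 'f \<Rightarrow> ('e \<times> 'd) set" where
  "base_tangent AB AF p = {v. tangent_map (prod_atlas AB AF) AF snd p v = 0}"

definition fiber_tangent ::
    "('b, 'e::euclidean_space) chart set \<Rightarrow> ('f, 'd::euclidean_space) chart set \<Rightarrow>
     'b \<times> 'f \<Rightarrow> ('e \<times> 'd) set" where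
  "fiber_tangent AB AF p = {v. tangent_map (prod_atlas AB AF) AB fst p v = 0}"

end

theory Submission
  imports Defs
begin

text \<open>At a point \<open>p\<close> use the preferred charts at \<open>p\<close> and at \<open>\<iota> p\<close>. For fields with constant components
  in the chart of \<open>M\<close>, put \<open>S x y = D\<^sup>2\<iota>(x, y) + \<Gamma>(d\<iota> x, d\<iota> y)\<close>; it is symmetric, and \<open>h\<close> is its normal part.
  The chart of \<open>M\<close> is a product chart, so constant fields are tangent to the base or to the fibre everywhere.
  Differentiating the induced metric and the identities \<open>g(\<phi> d\<iota> X, d\<iota> Z) = 0 = g(\<phi> d\<iota> X, \<phi> d\<iota> Z)\<close>, for \<open>X\<close> in
  \<open>D1\<close> and \<open>Z\<close> in \<open>D2\<close>, gives with the Kenmotsu identity, where \<open>\<phi>W = TW + FW\<close> splits into tangential and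
  normal part, \<open>\<xi>(ln f) = 1\<close>, \<open>g(h(X, Y), FW) = 0\<close> and
  \<open>g(h(X, Z), FW) = - (\<phi>X)(ln f) g(Z, W) + (X(ln f) - \<eta>(X)) g(TZ, W)\<close>.
  Since \<open>n = m1 + 2 m2\<close>, the vectors \<open>FW\<close> span the normal space, \<open>F\<close> scales the metric of \<open>D2\<close> by
  \<open>sin\<^sup>2 \<theta>\<close> and \<open>T\<close> scales it by \<open>cos\<^sup>2 \<theta>\<close>. Summing squares over an adapted orthonormal basis shows that the
  mixed part of \<open>\<parallel>h\<parallel>\<^sup>2\<close> is the right-hand side of the inequality, and the rest is the \<open>D2\<close>-\<open>D2\<close> part.\<close>

section \<open>Calculus of smooth maps\<close>

text \<open>Tangent vectors are components in a chart that jumps with the point, so fields cannot be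
  differentiated as they stand. Hence the two stages: linear algebra at one point, based on a list
  of first-order identities, and a coordinate computation that supplies this list. No estimate
  occurs: the mixed part is computed exactly, which gives the inequality and its equality case at
  once. The constant arises as follows. The two mixed blocks agree by symmetry of \<open>h\<close>,
  and every unit vector of \<open>D2\<close> contributes the same amount, hence 2 * dim D2 = 4 * m2.
  The vectors Z and TZ are orthogonal, so dividing the two squared coefficients by the squared sine
  gives the squared cosecant and cotangent. Summed over \<open>D1\<close>, both coefficients give
  the squared length of \<open>\<phi>\<close> applied to the gradient: the first because
  \<open>\<phi>\<close> is skew, the second because it pairs X with the gradient minus \<xi>, and
  \<xi>(ln f) = 1 shortens both vectors by the same amount. The normal space has dimension 2n + 1 -
  m = 2 * m2, that of \<open>D2\<close>, and F is injective there because the sine of \<theta> is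
  positive.\<close>

lemma frechet_derivative_cong_open:
  assumes "open S" "x \<in> S" "\<And>y. y \<in> S \<Longrightarrow> f y = g y"
  shows "frechet_derivative f (at x) = frechet_derivative g (at x)"
proof -
  have "(f has_derivative D) (at x) \<longleftrightarrow> (g has_derivative D) (at x)" for D
    using has_derivative_transform_within_open[of f D x UNIV S g]
      has_derivative_transform_within_open[of g D x UNIV S f] assms by auto
  then show ?thesis unfolding frechet_derivative_def by simp
qed

section \<open>Closure properties of maps of class C^k\<close>

lemma Ck_on_SucD:
  assumes "Ck_on (Suc k) S f" "open S" "x \<in> S"
  shows "(f has_derivative frechet_derivative f (at x)) (at x)"
  using assms by (metis Ck_on.simps(2) differentiable_on_eq_differentiable_at frechet_derivative_works)

lemma Ck_on_Suc_imp: "Ck_on (Suc k) S f \<Longrightarrow> Ck_on k S f"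
proof (induction k arbitrary: f)
  case 0
  then show ?case using differentiable_imp_continuous_on by auto
next
  case (Suc k)
  then show ?case using Ck_on.simps(2) by blast
qed

lemma Ck_on_cong:
  assumes "open S" "\<And>x. x \<in> S \<Longrightarrow> f x = g x" "Ck_on k S f"
  shows "Ck_on k S g"
  using assms(2,3)
proof (induction k arbitrary: f g)
  case 0
  then show ?case by (metis Ck_on.simps(1) continuous_on_cong)
next
  case (Suc k)
  have "g differentiable_on S"
    using Suc.prems by (metis Ck_on.simps(2) differentiable_on_def differentiable_transform_within zero_less_one)
  moreover have "Ck_on k S (\<lambda>x. frechet_derivative g (at x) v)" for v
    using Suc.IH[of "\<lambda>x. frechet_derivative f (at x) v" "\<lambda>x. frechet_derivative g (at x) v"] Suc.prems
      frechet_derivative_cong_open[OF assms(1)] by (metis Ck_on.simps(2))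
  ultimately show ?case by simp
qed

text \<open>Lets the closure proofs below use an explicit formula for the derivative instead of the
  one picked by \<open>frechet_derivative\<close>.\<close>

lemma Ck_on_SucI:
  assumes "open S" "\<And>x. x \<in> S \<Longrightarrow> (f has_derivative f' x) (at x)"
    and "\<And>v. Ck_on k S (\<lambda>x. f' x v)"
  shows "Ck_on (Suc k) S f"
proof -
  have "f differentiable_on S"
    using assms(1,2) by (meson differentiableI differentiable_on_eq_differentiable_at)
  moreover have "Ck_on k S (\<lambda>x. frechet_derivative f (at x) v)" for v
  proof (rule Ck_on_cong[OF assms(1) _ assms(3)])
    show "f' x v = frechet_derivative f (at x) v" if "x \<in> S" for x
      by (rule fun_cong[OF frechet_derivative_at[OF assms(2)[OF that]]])
  qed
  ultimately show ?thesis by simp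
qed

lemma Ck_on_const:
  fixes c :: "'f::real_normed_vector"
  assumes S: "open S"
  shows "Ck_on k S (\<lambda>x. c)"
proof -
  \<comment> \<open>The constant is quantified inside the induction because the derivative of a
    constant map is a different constant, zero.\<close>
  have "\<forall>c::'f. Ck_on k S (\<lambda>x. c)"
  proof (induction k)
    case 0
    show ?case by simp
  next
    case (Suc k)
    have "Ck_on k S (\<lambda>x. 0::'f)" using Suc.IH by (rule spec)
    then show ?case by simp
  qed
  then show ?thesis by (rule spec)
qed

lemma Ck_on_linear:
  assumes "bounded_linear L" "open S" "Ck_on k S f"
  shows "Ck_on k S (\<lambda>x. L (f x))"
  using assms(3)
proof (induction k arbitrary: f)
  case 0
  then show ?case using assms(1) by (simp add: bounded_linear.continuous_on)
next
  case (Suc k)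
  show ?case
  proof (rule Ck_on_SucI[where f' = "\<lambda>x v. L (frechet_derivative f (at x) v)"])
    show "((\<lambda>x. L (f x)) has_derivative (\<lambda>v. L (frechet_derivative f (at x) v))) (at x)"
      if "x \<in> S" for x
      using bounded_linear.has_derivative[OF assms(1) Ck_on_SucD[OF Suc.prems assms(2) that]] .
    show "Ck_on k S (\<lambda>x. L (frechet_derivative f (at x) v))" for v
      by (rule Suc.IH) (use Suc.prems in simp)
  qed (rule assms(2))
qed

lemma Ck_on_id:
  assumes "open S"
  shows "Ck_on k S (\<lambda>x. x)"
proof (cases k)
  case 0
  then show ?thesis by (simp add: continuous_on_id)
next
  case (Suc j)
  have "Ck_on (Suc j) S (\<lambda>x. x)"
    by (rule Ck_on_SucI[OF assms, where f' = "\<lambda>x v. v"])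
      (rule has_derivative_ident, rule Ck_on_const[OF assms])
  then show ?thesis by (simp only: Suc)
qed

lemma Ck_on_add:
  assumes "open S" "Ck_on k S f" "Ck_on k S g"
  shows "Ck_on k S (\<lambda>x. f x + g x)"
  using assms(2,3)
proof (induction k arbitrary: f g)
  case 0
  then show ?case by (simp add: continuous_on_add)
next
  case (Suc k)
  show ?case
  proof (rule Ck_on_SucI[where f' = "\<lambda>x v. frechet_derivative f (at x) v + frechet_derivative g (at x) v"])
    show "((\<lambda>x. f x + g x) has_derivative
        (\<lambda>v. frechet_derivative f (at x) v + frechet_derivative g (at x) v)) (at x)" if "x \<in> S" for x
      using has_derivative_add[OF Ck_on_SucD[OF Suc.prems(1) assms(1) that]
          Ck_on_SucD[OF Suc.prems(2) assms(1) that]] .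
    show "Ck_on k S (\<lambda>x. frechet_derivative f (at x) v + frechet_derivative g (at x) v)" for v
      by (rule Suc.IH) (use Suc.prems in simp_all)
  qed (rule assms(1))
qed

lemma Ck_on_sum:
  assumes "open S" "finite I" "\<And>i. i \<in> I \<Longrightarrow> Ck_on k S (f i)"
  shows "Ck_on k S (\<lambda>x. \<Sum>i\<in>I. f i x)"
  using assms(2,3)
proof (induction I rule: finite_induct)
  case empty
  show ?case using Ck_on_const[OF assms(1)] by simp
next
  case (insert i I)
  have "Ck_on k S (\<lambda>x. f i x + (\<Sum>i\<in>I. f i x))"
    by (rule Ck_on_add[OF assms(1)]) (use insert in blast)+
  then show ?case using insert.hyps by simp
qed

lemma Ck_on_scaleR:
  assumes "open S" "Ck_on k S u" "Ck_on k S f"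
  shows "Ck_on k S (\<lambda>x. u x *\<^sub>R f x)"
  using assms(2,3)
proof (induction k arbitrary: u f)
  case 0
  then show ?case by (simp add: continuous_on_scaleR)
next
  case (Suc k)
  show ?case
  proof (rule Ck_on_SucI[where f' = "\<lambda>x v. u x *\<^sub>R frechet_derivative f (at x) v
           + frechet_derivative u (at x) v *\<^sub>R f x"])
    show "((\<lambda>x. u x *\<^sub>R f x) has_derivative (\<lambda>v. u x *\<^sub>R frechet_derivative f (at x) v
           + frechet_derivative u (at x) v *\<^sub>R f x)) (at x)" if "x \<in> S" for x
      using has_derivative_scaleR[OF Ck_on_SucD[OF Suc.prems(1) assms(1) that]
          Ck_on_SucD[OF Suc.prems(2) assms(1) that]] .
    show "Ck_on k S (\<lambda>x. u x *\<^sub>R frechet_derivative f (at x) v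
           + frechet_derivative u (at x) v *\<^sub>R f x)" for v
    proof (rule Ck_on_add[OF assms(1)])
      show "Ck_on k S (\<lambda>x. u x *\<^sub>R frechet_derivative f (at x) v)"
        by (rule Suc.IH) (use Suc.prems Ck_on_Suc_imp[OF Suc.prems(1)] in simp_all)
      show "Ck_on k S (\<lambda>x. frechet_derivative u (at x) v *\<^sub>R f x)"
        by (rule Suc.IH) (use Suc.prems Ck_on_Suc_imp[OF Suc.prems(2)] in simp_all)
    qed
  qed (rule assms(1))
qed

lemma linear_eq_sum_Basis:
  fixes L :: "'e::euclidean_space \<Rightarrow> 'f::real_vector"
  assumes "linear L"
  shows "L w = (\<Sum>i\<in>Basis. (w \<bullet> i) *\<^sub>R L i)"
proof -
  have "L w = L (\<Sum>i\<in>Basis. (w \<bullet> i) *\<^sub>R i)" by (simp add: euclidean_representation)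
  also have "\<dots> = (\<Sum>i\<in>Basis. (w \<bullet> i) *\<^sub>R L i)"
    by (simp add: linear_sum[OF assms] linear_cmul[OF assms])
  finally show ?thesis .
qed

lemma Ck_on_compose:
  fixes g :: "'e::euclidean_space \<Rightarrow> 'h::euclidean_space"
  assumes "open S" "open T" "Ck_on k S g" "g ` S \<subseteq> T" "Ck_on k T f"
  shows "Ck_on k S (\<lambda>x. f (g x))"
  using assms(3,5)
proof (induction k arbitrary: f)
  case 0
  then show ?case using assms(4) by (auto intro: continuous_on_compose2)
next
  case (Suc k)
  \<comment> \<open>In the chain rule the direction fed to the derivative of \<open>f\<close> moves
    with \<open>x\<close>. Expanding it in the basis leaves derivatives in fixed directions, to
    which the induction hypothesis applies.\<close>
  let ?f' = "\<lambda>x v. \<Sum>i\<in>Basis. (frechet_derivative g (at x) v \<bullet> i) *\<^sub>R frechet_derivative f (at (g x)) i"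
  show ?case
  proof (rule Ck_on_SucI[where f' = ?f'])
    fix x assume x: "x \<in> S"
    then have gx: "g x \<in> T" using assms(4) by auto
    note df = Ck_on_SucD[OF Suc.prems(2) assms(2) gx]
    have "((\<lambda>x. f (g x)) has_derivative
        (\<lambda>v. frechet_derivative f (at (g x)) (frechet_derivative g (at x) v))) (at x)"
      using has_derivative_compose[OF Ck_on_SucD[OF Suc.prems(1) assms(1) x] df] .
    moreover have "(\<lambda>v. frechet_derivative f (at (g x)) (frechet_derivative g (at x) v)) = ?f' x"
      by (rule ext, rule linear_eq_sum_Basis[OF has_derivative_linear[OF df]])
    ultimately show "((\<lambda>x. f (g x)) has_derivative ?f' x) (at x)" by (simp only:)
  next
    fix v
    show "Ck_on k S (\<lambda>x. ?f' x v)"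
    proof (rule Ck_on_sum[OF assms(1) finite_Basis], rule Ck_on_scaleR[OF assms(1)])
      fix i :: 'h
      show "Ck_on k S (\<lambda>x. frechet_derivative g (at x) v \<bullet> i)"
        by (rule Ck_on_linear[OF bounded_linear_inner_left assms(1)]) (use Suc.prems in simp)
      show "Ck_on k S (\<lambda>x. frechet_derivative f (at (g x)) i)"
        by (rule Suc.IH[OF Ck_on_Suc_imp[OF Suc.prems(1)]]) (use Suc.prems(2) in simp)
    qed
  qed (rule assms(1))
qed

lemma smooth_on_cong:
  "open S \<Longrightarrow> (\<And>x. x \<in> S \<Longrightarrow> f x = g x) \<Longrightarrow> smooth_on S f \<Longrightarrow> smooth_on S g"
  unfolding smooth_on_def by (intro allI, rule Ck_on_cong[where f = f]) auto

lemma smooth_on_has_derivative: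
  "smooth_on S f \<Longrightarrow> open S \<Longrightarrow> x \<in> S \<Longrightarrow> (f has_derivative frechet_derivative f (at x)) (at x)"
  unfolding smooth_on_def using Ck_on_SucD by blast

lemma smooth_on_frechet_derivative: "smooth_on S f \<Longrightarrow> smooth_on S (\<lambda>x. frechet_derivative f (at x) v)"
  unfolding smooth_on_def by (metis Ck_on.simps(2))

lemma smooth_on_const: "open S \<Longrightarrow> smooth_on S (\<lambda>x. c)"
  unfolding smooth_on_def using Ck_on_const by metis

lemma smooth_on_id: "open S \<Longrightarrow> smooth_on S (\<lambda>x. x)"
  unfolding smooth_on_def using Ck_on_id by metis

lemma smooth_on_linear: "bounded_linear L \<Longrightarrow> open S \<Longrightarrow> smooth_on S f \<Longrightarrow> smooth_on S (\<lambda>x. L (f x))"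
  unfolding smooth_on_def by (intro allI, rule Ck_on_linear) auto

lemma smooth_on_add: "open S \<Longrightarrow> smooth_on S f \<Longrightarrow> smooth_on S g \<Longrightarrow> smooth_on S (\<lambda>x. f x + g x)"
  unfolding smooth_on_def by (intro allI, rule Ck_on_add) auto

lemma smooth_on_scaleR:
  "open S \<Longrightarrow> smooth_on S u \<Longrightarrow> smooth_on S f \<Longrightarrow> smooth_on S (\<lambda>x. u x *\<^sub>R f x)"
  unfolding smooth_on_def by (intro allI, rule Ck_on_scaleR) auto

lemma smooth_on_compose:
  fixes g :: "'e::euclidean_space \<Rightarrow> 'h::euclidean_space"
  shows "open S \<Longrightarrow> open T \<Longrightarrow> smooth_on S g \<Longrightarrow> g ` S \<subseteq> T \<Longrightarrow> smooth_on T f \<Longrightarrow> smooth_on S (\<lambda>x. f (g x))"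
  unfolding smooth_on_def by (intro allI, rule Ck_on_compose) auto

text \<open>A product rule for linear maps \<open>F x\<close> evaluated at a moving vector. Only the
  derivatives of \<open>F x u\<close> for fixed \<open>u\<close> are given, so \<open>A x\<close> is
  expanded in the basis and its coefficients are differentiated.\<close>

lemma has_derivative_apply_family:
  fixes F :: "'x::real_normed_vector \<Rightarrow> 'e::euclidean_space \<Rightarrow> 'f::real_normed_vector"
  assumes S: "open S" "x0 \<in> S" and lin: "\<And>x. x \<in> S \<Longrightarrow> linear (F x)"
    and F: "\<And>u. ((\<lambda>x. F x u) has_derivative (\<lambda>w. F' w u)) (at x0)"
    and A: "(A has_derivative A') (at x0)" and lin': "\<And>w. linear (F' w)"
  shows "((\<lambda>x. F x (A x)) has_derivative (\<lambda>w. F' w (A x0) + F x0 (A' w))) (at x0)"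
proof -
  have "((\<lambda>x. \<Sum>i\<in>Basis. (A x \<bullet> i) *\<^sub>R F x i) has_derivative
      (\<lambda>w. \<Sum>i\<in>Basis. (A x0 \<bullet> i) *\<^sub>R F' w i + (A' w \<bullet> i) *\<^sub>R F x0 i)) (at x0)"
    by (intro has_derivative_sum has_derivative_scaleR F
        bounded_linear.has_derivative[OF bounded_linear_inner_left A])
  moreover have "(\<lambda>w. \<Sum>i\<in>Basis. (A x0 \<bullet> i) *\<^sub>R F' w i + (A' w \<bullet> i) *\<^sub>R F x0 i) =
      (\<lambda>w. F' w (A x0) + F x0 (A' w))"
    by (rule ext, unfold sum.distrib, rule arg_cong2[where f = "(+)"])
      (rule linear_eq_sum_Basis[OF lin', symmetric], rule linear_eq_sum_Basis[OF lin[OF S(2)], symmetric])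
  ultimately have "((\<lambda>x. \<Sum>i\<in>Basis. (A x \<bullet> i) *\<^sub>R F x i) has_derivative
      (\<lambda>w. F' w (A x0) + F x0 (A' w))) (at x0)" by (simp only:)
  then show ?thesis
    by (rule has_derivative_transform_within_open[OF _ S]) (rule linear_eq_sum_Basis[OF lin, symmetric])
qed

text \<open>For functions that are explicit along one line only: the warped metric is understood
  along pure base and pure fibre directions.\<close>

lemma has_derivative_along_line:
  fixes F :: "'x::real_normed_vector \<Rightarrow> real"
  assumes F: "(F has_derivative F') (at x0)" and k: "(k has_real_derivative d) (at 0)"
    and eq: "\<forall>\<^sub>F t in nhds 0. F (x0 + t *\<^sub>R w) = k t"
  shows "F' w = d"
proof -
  have "((\<lambda>t. x0 + t *\<^sub>R w) has_derivative (\<lambda>t. t *\<^sub>R w)) (at (0::real))"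
    by (auto intro!: derivative_eq_intros)
  then have "((\<lambda>t. F (x0 + t *\<^sub>R w)) has_derivative (\<lambda>t. F' (t *\<^sub>R w))) (at 0)"
    by (rule has_derivative_compose) (use F in simp)
  moreover have "(\<lambda>t. F' (t *\<^sub>R w)) = (\<lambda>t. F' w * t)"
    using linear_cmul[OF has_derivative_linear[OF F]] by (simp add: mult.commute)
  ultimately have "((\<lambda>t. F (x0 + t *\<^sub>R w)) has_real_derivative F' w) (at 0)"
    by (simp add: has_field_derivative_def)
  moreover have "((\<lambda>t. F (x0 + t *\<^sub>R w)) has_real_derivative d) (at 0)"
    using k DERIV_cong_ev[OF refl eq refl] by simp
  ultimately show ?thesis by (rule DERIV_unique)
qed

lemma line_in_open:
  fixes x0 :: "'x::real_normed_vector"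
  assumes "open S" "x0 \<in> S"
  shows "\<forall>\<^sub>F t in nhds (0::real). x0 + t *\<^sub>R w \<in> S"
proof -
  have "((\<lambda>t::real. x0 + t *\<^sub>R w) \<longlongrightarrow> x0 + 0 *\<^sub>R w) (nhds 0)"
    by (intro tendsto_intros filterlim_ident)
  then have "((\<lambda>t::real. x0 + t *\<^sub>R w) \<longlongrightarrow> x0) (nhds 0)" by simp
  then show ?thesis using assms by (rule topological_tendstoD)
qed

text \<open>Schwarz: only the differentiability of the first partial derivatives at the point is needed. Both
  mixed derivatives are the limit of the second difference quotient, by the mean value theorem.\<close>

lemma second_difference_quotient:
  fixes f :: "'x::real_normed_vector \<Rightarrow> real"
  assumes S: "open S" "x0 \<in> S" and f: "\<And>x. x \<in> S \<Longrightarrow> (f has_derivative f' x) (at x)"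
    and Du: "((\<lambda>x. f' x u) has_derivative Du) (at x0)" and "e > 0"
  shows "\<forall>\<^sub>F t in at_right 0. \<bar>f (x0 + t *\<^sub>R u + t *\<^sub>R v) - f (x0 + t *\<^sub>R u) - f (x0 + t *\<^sub>R v) + f x0
      - t\<^sup>2 * Du v\<bar> \<le> e * t\<^sup>2"
proof -
  \<comment> \<open>The points of the parallelogram lie within \<open>t * M\<close> of
    \<open>x0\<close>. The error \<open>e / M\<close> enters twice, through \<open>R t\<close> and
    \<open>R 0\<close>, hence the factor 2; the summand 1 keeps \<open>M\<close> positive when
    \<open>u\<close> and \<open>v\<close> vanish.\<close>
  define M where "M = 2 * (norm u + norm v) + 1"
  have M: "M > 0" unfolding M_def by (simp add: add_nonneg_pos)
  have e': "e / M > 0" using \<open>e > 0\<close> M by simp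
  obtain r where r: "r > 0" "ball x0 r \<subseteq> S" using S open_contains_ball by blast
  obtain d where d: "d > 0" "\<And>y. norm (y - x0) < d \<Longrightarrow>
      norm (f' y u - f' x0 u - Du (y - x0)) \<le> e / M * norm (y - x0)"
    using Du e' unfolding has_derivative_at_alt by meson
  note lin = has_derivative_linear[OF Du]
  define t0 where "t0 = min r d / M"
  have t0: "t0 > 0" using r d M unfolding t0_def by simp
  show ?thesis
    unfolding eventually_at_right_field
  proof (intro exI[of _ t0] conjI allI impI t0)
    fix t :: real assume t: "0 < t" "t < t0"
    have tM: "t * M < r" "t * M < d"
      using t(2) M unfolding t0_def by (simp_all add: field_simps)
    have nb: "norm (s *\<^sub>R u + k *\<^sub>R v) \<le> t * (norm u + norm v)" if "0 \<le> s" "s \<le> t" "0 \<le> k" "k \<le> t" for s k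
    proof -
      have "norm (s *\<^sub>R u + k *\<^sub>R v) \<le> s * norm u + k * norm v"
        using norm_triangle_ineq[of "s *\<^sub>R u" "k *\<^sub>R v"] that by simp
      also have "\<dots> \<le> t * norm u + t * norm v" using that by (intro add_mono mult_right_mono) auto
      finally show ?thesis by (simp add: algebra_simps)
    qed
    have nM: "t * (norm u + norm v) < t * M"
      using t(1) unfolding M_def by (intro mult_strict_left_mono) (auto simp: add_nonneg_pos)
    have inS: "x0 + (s *\<^sub>R u + k *\<^sub>R v) \<in> S" if "0 \<le> s" "s \<le> t" "0 \<le> k" "k \<le> t" for s k
    proof -
      have "norm (s *\<^sub>R u + k *\<^sub>R v) < r" using nb[OF that] nM tM by linarith
      then have "x0 + (s *\<^sub>R u + k *\<^sub>R v) \<in> ball x0 r"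
        by (metis add_diff_cancel_left' dist_commute dist_norm mem_ball)
      then show ?thesis using r(2) by blast
    qed
    \<comment> \<open>The second difference is the increment of this function over
      \<open>[0, t]\<close>, so the mean value theorem in direction \<open>u\<close> reduces it to
      first derivatives.\<close>
    define \<phi> where "\<phi> s = f (x0 + (s *\<^sub>R u + t *\<^sub>R v)) - f (x0 + (s *\<^sub>R u + 0 *\<^sub>R v))" for s
    have der: "((\<lambda>s. f (x0 + (s *\<^sub>R u + k *\<^sub>R v))) has_real_derivative f' (x0 + (s *\<^sub>R u + k *\<^sub>R v)) u) (at s)"
      if "0 \<le> s" "s \<le> t" "0 \<le> k" "k \<le> t" for s k
    proof -
      have 1: "((\<lambda>s. x0 + (s *\<^sub>R u + k *\<^sub>R v)) has_derivative (\<lambda>h. h *\<^sub>R u)) (at s)"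
        by (auto intro!: derivative_eq_intros)
      have "((\<lambda>s. f (x0 + (s *\<^sub>R u + k *\<^sub>R v))) has_derivative (\<lambda>h. f' (x0 + (s *\<^sub>R u + k *\<^sub>R v)) (h *\<^sub>R u))) (at s)"
        by (rule has_derivative_compose[OF 1 f[OF inS[OF that]]])
      then show ?thesis
        using linear_cmul[OF has_derivative_linear[OF f[OF inS[OF that]]]]
        by (simp add: has_field_derivative_def mult.commute[of _ "f' _ u"] cong: if_cong)
    qed
    have "\<exists>z. 0 < z \<and> z < t \<and> \<phi> t - \<phi> 0 = (t - 0) * (f' (x0 + (z *\<^sub>R u + t *\<^sub>R v)) u - f' (x0 + (z *\<^sub>R u + 0 *\<^sub>R v)) u)"
      unfolding \<phi>_def
      by (rule MVT2[OF t(1)]) (intro DERIV_diff der, use t in auto)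
    then obtain z where z: "0 < z" "z < t"
      and eq: "\<phi> t - \<phi> 0 = t * (f' (x0 + (z *\<^sub>R u + t *\<^sub>R v)) u - f' (x0 + (z *\<^sub>R u + 0 *\<^sub>R v)) u)" by auto
    define R where "R k = f' (x0 + (z *\<^sub>R u + k *\<^sub>R v)) u - f' x0 u - Du (z *\<^sub>R u + k *\<^sub>R v)" for k
    have R: "\<bar>R k\<bar> \<le> e / M * (t * (norm u + norm v))" if "0 \<le> k" "k \<le> t" for k
    proof -
      have n: "norm (z *\<^sub>R u + k *\<^sub>R v) \<le> t * (norm u + norm v)" using nb z that by simp
      then have "norm (x0 + (z *\<^sub>R u + k *\<^sub>R v) - x0) < d" using nM tM by simp
      from d(2)[OF this] have "\<bar>R k\<bar> \<le> e / M * norm (z *\<^sub>R u + k *\<^sub>R v)" unfolding R_def by simp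
      also have "\<dots> \<le> e / M * (t * (norm u + norm v))" using n e' by (intro mult_left_mono) auto
      finally show ?thesis .
    qed
    have "\<phi> t - \<phi> 0 = t * (Du (t *\<^sub>R v) + (R t - R 0))"
      unfolding eq R_def using linear_add[OF lin, of "z *\<^sub>R u" "t *\<^sub>R v"] by (simp add: algebra_simps)
    then have "\<phi> t - \<phi> 0 - t\<^sup>2 * Du v = t * (R t - R 0)"
      by (simp add: linear_cmul[OF lin] power2_eq_square algebra_simps)
    then have "\<bar>\<phi> t - \<phi> 0 - t\<^sup>2 * Du v\<bar> = t * \<bar>R t - R 0\<bar>" using t by (simp add: abs_mult)
    also have "\<dots> \<le> t * (2 * (e / M * (t * (norm u + norm v))))"
      using R[of t] R[of 0] t by (intro mult_left_mono) auto
    also have "\<dots> = e * t\<^sup>2 * (2 * (norm u + norm v) / M)" by (simp add: power2_eq_square)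
    also have "\<dots> \<le> e * t\<^sup>2 * 1"
      using M \<open>e > 0\<close> by (intro mult_left_mono) (simp_all add: M_def)
    finally show "\<bar>f (x0 + t *\<^sub>R u + t *\<^sub>R v) - f (x0 + t *\<^sub>R u) - f (x0 + t *\<^sub>R v) + f x0
      - t\<^sup>2 * Du v\<bar> \<le> e * t\<^sup>2"
      unfolding \<phi>_def by (simp add: algebra_simps)
  qed
qed

lemma second_derivative_symmetric_real:
  fixes f :: "'x::real_normed_vector \<Rightarrow> real"
  assumes S: "open S" "x0 \<in> S" and f: "\<And>x. x \<in> S \<Longrightarrow> (f has_derivative f' x) (at x)"
    and Du: "((\<lambda>x. f' x u) has_derivative Du) (at x0)" and Dv: "((\<lambda>x. f' x v) has_derivative Dv) (at x0)"
  shows "Du v = Dv u"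
proof -
  have "\<bar>Du v - Dv u\<bar> \<le> 0 + e" if "e > 0" for e
  proof -
    have e2: "e / 2 > 0" using that by simp
    have q1: "\<forall>\<^sub>F t in at_right 0. \<bar>f (x0 + t *\<^sub>R u + t *\<^sub>R v) - f (x0 + t *\<^sub>R u) - f (x0 + t *\<^sub>R v) + f x0
      - t\<^sup>2 * Du v\<bar> \<le> e / 2 * t\<^sup>2"
      by (rule second_difference_quotient[where f = f and f' = f', OF S _ Du e2]) (rule f)
    have q2: "\<forall>\<^sub>F t in at_right 0. \<bar>f (x0 + t *\<^sub>R v + t *\<^sub>R u) - f (x0 + t *\<^sub>R v) - f (x0 + t *\<^sub>R u) + f x0
      - t\<^sup>2 * Dv u\<bar> \<le> e / 2 * t\<^sup>2"
      by (rule second_difference_quotient[where f = f and f' = f', OF S _ Dv e2]) (rule f)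
    have "\<forall>\<^sub>F t in at_right (0::real). \<bar>Du v - Dv u\<bar> \<le> e"
      using q1 q2 eventually_at_right_less[of 0]
    proof eventually_elim
      case (elim t)
      have "\<bar>t\<^sup>2 * Du v - t\<^sup>2 * Dv u\<bar> \<le> e * t\<^sup>2"
      proof -
        have c: "x0 + t *\<^sub>R v + t *\<^sub>R u = x0 + t *\<^sub>R u + t *\<^sub>R v" by simp
        show ?thesis using elim(1,2) unfolding c abs_le_iff by linarith
      qed
      moreover have "\<bar>t\<^sup>2 * Du v - t\<^sup>2 * Dv u\<bar> = t\<^sup>2 * \<bar>Du v - Dv u\<bar>"
        by (simp add: abs_mult flip: right_diff_distrib)
      ultimately have "t\<^sup>2 * \<bar>Du v - Dv u\<bar> \<le> t\<^sup>2 * e" by (simp add: mult.commute)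
      then show ?case using elim(3) by simp
    qed
    then show ?thesis using eventually_happens[of _ "at_right (0::real)"] by (auto simp: trivial_limit_at_right_real)
  qed
  then have "\<bar>Du v - Dv u\<bar> \<le> 0" by (rule field_le_epsilon)
  then show ?thesis by simp
qed

lemma second_derivative_symmetric:
  fixes f :: "'x::real_normed_vector \<Rightarrow> 'e::euclidean_space"
  assumes S: "open S" "x0 \<in> S" and f: "\<And>x. x \<in> S \<Longrightarrow> (f has_derivative f' x) (at x)"
    and Du: "((\<lambda>x. f' x u) has_derivative Du) (at x0)" and Dv: "((\<lambda>x. f' x v) has_derivative Dv) (at x0)"
  shows "Du v = Dv u"
proof (rule euclidean_eqI)
  fix i :: 'e assume "i \<in> Basis"
  note I = bounded_linear.has_derivative[OF bounded_linear_inner_left[of i]]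
  show "Du v \<bullet> i = Dv u \<bullet> i"
    by (rule second_derivative_symmetric_real[where f = "\<lambda>x. f x \<bullet> i" and f' = "\<lambda>x w. f' x w \<bullet> i", OF S _ I[OF Du] I[OF Dv]]) (rule I[OF f])
qed

section \<open>Orthonormal bases\<close>

text \<open>The inner product carried by the type serves for coordinates only. The metric at a point
  is another positive definite form, so orthonormality is developed relative to
  \<open>G\<close>.\<close>

locale inner_form =
  fixes G :: "'e::euclidean_space \<Rightarrow> 'e \<Rightarrow> real"
  assumes bilin: "bilinear G"
    and sym: "G v w = G w v"
    and pos: "v \<noteq> 0 \<Longrightarrow> G v v > 0"
begin

lemma add_left: "G (x + y) z = G x z + G y z" by (rule bilinear_ladd[OF bilin])
lemma add_right: "G z (x + y) = G z x + G z y" by (rule bilinear_radd[OF bilin])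
lemma diff_left: "G (x - y) z = G x z - G y z" by (rule bilinear_lsub[OF bilin])
lemma diff_right: "G z (x - y) = G z x - G z y" by (rule bilinear_rsub[OF bilin])
lemma minus_left: "G (- x) z = - G x z" by (rule bilinear_lneg[OF bilin])
lemma minus_right: "G z (- x) = - G z x" by (rule bilinear_rneg[OF bilin])
lemma scale_left: "G (r *\<^sub>R x) z = r * G x z" using bilinear_lmul[OF bilin] by simp
lemma scale_right: "G z (r *\<^sub>R x) = r * G z x" using bilinear_rmul[OF bilin] by simp
lemma zero_left [simp]: "G 0 z = 0" by (rule bilinear_lzero[OF bilin])
lemma zero_right [simp]: "G z 0 = 0" by (rule bilinear_rzero[OF bilin])
lemma sum_left: "G (sum f I) z = (\<Sum>i\<in>I. G (f i) z)"
  using linear_sum[of "\<lambda>x. G x z"] bilin unfolding bilinear_def by blast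
lemma sum_right: "G z (sum f I) = (\<Sum>i\<in>I. G z (f i))"
  using linear_sum[of "G z"] bilin unfolding bilinear_def by blast

lemmas form_simps = add_left add_right diff_left diff_right minus_left minus_right
  scale_left scale_right

lemma nonneg: "G v v \<ge> 0"
  using pos[of v] by (cases "v = 0") auto

lemma eq_zero_iff: "G v v = 0 \<longleftrightarrow> v = 0"
  by (metis pos less_irrefl zero_left)

text \<open>Relative to a subspace, since \<open>D1\<close>, \<open>D2\<close> and the whole tangent
  space each need such a basis.\<close>

definition onb :: "'e set \<Rightarrow> 'e set \<Rightarrow> bool" where
  "onb S E \<longleftrightarrow> (\<forall>x\<in>E. \<forall>y\<in>E. G x y = (if x = y then 1 else 0)) \<and> span E = S"

lemma onb_UNIV: "onb UNIV E \<longleftrightarrow> orthonormal_basis G E"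
  unfolding onb_def orthonormal_basis_def by simp

lemma orthonormal_independent:
  assumes "\<forall>x\<in>E. \<forall>y\<in>E. G x y = (if x = y then 1 else 0)"
  shows "independent E"
  unfolding dependent_explicit
proof (rule notI, elim exE conjE bexE)
  fix F u v assume F: "finite F" "F \<subseteq> E" "v \<in> F" "u v \<noteq> 0" and s: "(\<Sum>w\<in>F. u w *\<^sub>R w) = 0"
  have "0 = (\<Sum>w\<in>F. G (u w *\<^sub>R w) v)" using s by (simp flip: sum_left)
  also have "\<dots> = (\<Sum>w\<in>F. if w = v then u w else 0)"
    by (rule sum.cong) (use assms F in \<open>auto simp: scale_left subset_iff\<close>)
  also have "\<dots> = u v" using F by simp
  finally show False using F by simp
qed

lemma onb_finite: "onb S E \<Longrightarrow> finite E"
  unfolding onb_def by (intro independent_imp_finite orthonormal_independent) simp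

lemma onb_card: "onb S E \<Longrightarrow> card E = dim S"
  using dim_span_eq_card_independent[OF orthonormal_independent, of E] unfolding onb_def by simp

lemma onb_mem: "onb S E \<Longrightarrow> e \<in> E \<Longrightarrow> e \<in> S"
  unfolding onb_def using span_base by blast

lemma onb_self: "onb S E \<Longrightarrow> e \<in> E \<Longrightarrow> e' \<in> E \<Longrightarrow> G e e' = (if e = e' then 1 else 0)"
  unfolding onb_def by blast

lemma onb_expand:
  assumes "onb S E" "x \<in> S"
  shows "x = (\<Sum>e\<in>E. G x e *\<^sub>R e)"
proof -
  have fin: "finite E" using onb_finite assms by blast
  have "x \<in> range (\<lambda>u. \<Sum>e\<in>E. u e *\<^sub>R e)"
    using assms span_finite[OF fin] unfolding onb_def by simp
  then obtain u where u: "x = (\<Sum>e\<in>E. u e *\<^sub>R e)" by blast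
  have "G x e = u e" if "e \<in> E" for e
  proof -
    have "G x e = (\<Sum>w\<in>E. if w = e then u w else 0)"
      unfolding u sum_left
      by (rule sum.cong) (use onb_self[OF assms(1)] that in \<open>auto simp: scale_left\<close>)
    then show ?thesis using fin that by simp
  qed
  then have "(\<Sum>e\<in>E. G x e *\<^sub>R e) = (\<Sum>e\<in>E. u e *\<^sub>R e)" by (intro sum.cong) auto
  then show ?thesis using u by simp
qed

lemma onb_parseval:
  assumes "onb S E" "x \<in> S"
  shows "(\<Sum>e\<in>E. G x e * G y e) = G x y"
proof -
  have "G x y = G (\<Sum>e\<in>E. G x e *\<^sub>R e) y" using onb_expand[OF assms] by simp
  also have "\<dots> = (\<Sum>e\<in>E. G x e * G y e)"
    unfolding sum_left by (rule sum.cong) (simp_all add: scale_left scale_right sym[of _ y])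
  finally show ?thesis by simp
qed

text \<open>One Gram-Schmidt step per vector: either the remainder \<open>a'\<close> is zero and the
  span does not grow, or it is normalised and added.\<close>

lemma onb_exists_span:
  assumes "finite B"
  shows "\<exists>E. onb (span B) E"
  using assms
proof (induction B rule: finite_induct)
  case empty
  then show ?case unfolding onb_def by (intro exI[of _ "{}"]) auto
next
  case (insert a B)
  then obtain E where E: "onb (span B) E" by blast
  have fin: "finite E" using onb_finite E by blast
  have spE: "span E = span B" using E unfolding onb_def by blast
  define a' where "a' = a - (\<Sum>e\<in>E. G a e *\<^sub>R e)"
  have P: "(\<Sum>e\<in>E. G a e *\<^sub>R e) \<in> span E"
    by (intro span_sum span_scale span_base)
  have orth: "G a' e = 0" if "e \<in> E" for e
  proof -
    have "(\<Sum>w\<in>E. G (G a w *\<^sub>R w) e) = (\<Sum>w\<in>E. if w = e then G a w else 0)"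
      by (rule sum.cong) (use onb_self[OF E] that in \<open>auto simp: scale_left\<close>)
    then show ?thesis unfolding a'_def diff_left sum_left using fin that by simp
  qed
  have sp: "span (insert a B) = span (insert a' E)"
  proof -
    have "span (insert a B) = span (insert a E)"
      using spE by (simp add: span_insert)
    also have "\<dots> = span (insert a' E)"
      by (rule eq_span_insert_eq) (use P in \<open>simp add: a'_def\<close>)
    finally show ?thesis .
  qed
  show ?case
  proof (cases "a' = 0")
    case True
    then have "span (insert a B) = span E" using sp span_redundant[of 0 E] by (simp add: span_zero)
    then show ?thesis using E spE by auto
  next
    case False
    define n where "n = sqrt (G a' a')"
    have n: "n > 0" "n * n = G a' a'" using pos[OF False] nonneg[of a'] unfolding n_def by auto
    define c where "c = (1 / n) *\<^sub>R a'"
    have "span (insert c E) = span (insert a' E)"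
    proof (rule span_eq[THEN iffD2], intro conjI subsetI)
      fix x assume "x \<in> insert c E"
      then show "x \<in> span (insert a' E)"
        unfolding c_def by (metis insertE insertI1 insertI2 span_base span_scale)
    next
      fix x assume "x \<in> insert a' E"
      moreover have "a' = n *\<^sub>R c" using n unfolding c_def by simp
      ultimately show "x \<in> span (insert c E)"
        by (metis insertE insertI1 insertI2 span_base span_scale)
    qed
    with sp have sp': "span (insert a B) = span (insert c E)" by simp
    have cc: "G c c = 1" using n unfolding c_def by (simp add: scale_left scale_right flip: n(2))
    have c0: "G c e = 0" if "e \<in> E" for e
      using orth[OF that] unfolding c_def by (simp add: scale_left)
    have c1: "G e c = 0" if "e \<in> E" for e
      using c0[OF that] sym[of e c] by simp
    have "c \<notin> E" using c0[of c] cc by auto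
    then have "onb (span (insert a B)) (insert c E)"
      unfolding onb_def sp' using cc c0 c1 onb_self[OF E] by auto
    then show ?thesis by blast
  qed
qed

lemma onb_exists:
  assumes "subspace S"
  obtains E where "onb S E"
proof -
  obtain B where "B \<subseteq> S" "independent B" "S \<subseteq> span B" using maximal_independent_subset by blast
  then have "finite B" "span B = S"
    using independent_imp_finite assms span_minimal by blast+
  then show ?thesis using onb_exists_span that by metis
qed

text \<open>\<open>sff_norm_sq\<close> sums over a basis picked by \<open>SOME\<close>; this lemma
  exchanges it for one adapted to \<open>D1\<close> and \<open>D2\<close>. After expansion in
  \<open>F\<close>, the sum over \<open>E\<close> collapses by Parseval.\<close>

lemma trace_onb:
  fixes Q :: "'e \<Rightarrow> 'e \<Rightarrow> real"
  assumes Q: "bilinear Q" and E: "onb S E" and F: "onb S F"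
  shows "(\<Sum>x\<in>E. Q x x) = (\<Sum>x\<in>F. Q x x)"
proof -
  have lin: "linear (\<lambda>x. Q x z)" "linear (Q z)" for z using Q unfolding bilinear_def by auto
  have expand: "Q x y = (\<Sum>a\<in>F. \<Sum>b\<in>F. G x a * G y b * Q a b)" if "x \<in> S" "y \<in> S" for x y
  proof -
    have "Q x y = Q (\<Sum>a\<in>F. G x a *\<^sub>R a) (\<Sum>b\<in>F. G y b *\<^sub>R b)"
      using onb_expand[OF F that(1)] onb_expand[OF F that(2)] by simp
    also have "\<dots> = (\<Sum>a\<in>F. \<Sum>b\<in>F. G x a * G y b * Q a b)"
      unfolding linear_sum[OF lin(1)] linear_sum[OF lin(2)] linear_cmul[OF lin(1)]
          linear_cmul[OF lin(2)] by (subst sum.swap) (simp add: sum_distrib_left mult.assoc mult.left_commute)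
    finally show ?thesis .
  qed
  have "(\<Sum>x\<in>E. Q x x) = (\<Sum>x\<in>E. \<Sum>a\<in>F. \<Sum>b\<in>F. G x a * G x b * Q a b)"
    by (rule sum.cong[OF refl], rule expand) (use onb_mem[OF E] in auto)
  also have "\<dots> = (\<Sum>a\<in>F. \<Sum>x\<in>E. \<Sum>b\<in>F. G x a * G x b * Q a b)"
    by (rule sum.swap)
  also have "\<dots> = (\<Sum>a\<in>F. \<Sum>b\<in>F. \<Sum>x\<in>E. G x a * G x b * Q a b)"
    by (rule sum.cong[OF refl], rule sum.swap)
  also have "\<dots> = (\<Sum>a\<in>F. \<Sum>b\<in>F. if b = a then Q a b else 0)"
  proof (intro sum.cong refl)
    fix a b assume ab: "a \<in> F" "b \<in> F"
    have "(\<Sum>x\<in>E. G x a * G x b * Q a b) = (\<Sum>x\<in>E. G a x * G b x) * Q a b"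
      by (simp add: sum_distrib_right sym)
    also have "\<dots> = G a b * Q a b" using onb_parseval[OF E onb_mem[OF F ab(1)]] by simp
    finally show "(\<Sum>x\<in>E. G x a * G x b * Q a b) = (if b = a then Q a b else 0)"
      using onb_self[OF F ab] by auto
  qed
  also have "\<dots> = (\<Sum>a\<in>F. Q a a)" using onb_finite[OF F] by simp
  finally show ?thesis .
qed

lemma cauchy_schwarz: "(G x y)\<^sup>2 \<le> G x x * G y y"
proof (cases "y = 0")
  case False
  have p: "G y y > 0" using pos[OF False] .
  have "0 \<le> G (G y y *\<^sub>R x - G x y *\<^sub>R y) (G y y *\<^sub>R x - G x y *\<^sub>R y)" by (rule nonneg)
  also have "\<dots> = G y y * (G x x * G y y - (G x y)\<^sup>2)"
    by (simp add: form_simps sym[of y x] algebra_simps power2_eq_square)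
  finally show ?thesis using p by (simp add: zero_le_mult_iff)
qed simp

end

section \<open>Pointwise geometry of a semi-slant tangent space\<close>

locale almost_contact_space = inner_form g for g :: "'n::euclidean_space \<Rightarrow> 'n \<Rightarrow> real" +
  fixes \<phi> :: "'n \<Rightarrow> 'n" and \<xi> :: 'n and \<eta> :: "'n \<Rightarrow> real"
  assumes phi_linear: "linear \<phi>"
    and eta_linear: "linear \<eta>"
    and phi_phi: "\<phi> (\<phi> v) = - v + \<eta> v *\<^sub>R \<xi>"
    and eta_xi: "\<eta> \<xi> = 1"
    and g_phi_phi: "g (\<phi> v) (\<phi> w) = g v w - \<eta> v * \<eta> w"
begin

text \<open>Applying \<open>\<phi>\<close> twice to \<open>\<xi>\<close> gives zero; the third
  application shows that \<open>\<phi> \<xi>\<close> is a multiple of \<open>\<xi>\<close>. Applying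
  \<open>\<phi>\<close> to this relation makes the factor or \<open>\<phi> \<xi>\<close> itself
  vanish.\<close>

lemma phi_xi: "\<phi> \<xi> = 0"
proof -
  have 0: "\<phi> (\<phi> \<xi>) = 0" by (simp add: phi_phi eta_xi)
  have 1: "\<phi> (\<phi> (\<phi> \<xi>)) = 0" by (simp add: 0 linear_0[OF phi_linear])
  have 2: "\<phi> \<xi> = \<eta> (\<phi> \<xi>) *\<^sub>R \<xi>" using 1 phi_phi[of "\<phi> \<xi>"] by simp
  have "\<phi> (\<phi> \<xi>) = \<eta> (\<phi> \<xi>) *\<^sub>R \<phi> \<xi>"
    using arg_cong[OF 2, of \<phi>] by (simp add: linear_cmul[OF phi_linear])
  then have "\<eta> (\<phi> \<xi>) = 0 \<or> \<phi> \<xi> = 0" using 0 by simp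
  then show ?thesis using 2 by auto
qed

lemma eta_eq: "\<eta> v = g v \<xi>"
  using g_phi_phi[of v \<xi>] by (simp add: phi_xi eta_xi)

lemma xi_nz: "\<xi> \<noteq> 0"
  using eta_xi linear_0[OF eta_linear] by auto

text \<open>Threefold application of \<open>\<phi>\<close> to \<open>v\<close> is evaluated in two
  ways; the results differ by a multiple of the nonzero vector \<open>\<xi>\<close>.\<close>

lemma eta_phi: "\<eta> (\<phi> v) = 0"
proof -
  have "\<phi> (- v + \<eta> v *\<^sub>R \<xi>) = - \<phi> v + \<eta> (\<phi> v) *\<^sub>R \<xi>" using phi_phi[of "\<phi> v"] by (simp add: phi_phi)
  then have "\<eta> (\<phi> v) *\<^sub>R \<xi> = 0"
    by (simp add: linear_diff[OF phi_linear] linear_cmul[OF phi_linear] phi_xi)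
  then show ?thesis using xi_nz by simp
qed

text \<open>The compatibility of \<open>g\<close> with \<open>\<phi>\<close>, taken at
  \<open>v\<close> and \<open>\<phi> w\<close>; the terms with \<open>\<eta>\<close> drop out by
  \<open>eta_phi\<close>.\<close>

lemma phi_skew: "g (\<phi> v) w = - g v (\<phi> w)"
  using g_phi_phi[of v "\<phi> w"] by (simp add: phi_phi eta_phi form_simps eta_eq[symmetric])

end

text \<open>The linear data of the submanifold at one point. \<open>L\<close> is the differential of
  the immersion; \<open>D1\<close> and \<open>D2\<close> live in its domain, not in the ambient
  space.\<close>

locale semi_slant_space = almost_contact_space g \<phi> \<xi> \<eta>
  for g :: "'n::euclidean_space \<Rightarrow> 'n \<Rightarrow> real" and \<phi> \<xi> \<eta> +
  fixes L :: "'e::euclidean_space \<Rightarrow> 'n" and D1 D2 :: "'e set" and \<theta> :: real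
  assumes L_linear: "linear L" and L_inj: "inj L"
    and D1_subspace: "subspace D1"
    and D2_eq: "D2 = {w. \<forall>v\<in>D1. g (L v) (L w) = 0}"
    and D_sum: "{v + w | v w. v \<in> D1 \<and> w \<in> D2} = UNIV"
    and D2_nontrivial: "D2 \<noteq> {0}"
    and phi_D1: "\<phi> ` L ` D1 \<subseteq> L ` D1"
    and slant: "\<And>X. X \<in> D2 \<Longrightarrow> X \<noteq> 0 \<Longrightarrow> subspace_angle g (\<phi> (L X)) (L ` D2) = \<theta>"
    and theta_pos: "0 < \<theta>" and theta_less: "\<theta> < pi / 2"
    and xi_range: "\<xi> \<in> range L"
begin

section \<open>The induced form and the tangential and normal projections\<close>

definition G :: "'e \<Rightarrow> 'e \<Rightarrow> real" where "G x y = g (L x) (L y)"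

lemma L_simps: "L (x + y) = L x + L y" "L (x - y) = L x - L y" "L (- x) = - L x"
   "L (r *\<^sub>R x) = r *\<^sub>R L x" "L 0 = 0"
  using L_linear by (simp_all add: linear_add linear_diff linear_neg linear_cmul linear_0)

sublocale T: inner_form G
proof
  have 1: "g (L (x + y)) z = g (L x) z + g (L y) z" "g z (L (x + y)) = g z (L x) + g z (L y)"
    "g (L (r *\<^sub>R x)) z = r *\<^sub>R g (L x) z" "g z (L (r *\<^sub>R x)) = r *\<^sub>R g z (L x)" for x y z r
    by (simp_all add: L_simps form_simps)
  show "bilinear G"
    unfolding bilinear_def G_def by (intro conjI allI linearI 1)
  show "G v w = G w v" for v w unfolding G_def by (rule sym)
  show "G v v > 0" if "v \<noteq> 0" for v
    unfolding G_def using that L_inj L_simps(5) by (intro pos) (metis injD)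
qed

lemma D2_subspace: "subspace D2"
  unfolding D2_eq by (rule subspaceI) (auto simp: L_simps form_simps)

lemma D_orth: "v \<in> D1 \<Longrightarrow> w \<in> D2 \<Longrightarrow> G v w = 0" "v \<in> D1 \<Longrightarrow> w \<in> D2 \<Longrightarrow> G w v = 0"
  unfolding D2_eq G_def by (auto simp: sym)

lemma D_decomp: obtains v w where "v \<in> D1" "w \<in> D2" "x = v + w"
  using D_sum by blast

lemma D2I: "(\<And>v. v \<in> D1 \<Longrightarrow> G v w = 0) \<Longrightarrow> w \<in> D2"
  unfolding D2_eq G_def by simp

lemma D1I:
  assumes "\<And>w. w \<in> D2 \<Longrightarrow> G x w = 0"
  shows "x \<in> D1"
proof -
  obtain v w where vw: "v \<in> D1" "w \<in> D2" "x = v + w" by (rule D_decomp)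
  have "G x w = G v w + G w w" by (simp add: vw T.add_left)
  then have "G w w = 0" using assms[OF vw(2)] D_orth(1)[OF vw(1,2)] by simp
  then have "w = 0" by (simp add: T.eq_zero_iff)
  then show ?thesis using vw by simp
qed

text \<open>The adjoint of \<open>L\<close>, that is, the tangential projection read back in the
  domain of \<open>L\<close>. The basis chosen does not matter, since \<open>G_tan_part\<close>
  determines the value.\<close>

definition tan_part :: "'n \<Rightarrow> 'e" where
  "tan_part V = (\<Sum>e\<in>(SOME E. T.onb UNIV E). g V (L e) *\<^sub>R e)"

lemma G_tan_part: "G (tan_part V) x = g V (L x)"
proof -
  define E where "E = (SOME E. T.onb UNIV E)"
  have E: "T.onb UNIV E" unfolding E_def by (rule someI_ex) (metis T.onb_exists subspace_UNIV)
  have "G (tan_part V) x = (\<Sum>e\<in>E. g V (L e) * G x e)"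
    unfolding tan_part_def E_def[symmetric] T.sum_left
    by (rule sum.cong) (simp_all add: T.scale_left T.sym[of x])
  also have "\<dots> = g V (\<Sum>e\<in>E. G x e *\<^sub>R L e)"
    unfolding sum_right by (rule sum.cong) (simp_all add: scale_right)
  also have "(\<Sum>e\<in>E. G x e *\<^sub>R L e) = L (\<Sum>e\<in>E. G x e *\<^sub>R e)"
    by (simp add: linear_sum[OF L_linear] L_simps)
  also have "\<dots> = L x" using T.onb_expand[OF E, of x] by simp
  finally show ?thesis .
qed

lemma form_eqI: "(\<And>z. G x z = G y z) \<Longrightarrow> x = y"
  using T.eq_zero_iff[of "x - y"] by (simp add: T.diff_left)

lemma tan_part_L: "tan_part (L x) = x"
  by (rule form_eqI) (simp only: G_tan_part, simp only: G_def)

lemma tan_part_linear: "linear tan_part"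
  by (rule linearI; rule form_eqI) (simp_all add: G_tan_part form_simps T.form_simps)

definition nor_part :: "'n \<Rightarrow> 'n" where "nor_part V = V - L (tan_part V)"

lemma nor_part_orth: "g (nor_part V) (L x) = 0" "g (L x) (nor_part V) = 0"
proof -
  show "g (nor_part V) (L x) = 0"
    using G_tan_part[of V x] unfolding nor_part_def by (simp add: diff_left G_def)
  then show "g (L x) (nor_part V) = 0" by (simp add: sym)
qed

lemma nor_part_linear: "linear nor_part"
  unfolding nor_part_def
  by (rule linearI) (simp_all add: linear_add[OF tan_part_linear] linear_cmul[OF tan_part_linear]
      L_simps algebra_simps)

lemma nor_part_L: "nor_part (L x) = 0"
  unfolding nor_part_def by (simp add: tan_part_L)

text \<open>Serves to evaluate the definite description in \<open>normal_part\<close>.\<close>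

lemma nor_part_unique:
  assumes "\<And>x. g W (L x) = 0" "V - W \<in> range L"
  shows "W = nor_part V"
proof -
  obtain y where y: "V - W = L y" using assms(2) by blast
  have "nor_part V = nor_part W"
    using linear_add[OF nor_part_linear, of W "L y"] y nor_part_L[of y] by (simp add: algebra_simps)
  moreover have "tan_part W = 0" by (rule form_eqI) (simp add: G_tan_part assms)
  ultimately show ?thesis unfolding nor_part_def by (simp add: L_simps)
qed

lemma phi_D1_ex: "x \<in> D1 \<Longrightarrow> \<exists>y\<in>D1. \<phi> (L x) = L y"
  using phi_D1 by blast

lemma g_phi_D1_D2: "x \<in> D1 \<Longrightarrow> z \<in> D2 \<Longrightarrow> g (\<phi> (L x)) (L z) = 0"
  using phi_D1_ex[of x] D_orth(1)[of _ z] unfolding G_def by auto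

text \<open>Otherwise every angle in the infimum would be \<open>arccos 0\<close>, and \<theta>
  would equal \<pi>/2.\<close>

lemma tan_part_phi_nonzero:
  assumes "X \<in> D2" "X \<noteq> 0"
  shows "\<exists>W\<in>D2. g (\<phi> (L X)) (L W) \<noteq> 0"
proof (rule ccontr)
  assume "\<not> ?thesis"
  then have 0: "g (\<phi> (L X)) (L W) = 0" if "W \<in> D2" for W using that by blast
  have "{vec_angle g (\<phi> (L X)) w | w. w \<in> L ` D2 \<and> w \<noteq> 0} = {pi / 2}"
  proof (rule set_eqI, rule iffI)
    fix t assume "t \<in> {vec_angle g (\<phi> (L X)) w | w. w \<in> L ` D2 \<and> w \<noteq> 0}"
    then show "t \<in> {pi / 2}" using 0 unfolding vec_angle_def by auto
  next
    \<comment> \<open>The infimum is \<pi>/2 only if the set of angles is nonempty; \<open>X\<close>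
      itself supplies an element.\<close>
    fix t assume "t \<in> {pi / 2}"
    then have "t = vec_angle g (\<phi> (L X)) (L X)" using 0[OF assms(1)] unfolding vec_angle_def by simp
    moreover have "L X \<noteq> 0" using assms(2) L_inj L_simps(5) by (metis injD)
    ultimately show "t \<in> {vec_angle g (\<phi> (L X)) w | w. w \<in> L ` D2 \<and> w \<noteq> 0}"
      using assms(1) by blast
  qed
  then have "\<theta> = pi / 2" using slant[OF assms] unfolding subspace_angle_def by simp
  then show False using theta_less by simp
qed

text \<open>If \<open>\<eta>\<close> vanished on \<open>D1\<close>, then \<open>\<xi>\<close> would lie in \<open>D2\<close> with \<open>\<phi>\<xi> = 0\<close>, which forces the angle \<open>\<pi>/2\<close>.\<close>

lemma xi_D1: obtains \<zeta> where "\<zeta> \<in> D1" "\<xi> = L \<zeta>"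
proof -
  obtain \<zeta> where z: "\<xi> = L \<zeta>" using xi_range by blast
  have "\<zeta> \<in> D1"
  proof (cases "\<exists>x\<in>D1. \<eta> (L x) \<noteq> 0")
    case True
    then obtain x where x: "x \<in> D1" "\<eta> (L x) \<noteq> 0" by blast
    obtain y where y: "y \<in> D1" "\<phi> (\<phi> (L x)) = L y" using phi_D1_ex[OF x(1)] phi_D1_ex by metis
    \<comment> \<open>The formula for the square of \<open>\<phi>\<close> is solved for
      \<open>\<xi>\<close>; both \<open>x\<close> and the preimage \<open>y\<close> of
      \<open>\<phi> (\<phi> (L x))\<close> lie in \<open>D1\<close>.\<close>
    have "L (\<eta> (L x) *\<^sub>R \<zeta>) = L (x + y)" using y(2) unfolding phi_phi z by (simp add: L_simps algebra_simps)
    then have "\<eta> (L x) *\<^sub>R \<zeta> = x + y" using L_inj by (rule injD[rotated])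
    then have "\<zeta> = (1 / \<eta> (L x)) *\<^sub>R (x + y)" using x(2) by (metis divide_self_if scaleR_one scaleR_scaleR times_divide_eq_left mult_1)
    then show ?thesis using x(1) y(1) D1_subspace by (simp add: subspace_add subspace_scale)
  next
    case False
    then have "\<zeta> \<in> D2"
      by (intro D2I) (simp add: G_def z[symmetric] eta_eq[symmetric])
    moreover have "\<zeta> \<noteq> 0" using z xi_nz L_simps(5) by auto
    ultimately show ?thesis using tan_part_phi_nonzero[of \<zeta>] phi_xi z by auto
  qed
  then show ?thesis using that z by blast
qed

lemma eta_D2: "z \<in> D2 \<Longrightarrow> \<eta> (L z) = 0"
  using xi_D1 D_orth(2) unfolding eta_eq G_def by metis

section \<open>The tangential part T and the normal part F of \<open>\<phi>\<close>\<close>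

definition T where "T z = tan_part (\<phi> (L z))"
definition F where "F z = nor_part (\<phi> (L z))"

text \<open>\<open>\<phi>\<close> is skew and preserves \<open>D1\<close>, so it maps
  \<open>D2\<close> into the orthogonal complement of \<open>D1\<close>.\<close>

lemma T_D2:
  assumes "z \<in> D2" shows "T z \<in> D2"
proof (rule D2I)
  fix v assume v: "v \<in> D1"
  have "G v (T z) = g (\<phi> (L z)) (L v)" by (simp add: T_def T.sym[of v] G_tan_part)
  also have "\<dots> = - g (\<phi> (L v)) (L z)" by (simp add: phi_skew[of "L z"] sym[of "L z"])
  finally show "G v (T z) = 0" using g_phi_D1_D2[OF v assms] by simp
qed

lemma G_T: "G (T z) w = g (\<phi> (L z)) (L w)"
  by (simp add: T_def G_tan_part)

lemma phi_L_decomp: "\<phi> (L z) = L (T z) + F z"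
  unfolding T_def F_def nor_part_def by simp

lemma TF_linear: "linear T" "linear F"
proof -
  have 1: "linear (\<lambda>z. \<phi> (L z))" using linear_compose[OF L_linear phi_linear] by (simp add: o_def)
  show "linear T" "linear F"
    unfolding T_def F_def
    using linear_compose[OF 1 tan_part_linear] linear_compose[OF 1 nor_part_linear] by (simp_all add: o_def)
qed

text \<open>By Cauchy-Schwarz the direction of \<open>D2\<close> closest to
  \<open>\<phi> (L z)\<close> is that of \<open>T z\<close>. The infimum of the angles is thus
  attained, and its cosine is the ratio of the lengths of \<open>T z\<close> and
  \<open>z\<close>.\<close>

lemma G_T_T_self:
  assumes "z \<in> D2"
  shows "G (T z) (T z) = (cos \<theta>)\<^sup>2 * G z z"
proof (cases "z = 0")
  case True
  then show ?thesis by (simp add: linear_0[OF TF_linear(1)])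
next
  case False
  have TD: "T z \<in> D2" by (rule T_D2[OF assms])
  have nz: "T z \<noteq> 0" using tan_part_phi_nonzero[OF assms False] G_T[of z] by auto
  have Gz: "G z z > 0" and GT: "G (T z) (T z) > 0" using T.pos nz False by auto
  have pp: "g (\<phi> (L z)) (\<phi> (L z)) = G z z"
    by (simp add: g_phi_phi eta_D2[OF assms] G_def)
  define c where "c = sqrt (G (T z) (T z)) / sqrt (G z z)"
  have va: "vec_angle g (\<phi> (L z)) (L w) = arccos (G (T z) w / (sqrt (G z z) * sqrt (G w w)))" for w
    unfolding vec_angle_def pp G_T by (simp add: G_def)
  \<comment> \<open>The lower bound is needed as well: it keeps the quotient inside the interval on
    which \<open>arccos\<close> is decreasing.\<close>
  have le: "G (T z) w / (sqrt (G z z) * sqrt (G w w)) \<le> c"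
    and ge: "- c \<le> G (T z) w / (sqrt (G z z) * sqrt (G w w))" if "w \<noteq> 0" for w
  proof -
    have Gw: "G w w > 0" using T.pos that by auto
    have "\<bar>G (T z) w\<bar> \<le> sqrt (G (T z) (T z) * G w w)"
      using T.cauchy_schwarz[of "T z" w] by (simp add: real_le_rsqrt)
    then have ab: "\<bar>G (T z) w\<bar> \<le> sqrt (G (T z) (T z)) * sqrt (G w w)"
      by (simp add: real_sqrt_mult)
    have "\<bar>G (T z) w / (sqrt (G z z) * sqrt (G w w))\<bar> = \<bar>G (T z) w\<bar> / (sqrt (G z z) * sqrt (G w w))"
      using Gz Gw by (simp add: abs_mult)
    also have "\<dots> \<le> (sqrt (G (T z) (T z)) * sqrt (G w w)) / (sqrt (G z z) * sqrt (G w w))"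
      using ab Gz Gw by (intro divide_right_mono) auto
    also have "\<dots> = c" using Gw unfolding c_def by simp
    finally have *: "\<bar>G (T z) w / (sqrt (G z z) * sqrt (G w w))\<bar> \<le> c" .
    show "G (T z) w / (sqrt (G z z) * sqrt (G w w)) \<le> c"
      "- c \<le> G (T z) w / (sqrt (G z z) * sqrt (G w w))"
      using * by linarith+
  qed
  have cT: "G (T z) (T z) / (sqrt (G z z) * sqrt (G (T z) (T z))) = c"
    using GT Gz unfolding c_def by (simp add: field_simps)
  have "(G (T z) (T z))\<^sup>2 \<le> G z z * G (T z) (T z)"
  proof -
    have "G (T z) (T z) = g (\<phi> (L z)) (L (T z))" by (rule G_T)
    then show ?thesis using cauchy_schwarz[of "\<phi> (L z)" "L (T z)"] pp by (simp add: G_def)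
  qed
  then have "G (T z) (T z) \<le> G z z" using GT by (simp add: power2_eq_square)
  then have c1: "c \<le> 1" "c > 0" using Gz GT unfolding c_def by auto
  have lower: "arccos c \<le> vec_angle g (\<phi> (L z)) (L w)" if "w \<noteq> 0" for w
    unfolding va using le[OF that] ge[OF that] c1 by (intro arccos_le_mono[THEN iffD2]) auto
  have mem: "arccos c \<in> {vec_angle g (\<phi> (L z)) w | w. w \<in> L ` D2 \<and> w \<noteq> 0}"
  proof -
    have "L (T z) \<noteq> 0" using nz L_inj L_simps(5) by (metis injD)
    then show ?thesis using va[of "T z"] cT TD by force
  qed
  have "Inf {vec_angle g (\<phi> (L z)) w | w. w \<in> L ` D2 \<and> w \<noteq> 0} = arccos c"
  proof (rule cInf_eq_minimum[OF mem])
    fix t assume "t \<in> {vec_angle g (\<phi> (L z)) w | w. w \<in> L ` D2 \<and> w \<noteq> 0}"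
    then obtain w where "t = vec_angle g (\<phi> (L z)) (L w)" "L w \<noteq> 0" by blast
    then show "arccos c \<le> t" using lower[of w] L_simps(5) by auto
  qed
  then have "\<theta> = arccos c" using slant[OF assms False] unfolding subspace_angle_def by simp
  then have "(cos \<theta>)\<^sup>2 = c\<^sup>2" using c1 by simp
  also have "\<dots> = G (T z) (T z) / G z z" using Gz GT unfolding c_def by (simp add: power_divide)
  finally show ?thesis using Gz by simp
qed

text \<open>Polarisation of \<open>G_T_T_self\<close>.\<close>

lemma G_T_T:
  assumes "z \<in> D2" "w \<in> D2"
  shows "G (T z) (T w) = (cos \<theta>)\<^sup>2 * G z w"
proof -
  have "G (T (z + w)) (T (z + w)) = (cos \<theta>)\<^sup>2 * G (z + w) (z + w)"
    using D2_subspace assms by (intro G_T_T_self subspace_add)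
  then have "2 * G (T z) (T w) + (cos \<theta>)\<^sup>2 * G z z + (cos \<theta>)\<^sup>2 * G w w
     = (cos \<theta>)\<^sup>2 * (2 * G z w + G z z + G w w)"
    using G_T_T_self[OF assms(1)] G_T_T_self[OF assms(2)]
    by (simp add: linear_add[OF TF_linear(1)] T.form_simps T.sym[of w z] T.sym[of "T w" "T z"] algebra_simps)
  then show ?thesis by (simp add: algebra_simps)
qed

text \<open>Pythagoras for the decomposition of \<open>\<phi> (L z)\<close>: since
  \<open>\<eta>\<close> vanishes on \<open>D2\<close>, \<open>\<phi>\<close> is isometric there, and
  F takes what T leaves.\<close>

lemma g_F_F:
  assumes "z \<in> D2" "w \<in> D2"
  shows "g (F z) (F w) = (sin \<theta>)\<^sup>2 * G z w"
proof -
  have "g (\<phi> (L z)) (\<phi> (L w)) = G (T z) (T w) + g (F z) (F w)"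
    unfolding phi_L_decomp by (simp add: form_simps G_def F_def nor_part_orth)
  moreover have "g (\<phi> (L z)) (\<phi> (L w)) = G z w"
    by (simp add: g_phi_phi eta_D2[OF assms(1)] G_def)
  ultimately have "g (F z) (F w) = (1 - (cos \<theta>)\<^sup>2) * G z w"
    using G_T_T[OF assms] by (simp add: algebra_simps)
  then show ?thesis by (simp add: sin_squared_eq)
qed

lemma sin_theta: "sin \<theta> > 0"
  using theta_pos theta_less by (simp add: sin_gt_zero)

lemma G_T_skew: "G (T z) z = 0"
  using G_T[of z z] phi_skew[of "L z" "L z"] sym[of "L z" "\<phi> (L z)"] by linarith

text \<open>The dimension hypothesis makes the rescaled vectors \<open>F e\<close> an orthonormal
  basis of the whole normal space. A normal vector is then determined by its products with
  them.\<close>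

lemma parseval_normal:
  assumes E: "T.onb D2 E" and dims: "DIM('n) = DIM('e) + dim D2"
    and orth: "\<And>x. g V (L x) = 0"
  shows "g V V = (\<Sum>e\<in>E. (g V (F e))\<^sup>2) / (sin \<theta>)\<^sup>2"
proof -
  obtain E0 where E0: "T.onb UNIV E0" using T.onb_exists subspace_UNIV by blast
  \<comment> \<open>By \<open>g_F_F\<close>, \<open>F\<close> stretches lengths by the sine of
    \<theta>, which is divided out here.\<close>
  define N where "N e = (1 / sin \<theta>) *\<^sub>R F e" for e
  have NN: "g (N e) (N e') = (if e = e' then 1 else 0)" if "e \<in> E" "e' \<in> E" for e e'
    using g_F_F[OF T.onb_mem[OF E that(1)] T.onb_mem[OF E that(2)]] T.onb_self[OF E that] sin_theta
    unfolding N_def by (simp add: scale_left scale_right power2_eq_square)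
  have LN: "g (L x) (N e) = 0" "g (N e) (L x) = 0" for x e
    unfolding N_def F_def by (simp_all add: scale_left scale_right nor_part_orth)
  have inj: "inj_on N E"
  proof (rule inj_onI)
    fix e e' assume "e \<in> E" "e' \<in> E" "N e = N e'"
    then show "e = e'" using NN[of e e'] NN[of e e] by (auto split: if_splits)
  qed
  have on: "\<forall>x\<in>L ` E0 \<union> N ` E. \<forall>y\<in>L ` E0 \<union> N ` E. g x y = (if x = y then 1 else 0)"
  proof (intro ballI)
    fix x y assume "x \<in> L ` E0 \<union> N ` E" "y \<in> L ` E0 \<union> N ` E"
    then consider a b where "a \<in> E0" "b \<in> E0" "x = L a" "y = L b"
      | a b where "a \<in> E0" "b \<in> E" "x = L a" "y = N b"
      | a b where "a \<in> E" "b \<in> E0" "x = N a" "y = L b"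
      | a b where "a \<in> E" "b \<in> E" "x = N a" "y = N b" by blast
    then show "g x y = (if x = y then 1 else 0)"
    proof cases
      case 1
      have "(L a = L b) = (a = b)" using L_inj by (simp add: inj_eq)
      then show ?thesis using T.onb_self[OF E0 1(1,2)] 1(3,4) by (simp add: G_def)
    next
      case 2
      then have "x \<noteq> y" using NN[OF 2(2,2)] LN(1)[of a b] by auto
      then show ?thesis using LN 2 by simp
    next
      case 3
      then have "x \<noteq> y" using NN[OF 3(1,1)] LN(2)[of a b] by auto
      then show ?thesis using LN 3 by simp
    next
      case 4
      then show ?thesis using NN[OF 4(1,2)] inj by (auto simp: inj_on_eq_iff)
    qed
  qed
  have ind: "independent (L ` E0 \<union> N ` E)" by (rule orthonormal_independent[OF on])
  have disj: "L ` E0 \<inter> N ` E = {}"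
  proof (rule ccontr)
    assume "L ` E0 \<inter> N ` E \<noteq> {}"
    then obtain a b where "b \<in> E" "L a = N b" by blast
    then show False using NN[of b b] LN(1)[of a b] by simp
  qed
  have fin: "finite E0" "finite E" using T.onb_finite E0 E by blast+
  have "card (L ` E0 \<union> N ` E) = DIM('n)"
    using card_Un_disjoint[OF finite_imageI finite_imageI disj] fin card_image[OF inj]
      card_image[of L E0] inj_on_subset[OF L_inj subset_UNIV] T.onb_card[OF E0] T.onb_card[OF E] dims
    by simp
  then have "span (L ` E0 \<union> N ` E) = UNIV"
    using ind by (metis card_ge_dim_independent dim_UNIV order_refl subset_UNIV top.extremum_uniqueI)
  with on have B: "onb UNIV (L ` E0 \<union> N ` E)" unfolding onb_def by blast
  have "g V V = (\<Sum>b\<in>L ` E0 \<union> N ` E. g V b * g V b)" using onb_parseval[OF B, of V V] by simp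
  also have "\<dots> = (\<Sum>b\<in>L ` E0. g V b * g V b) + (\<Sum>b\<in>N ` E. g V b * g V b)"
    using fin disj by (intro sum.union_disjoint) auto
  also have "(\<Sum>b\<in>L ` E0. g V b * g V b) = 0" using orth by (intro sum.neutral) auto
  also have "(\<Sum>b\<in>N ` E. g V b * g V b) = (\<Sum>e\<in>E. g V (N e) * g V (N e))"
    by (simp add: sum.reindex[OF inj])
  also have "\<dots> = (\<Sum>e\<in>E. (g V (F e))\<^sup>2) / (sin \<theta>)\<^sup>2"
    unfolding sum_divide_distrib by (rule sum.cong) (simp_all add: N_def scale_right power2_eq_square)
  finally show ?thesis by simp
qed

end

text \<open>\<open>S x y\<close> stands for the ambient covariant derivative, in direction \<open>x\<close>, of the field with constant
  components \<open>y\<close> in a product chart, and \<open>l\<close> for the differential of \<open>ln f\<close>. The first three metric assumptions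
  are derivatives of the induced metric, the last two are derivatives of \<open>g(\<phi>X, Z)\<close> and \<open>g(\<phi>X, \<phi>Z)\<close>.\<close>

locale warped_semi_slant_space = semi_slant_space g \<phi> \<xi> \<eta> L D1 D2 \<theta>
  for g :: "'n::euclidean_space \<Rightarrow> 'n \<Rightarrow> real" and \<phi> \<xi> \<eta>
    and L :: "'e::euclidean_space \<Rightarrow> 'n" and D1 D2 \<theta> +
  fixes S :: "'e \<Rightarrow> 'e \<Rightarrow> 'n" and l :: "'e \<Rightarrow> real"
  assumes S_bilinear: "bilinear S" and S_sym: "S x y = S y x"
    and l_linear: "linear l" and l_D2: "z \<in> D2 \<Longrightarrow> l z = 0"
    and dG_mixed: "x \<in> D1 \<Longrightarrow> z \<in> D2 \<Longrightarrow> g (S w x) (L z) + g (L x) (S w z) = 0"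
    and dG_base: "x \<in> D1 \<Longrightarrow> y \<in> D1 \<Longrightarrow> z \<in> D2 \<Longrightarrow> g (S z x) (L y) + g (L x) (S z y) = 0"
    and dG_fiber: "x \<in> D1 \<Longrightarrow> z \<in> D2 \<Longrightarrow> w \<in> D2 \<Longrightarrow>
        g (S x z) (L w) + g (L z) (S x w) = 2 * l x * g (L z) (L w)"
    and nabla_phi: "x \<in> D1 \<Longrightarrow> z \<in> D2 \<Longrightarrow>
        g (\<phi> (S w x) + g (\<phi> (L w)) (L x) *\<^sub>R \<xi> - \<eta> (L x) *\<^sub>R \<phi> (L w)) (L z)
          + g (\<phi> (L x)) (S w z) = 0"
    and nabla_phi_phi: "x \<in> D1 \<Longrightarrow> z \<in> D2 \<Longrightarrow>
        g (\<phi> (S w x) + g (\<phi> (L w)) (L x) *\<^sub>R \<xi> - \<eta> (L x) *\<^sub>R \<phi> (L w)) (\<phi> (L z))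
          + g (\<phi> (L x)) (\<phi> (S w z) + g (\<phi> (L w)) (L z) *\<^sub>R \<xi> - \<eta> (L z) *\<^sub>R \<phi> (L w)) = 0"
begin

section \<open>The second fundamental form against the normal vectors \<open>F w\<close>\<close>

definition h where "h x y = nor_part (S x y)"

text \<open>The base leaves are totally geodesic in the submanifold. Two instances of
  \<open>dG_mixed\<close> move both terms of \<open>dG_base\<close> onto
  \<open>g (S x y) (L z)\<close>, so twice this number is zero.\<close>

lemma g_S_D1_D1:
  assumes "x \<in> D1" "y \<in> D1" "z \<in> D2"
  shows "g (S x y) (L z) = 0" "g (L y) (S x z) = 0"
proof -
  show "g (S x y) (L z) = 0"
    using dG_mixed[OF assms(2,3), of x] dG_mixed[OF assms(1,3), of y] dG_base[OF assms]
    by (simp add: S_sym[of y x] S_sym[of z] sym[of _ "L y"])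
  then show "g (L y) (S x z) = 0" using dG_mixed[OF assms(2,3), of x] by simp
qed

text \<open>By \<open>dG_mixed\<close> and the symmetry of \<open>S\<close> the left side is
  symmetric in \<open>z\<close> and \<open>w\<close>, so the two terms of \<open>dG_fiber\<close>
  coincide and the factor 2 cancels.\<close>

lemma g_S_D1_D2:
  assumes "x \<in> D1" "z \<in> D2" "w \<in> D2"
  shows "g (S x z) (L w) = l x * G z w"
  using dG_mixed[OF assms(1,2), of w] dG_mixed[OF assms(1,3), of z] dG_fiber[OF assms]
    S_sym[of z x] S_sym[of z w] S_sym[of w x] sym[of "L z" "S x w"] unfolding G_def by simp

lemma g_S_D2_D2:
  assumes "y \<in> D1" "z \<in> D2" "w \<in> D2"
  shows "g (S z w) (L y) = - l y * G z w"
  using dG_mixed[OF assms(1,3), of z] g_S_D1_D2[OF assms] S_sym[of z y] sym[of "L y"] by simp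

text \<open>Take \<open>nabla_phi_phi\<close> with \<open>\<xi>\<close> as base vector and one
  nonzero \<open>z\<close> of \<open>D2\<close> as both direction and second field. Every term
  containing \<open>\<phi> \<xi>\<close> drops out, and \<open>g_S_D1_D2\<close> reads off the
  derivative of ln f.\<close>

lemma l_xi:
  assumes "\<zeta> \<in> D1" "\<xi> = L \<zeta>"
  shows "l \<zeta> = 1"
proof -
  obtain z where z: "z \<in> D2" "z \<noteq> 0"
    using D2_nontrivial subspace_0[OF D2_subspace] by blast
  have "g (\<phi> (S z \<zeta>)) (\<phi> (L z)) = g (\<phi> (L z)) (\<phi> (L z))"
    using nabla_phi_phi[OF assms(1) z(1), of z]
    by (simp add: assms(2)[symmetric] phi_xi eta_xi form_simps sym[of \<xi>] eta_eq[symmetric] eta_phi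
        linear_0[OF eta_linear])
  then have "g (S z \<zeta>) (L z) = G z z"
    by (simp add: g_phi_phi eta_D2[OF z(1)] G_def)
  then have "l \<zeta> * G z z = G z z" using g_S_D1_D2[OF assms(1) z(1) z(1)] S_sym by simp
  then show ?thesis using T.pos[OF z(2)] by simp
qed

lemma h_F: "g (h x y) (F w) = g (S x y) (\<phi> (L w)) - g (S x y) (L (T w))"
proof -
  have "g (h x y) (F w) = g (S x y) (F w)"
    unfolding h_def nor_part_def[of "S x y"] F_def by (simp add: diff_left nor_part_orth)
  then show ?thesis unfolding phi_L_decomp by (simp add: form_simps)
qed

text \<open>In \<open>nabla_phi\<close>, differentiated in direction \<open>x\<close>, all terms but
  the first pair a \<open>D1\<close> vector with \<open>D2\<close>, or vanish by
  \<open>g_S_D1_D1\<close> because \<open>\<phi>\<close> preserves \<open>D1\<close>.\<close>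

lemma h_F_D1_D1:
  assumes "x \<in> D1" "y \<in> D1" "w \<in> D2"
  shows "g (h x y) (F w) = 0"
proof -
  obtain y' where y': "y' \<in> D1" "\<phi> (L y) = L y'" using phi_D1_ex[OF assms(2)] by blast
  obtain \<zeta> where \<zeta>: "\<zeta> \<in> D1" "\<xi> = L \<zeta>" by (rule xi_D1)
  have "g \<xi> (L w) = 0" using D_orth(1)[OF \<zeta>(1) assms(3)] unfolding \<zeta>(2) G_def .
  then have "g (\<phi> (S x y)) (L w) = 0"
    using nabla_phi[OF assms(2,3), of x] g_S_D1_D1(2)[OF assms(1) y'(1) assms(3)]
      g_phi_D1_D2[OF assms(1,3)] by (simp add: form_simps y'(2))
  then show ?thesis
    unfolding h_F using phi_skew[of "S x y" "L w"] g_S_D1_D1(1)[OF assms(1,2) T_D2[OF assms(3)]] by simp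
qed

text \<open>\<open>nabla_phi\<close> is used in the fibre direction \<open>z\<close>, and
  \<open>S\<close> is symmetric. The term with \<open>l x\<close> comes from the tangential
  correction in \<open>h_F\<close>, the one with \<open>\<eta>\<close> from the Kenmotsu identity.
  The result is written as a product of one vector with \<open>w\<close>, ready for
  Parseval.\<close>

lemma h_F_D1_D2:
  assumes "x \<in> D1" "z \<in> D2" "w \<in> D2" "x' \<in> D1" "\<phi> (L x) = L x'"
  shows "g (h x z) (F w) = G (- l x' *\<^sub>R z + (l x - \<eta> (L x)) *\<^sub>R T z) w"
proof -
  obtain \<zeta> where \<zeta>: "\<zeta> \<in> D1" "\<xi> = L \<zeta>" by (rule xi_D1)
  have x0: "g \<xi> (L w) = 0" using D_orth(1)[OF \<zeta>(1) assms(3)] unfolding \<zeta>(2) G_def .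
  have "g (L x') (S z w) = - l x' * G z w"
    using g_S_D2_D2[OF assms(4,2,3)] by (simp add: sym)
  then have "g (\<phi> (S z x)) (L w) = \<eta> (L x) * g (\<phi> (L z)) (L w) + l x' * G z w"
    using nabla_phi[OF assms(1,3), of z] by (simp add: form_simps assms(5) x0)
  moreover have "g (S z x) (\<phi> (L w)) = - g (\<phi> (S z x)) (L w)"
    by (simp add: phi_skew)
  moreover have "g (S x z) (L (T w)) = - l x * G (T z) w"
  proof -
    have "G z (T w) = - G (T z) w"
      using G_T[of w z] G_T[of z w] phi_skew[of "L z" "L w"] T.sym[of z] sym[of "L z"] by simp
    then show ?thesis using g_S_D1_D2[OF assms(1,2) T_D2[OF assms(3)]] by simp
  qed
  ultimately show ?thesis
    unfolding h_F S_sym[of x z] by (simp add: T.form_simps G_T S_sym[of x z] algebra_simps)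
qed

lemma h_bilinear: "bilinear h"
  using S_bilinear linear_compose[OF _ nor_part_linear] unfolding bilinear_def h_def o_def by blast

lemma h_normal: "g (h x y) (L v) = 0"
  unfolding h_def by (rule nor_part_orth)

text \<open>By bilinearity it is enough that the basis values vanish; conversely
  \<open>h z w\<close> is itself normal and may be paired with itself.\<close>

lemma h_D2_sum_eq_0_iff:
  assumes E2: "T.onb D2 E2"
  shows "(\<Sum>z\<in>E2. \<Sum>w\<in>E2. g (h z w) (h z w)) = 0 \<longleftrightarrow>
    (\<forall>Z\<in>D2. \<forall>W\<in>D2. \<forall>V. (\<forall>x. g V (L x) = 0) \<longrightarrow> g (h Z W) V = 0)"
proof
  have h_lin: "linear (\<lambda>x. h x y)" "linear (h x)" for x y using h_bilinear unfolding bilinear_def by auto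
  have fin: "finite E2" by (rule T.onb_finite[OF E2])
  assume "(\<Sum>z\<in>E2. \<Sum>w\<in>E2. g (h z w) (h z w)) = 0"
  then have "g (h z w) (h z w) = 0" if "z \<in> E2" "w \<in> E2" for z w
    using that fin by (simp add: sum_nonneg_eq_0_iff sum_nonneg nonneg)
  then have h0: "h z w = 0" if "z \<in> E2" "w \<in> E2" for z w using that by (simp add: eq_zero_iff)
  have "h Z W = 0" if "Z \<in> D2" "W \<in> D2" for Z W
  proof -
    have "h Z W = h (\<Sum>z\<in>E2. G Z z *\<^sub>R z) (\<Sum>w\<in>E2. G W w *\<^sub>R w)"
      using T.onb_expand[OF E2 that(1)] T.onb_expand[OF E2 that(2)] by simp
    also have "\<dots> = 0"
      unfolding linear_sum[OF h_lin(1)] linear_sum[OF h_lin(2)] linear_cmul[OF h_lin(1)]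
        linear_cmul[OF h_lin(2)] by (simp add: h0)
    finally show ?thesis .
  qed
  then show "\<forall>Z\<in>D2. \<forall>W\<in>D2. \<forall>V. (\<forall>x. g V (L x) = 0) \<longrightarrow> g (h Z W) V = 0" by simp
next
  assume *: "\<forall>Z\<in>D2. \<forall>W\<in>D2. \<forall>V. (\<forall>x. g V (L x) = 0) \<longrightarrow> g (h Z W) V = 0"
  have "g (h z w) (h z w) = 0" if "z \<in> E2" "w \<in> E2" for z w
    using * T.onb_mem[OF E2 that(1)] T.onb_mem[OF E2 that(2)] h_normal by blast
  then show "(\<Sum>z\<in>E2. \<Sum>w\<in>E2. g (h z w) (h z w)) = 0" by simp
qed

lemma norm_h:
  assumes dims: "DIM('n) = DIM('e) + dim D2"
    and E: "orthonormal_basis G E" and \<gamma>: "\<And>v. G \<gamma> v = l v" and E2: "T.onb D2 E2"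
  shows "(\<Sum>x\<in>E. \<Sum>y\<in>E. g (h x y) (h x y)) =
     2 * real (dim D2) * ((1 / sin \<theta>)\<^sup>2 + (cot \<theta>)\<^sup>2) * g (\<phi> (L \<gamma>)) (\<phi> (L \<gamma>))
     + (\<Sum>z\<in>E2. \<Sum>w\<in>E2. g (h z w) (h z w))"
proof -
  obtain E1 where E1: "T.onb D1 E1" using T.onb_exists[OF D1_subspace] by blast
  have fin: "finite E1" "finite E2" using T.onb_finite E1 E2 by blast+
  note m1 = T.onb_mem[OF E1] and m2 = T.onb_mem[OF E2]
  have disj: "E1 \<inter> E2 = {}"
  proof (rule ccontr)
    assume "E1 \<inter> E2 \<noteq> {}"
    then obtain e where "e \<in> E1" "e \<in> E2" by blast
    then show False using T.onb_self[OF E1, of e e] D_orth(1)[OF m1 m2, of e e] by simp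
  qed
  have E12: "T.onb UNIV (E1 \<union> E2)"
    unfolding T.onb_def
  proof (intro conjI ballI)
    fix x y assume "x \<in> E1 \<union> E2" "y \<in> E1 \<union> E2"
    then show "G x y = (if x = y then 1 else 0)"
      using T.onb_self[OF E1] T.onb_self[OF E2] D_orth m1 m2 disj by auto
  next
    have "x \<in> span (E1 \<union> E2)" for x
    proof -
      obtain v w where vw: "v \<in> D1" "w \<in> D2" "x = v + w" by (rule D_decomp)
      then have "v \<in> span E1" "w \<in> span E2" using E1 E2 unfolding T.onb_def by blast+
      then have "v \<in> span (E1 \<union> E2)" "w \<in> span (E1 \<union> E2)"
        using span_mono[of E1 "E1 \<union> E2"] span_mono[of E2 "E1 \<union> E2"] by blast+
      then show ?thesis unfolding vw(3) by (rule span_add)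
    qed
    then show "span (E1 \<union> E2) = UNIV" by blast
  qed
  define q where "q x y = g (h x y) (h x y)" for x y
  have q_sym: "q x y = q y x" for x y unfolding q_def h_def by (simp add: S_sym[of x y])
  have h_lin: "linear (\<lambda>x. h x y)" "linear (h x)" for x y using h_bilinear unfolding bilinear_def by auto
  \<comment> \<open>The double sum is a trace in each slot separately, so the basis is exchanged one
    slot at a time.\<close>
  have bil1: "bilinear (\<lambda>x x'. \<Sum>y\<in>A. g (h x y) (h x' y))" for A
    unfolding bilinear_def
    by (intro conjI allI linearI) (simp_all add: linear_add[OF h_lin(1)] linear_cmul[OF h_lin(1)]
        form_simps sum.distrib sum_distrib_left)
  have bil2: "bilinear (\<lambda>y y'. g (h x y) (h x y'))" for x
    unfolding bilinear_def
    by (intro conjI allI linearI) (simp_all add: linear_add[OF h_lin(2)] linear_cmul[OF h_lin(2)]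
        form_simps)
  have EU: "T.onb UNIV E" using E by (simp add: T.onb_UNIV)
  have "(\<Sum>x\<in>E. \<Sum>y\<in>E. q x y) = (\<Sum>x\<in>E1 \<union> E2. \<Sum>y\<in>E. q x y)"
    unfolding q_def by (rule T.trace_onb[OF bil1 EU E12])
  also have "\<dots> = (\<Sum>x\<in>E1 \<union> E2. \<Sum>y\<in>E1 \<union> E2. q x y)"
    unfolding q_def by (rule sum.cong[OF refl], rule T.trace_onb[OF bil2 EU E12])
  also have "\<dots> = (\<Sum>x\<in>E1. \<Sum>y\<in>E1. q x y) + (\<Sum>x\<in>E1. \<Sum>y\<in>E2. q x y)
      + ((\<Sum>x\<in>E2. \<Sum>y\<in>E1. q x y) + (\<Sum>x\<in>E2. \<Sum>y\<in>E2. q x y))"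
    by (simp add: sum.union_disjoint[OF fin disj] sum.distrib)
  also have "(\<Sum>x\<in>E2. \<Sum>y\<in>E1. q x y) = (\<Sum>x\<in>E1. \<Sum>y\<in>E2. q x y)"
    by (subst sum.swap) (simp add: q_sym)
  \<comment> \<open>A normal vector orthogonal to all \<open>F e\<close> is zero.\<close>
  also have "(\<Sum>x\<in>E1. \<Sum>y\<in>E1. q x y) = 0"
  proof (intro sum.neutral ballI)
    fix x y assume "x \<in> E1" "y \<in> E1"
    then have "q x y = (\<Sum>e\<in>E2. (g (h x y) (F e))\<^sup>2) / (sin \<theta>)\<^sup>2"
      unfolding q_def by (intro parseval_normal[OF E2 dims] h_normal)
    also have "\<dots> = 0" using h_F_D1_D1[OF m1 m1 m2] \<open>x \<in> E1\<close> \<open>y \<in> E1\<close> by simp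
    finally show "q x y = 0" .
  qed
  finally have total: "(\<Sum>x\<in>E. \<Sum>y\<in>E. q x y) =
      2 * (\<Sum>x\<in>E1. \<Sum>y\<in>E2. q x y) + (\<Sum>x\<in>E2. \<Sum>y\<in>E2. q x y)" by simp
  obtain P where P: "\<And>x. x \<in> D1 \<Longrightarrow> P x \<in> D1 \<and> \<phi> (L x) = L (P x)"
    using phi_D1_ex by metis
  obtain \<zeta> where \<zeta>: "\<zeta> \<in> D1" "\<xi> = L \<zeta>" by (rule xi_D1)
  \<comment> \<open>ln f is constant along the fibres, so its gradient is tangent to the
    base.\<close>
  have \<gamma>D1: "\<gamma> \<in> D1" by (rule D1I) (simp add: \<gamma> l_D2)
  define K where "K = g (\<phi> (L \<gamma>)) (\<phi> (L \<gamma>))"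
  have mixed: "q x z = ((l (P x))\<^sup>2 + (cos \<theta>)\<^sup>2 * (l x - \<eta> (L x))\<^sup>2) / (sin \<theta>)\<^sup>2"
    if "x \<in> E1" "z \<in> E2" for x z
  proof -
    \<comment> \<open>The vector of \<open>D2\<close> that represents \<open>g (h x z) (F e)\<close>
      as a function of \<open>e\<close>; Parseval turns the sum of squares into
      \<open>G u u\<close>.\<close>
    define u where "u = - l (P x) *\<^sub>R z + (l x - \<eta> (L x)) *\<^sub>R T z"
    have zD: "z \<in> D2" using m2 that by blast
    have uD: "u \<in> D2" unfolding u_def
      using D2_subspace zD T_D2[OF zD] by (intro subspace_add subspace_scale)
    have hF: "g (h x z) (F e) = G u e" if "e \<in> E2" for e
      unfolding u_def using h_F_D1_D2[OF m1[OF \<open>x \<in> E1\<close>] zD m2[OF that]] P[OF m1[OF \<open>x \<in> E1\<close>]] by blast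
    have "q x z = (\<Sum>e\<in>E2. (g (h x z) (F e))\<^sup>2) / (sin \<theta>)\<^sup>2"
      unfolding q_def by (intro parseval_normal[OF E2 dims] h_normal)
    also have "(\<Sum>e\<in>E2. (g (h x z) (F e))\<^sup>2) = (\<Sum>e\<in>E2. G u e * G u e)"
      by (rule sum.cong) (simp_all add: hF power2_eq_square)
    also have "\<dots> = G u u" by (rule T.onb_parseval[OF E2 uD])
    \<comment> \<open>The cross terms vanish because \<open>T z\<close> is orthogonal to
      \<open>z\<close>.\<close>
    also have "\<dots> = (l (P x))\<^sup>2 * G z z + (l x - \<eta> (L x))\<^sup>2 * G (T z) (T z)"
      unfolding u_def by (simp add: T.form_simps G_T_skew T.sym[of z "T z"] power2_eq_square algebra_simps)
    also have "\<dots> = (l (P x))\<^sup>2 + (cos \<theta>)\<^sup>2 * (l x - \<eta> (L x))\<^sup>2"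
      using G_T_T[OF zD zD] T.onb_self[OF E2 that(2) that(2)] by simp
    finally show ?thesis .
  qed
  \<comment> \<open>By skewness of \<open>\<phi>\<close> the numbers \<open>l (P x)\<close> are, up
    to sign, the coefficients of \<open>P \<gamma>\<close>.\<close>
  have s1: "(\<Sum>x\<in>E1. (l (P x))\<^sup>2) = K"
  proof -
    have "l (P x) = - G (P \<gamma>) x" if "x \<in> D1" for x
      using phi_skew[of "L \<gamma>" "L x"] P[OF that] P[OF \<gamma>D1] \<gamma>[of "P x", symmetric] by (simp add: G_def)
    then have "(\<Sum>x\<in>E1. (l (P x))\<^sup>2) = (\<Sum>x\<in>E1. G (P \<gamma>) x * G (P \<gamma>) x)"
      by (intro sum.cong) (simp_all add: m1 power2_eq_square)
    also have "\<dots> = G (P \<gamma>) (P \<gamma>)" using P[OF \<gamma>D1] by (intro T.onb_parseval[OF E1]) simp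
    also have "\<dots> = K" unfolding K_def using P[OF \<gamma>D1] by (simp add: G_def)
    finally show ?thesis .
  qed
  \<comment> \<open>The coefficients of \<open>\<gamma> - \<zeta>\<close>. Since
    \<open>l \<zeta> = 1\<close>, its squared length is \<open>G \<gamma> \<gamma> - 1\<close>, and
    removing the \<open>\<xi>\<close> component of \<open>L \<gamma>\<close>, as
    \<open>\<phi>\<close> does, costs the same 1.\<close>
  have s2: "(\<Sum>x\<in>E1. (l x - \<eta> (L x))\<^sup>2) = K"
  proof -
    have e: "\<eta> (L x) = G \<zeta> x" for x unfolding eta_eq G_def \<zeta>(2) by (rule sym)
    have "(\<Sum>x\<in>E1. (l x - \<eta> (L x))\<^sup>2) = (\<Sum>x\<in>E1. G (\<gamma> - \<zeta>) x * G (\<gamma> - \<zeta>) x)"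
      by (intro sum.cong) (simp_all add: e \<gamma> T.diff_left power2_eq_square)
    also have "\<dots> = G (\<gamma> - \<zeta>) (\<gamma> - \<zeta>)"
      using \<gamma>D1 \<zeta>(1) D1_subspace by (intro T.onb_parseval[OF E1] subspace_diff)
    also have "\<dots> = G \<gamma> \<gamma> - 1"
    proof -
      have "G \<zeta> \<zeta> = 1" using e[of \<zeta>] \<zeta>(2) eta_xi by simp
      moreover have "G \<gamma> \<zeta> = 1" using \<gamma> l_xi[OF \<zeta>] by simp
      ultimately show ?thesis by (simp add: T.form_simps T.sym[of \<zeta> \<gamma>])
    qed
    also have "\<dots> = K"
    proof -
      have "\<eta> (L \<gamma>) = 1" using e[of \<gamma>] \<gamma>[of \<zeta>] l_xi[OF \<zeta>] T.sym[of \<zeta> \<gamma>] by simp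
      then show ?thesis unfolding K_def by (simp add: g_phi_phi G_def)
    qed
    finally show ?thesis .
  qed
  \<comment> \<open>The summand does not depend on \<open>z\<close>, so the inner sum contributes
    the dimension of \<open>D2\<close> as a factor.\<close>
  have "(\<Sum>x\<in>E1. \<Sum>z\<in>E2. q x z) =
      (\<Sum>x\<in>E1. real (card E2) * (((l (P x))\<^sup>2 + (cos \<theta>)\<^sup>2 * (l x - \<eta> (L x))\<^sup>2) / (sin \<theta>)\<^sup>2))"
    by (rule sum.cong) (simp_all add: mixed)
  also have "\<dots> = real (card E2) * ((K + (cos \<theta>)\<^sup>2 * K) / (sin \<theta>)\<^sup>2)"
    by (simp add: s1[symmetric] s2 sum.distrib flip: sum_distrib_left sum_divide_distrib)
  also have "(K + (cos \<theta>)\<^sup>2 * K) / (sin \<theta>)\<^sup>2 = ((1 / sin \<theta>)\<^sup>2 + (cot \<theta>)\<^sup>2) * K"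
    by (simp add: cot_def power_divide add_divide_distrib algebra_simps)
  finally show ?thesis
    using total T.onb_card[OF E2] unfolding q_def K_def by simp
qed

end

section \<open>Charts and coordinate fields\<close>

text \<open>The Jacobian of a change of charts. \<open>tcoord\<close> and \<open>coord_field\<close>
  are instances with the preferred chart at one end, so their algebra reduces to the cocycle rule
  \<open>trans_trans\<close>.\<close>

definition transition :: "('a, 'e::euclidean_space) chart \<Rightarrow> ('a, 'e) chart \<Rightarrow> 'a \<Rightarrow> 'e \<Rightarrow> 'e" where
  "transition c d q = frechet_derivative (cmap d \<circ> cinv c) (at (cmap c q))"

lemma tcoord_trans: "tcoord A c p v = transition (chart_at A p) c p v"
  unfolding tcoord_def transition_def ..

lemma coord_field_trans: "coord_field A c a p = transition c (chart_at A p) p a"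
  unfolding coord_field_def transition_def ..

lemma is_chart_open_image:
  assumes "is_chart c" "open U"
  shows "open (cmap c ` (cdom c \<inter> U))"
proof -
  have h: "homeomorphism (cdom c) (cmap c ` cdom c) (cmap c) (cinv c)" "open (cmap c ` cdom c)"
    using assms(1) unfolding is_chart_def by auto
  have eq: "cmap c ` (cdom c \<inter> U) = cmap c ` cdom c \<inter> cinv c -` U"
    using homeomorphism_apply1[OF h(1)] homeomorphism_apply2[OF h(1)] homeomorphism_image2[OF h(1)] by force
  show ?thesis unfolding eq
    by (rule continuous_open_preimage[OF homeomorphism_cont2[OF h(1)] h(2) assms(2)])
qed

lemma is_chart_cinv:
  assumes "is_chart c" "p \<in> cdom c"
  shows "cinv c (cmap c p) = p"
  using assms homeomorphism_apply1 unfolding is_chart_def by blast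

lemma frechet_derivative_const_on:
  assumes "open S" "x \<in> S" "\<And>y. y \<in> S \<Longrightarrow> f y = k"
  shows "frechet_derivative f (at x) v = 0"
  using frechet_derivative_cong_open[OF assms(1,2), of f "\<lambda>_. k"] assms(3) by simp

locale smooth_atlas =
  fixes A :: "('a::{t2_space,second_countable_topology}, 'e::euclidean_space) chart set"
  assumes manifold: "smooth_manifold A"
begin

lemma chart: "c \<in> A \<Longrightarrow> is_chart c"
  using manifold unfolding smooth_manifold_def by blast

lemma open_cdom: "c \<in> A \<Longrightarrow> open (cdom c)"
  using chart unfolding is_chart_def by blast

lemmas open_image = is_chart_open_image[OF chart]

lemma open_range: "c \<in> A \<Longrightarrow> open (cmap c ` cdom c)"
  using open_image[of c UNIV] by simp

lemmas cinv_cmap = is_chart_cinv[OF chart]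

lemma chart_at_mem: "chart_at A p \<in> A" "p \<in> cdom (chart_at A p)"
proof -
  have "\<exists>c. c \<in> A \<and> p \<in> cdom c"
    using manifold unfolding smooth_manifold_def by blast
  then have "chart_at A p \<in> A \<and> p \<in> cdom (chart_at A p)"
    unfolding chart_at_def by (rule someI_ex)
  then show "chart_at A p \<in> A" "p \<in> cdom (chart_at A p)" by auto
qed

lemma transition_smooth:
  "c \<in> A \<Longrightarrow> d \<in> A \<Longrightarrow> smooth_on (cmap c ` (cdom c \<inter> cdom d)) (cmap d \<circ> cinv c)"
  using manifold unfolding smooth_manifold_def by blast

lemma trans_has_derivative:
  assumes "c \<in> A" "d \<in> A" "q \<in> cdom c" "q \<in> cdom d"
  shows "((cmap d \<circ> cinv c) has_derivative transition c d q) (at (cmap c q))"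
  unfolding transition_def
  by (rule smooth_on_has_derivative[OF transition_smooth[OF assms(1,2)] open_image[OF assms(1) open_cdom[OF assms(2)]]])
    (use assms in blast)

lemma trans_linear: "c \<in> A \<Longrightarrow> d \<in> A \<Longrightarrow> q \<in> cdom c \<Longrightarrow> q \<in> cdom d \<Longrightarrow> linear (transition c d q)"
  by (rule has_derivative_linear[OF trans_has_derivative])

lemma trans_trans:
  assumes "c \<in> A" "d \<in> A" "e \<in> A" "q \<in> cdom c" "q \<in> cdom d" "q \<in> cdom e"
  shows "transition d e q (transition c d q v) = transition c e q v"
proof -
  have eq: "(cmap d \<circ> cinv c) (cmap c q) = cmap d q" using cinv_cmap[OF assms(1,4)] by simp
  have "((cmap e \<circ> cinv d) \<circ> (cmap d \<circ> cinv c) has_derivative transition d e q \<circ> transition c d q) (at (cmap c q))"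
    by (rule diff_chain_at[OF trans_has_derivative[OF assms(1,2,4,5)]])
      (unfold eq, rule trans_has_derivative[OF assms(2,3,5,6)])
  then have "((cmap e \<circ> cinv c) has_derivative transition d e q \<circ> transition c d q) (at (cmap c q))"
  proof (rule has_derivative_transform_within_open)
    show "open (cmap c ` (cdom c \<inter> cdom d))" by (rule open_image[OF assms(1) open_cdom[OF assms(2)]])
    show "cmap c q \<in> cmap c ` (cdom c \<inter> cdom d)" using assms by blast
    fix x assume "x \<in> cmap c ` (cdom c \<inter> cdom d)"
    then show "(cmap e \<circ> cinv d \<circ> (cmap d \<circ> cinv c)) x = (cmap e \<circ> cinv c) x"
      using cinv_cmap[OF assms(1)] cinv_cmap[OF assms(2)] by auto
  qed
  from has_derivative_unique[OF this trans_has_derivative[OF assms(1,3,4,6)]]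
  show ?thesis by (metis comp_apply)
qed

lemma trans_self:
  assumes "c \<in> A" "q \<in> cdom c"
  shows "transition c c q v = v"
proof -
  have "((\<lambda>x. x) has_derivative (\<lambda>v. v)) (at (cmap c q))" by (rule has_derivative_ident)
  then have "((cmap c \<circ> cinv c) has_derivative (\<lambda>v. v)) (at (cmap c q))"
  proof (rule has_derivative_transform_within_open)
    show "open (cmap c ` cdom c)" by (rule open_range[OF assms(1)])
    show "x = (cmap c \<circ> cinv c) x" if "x \<in> cmap c ` cdom c" for x
      using cinv_cmap[OF assms(1)] that by auto
  qed (use assms in blast)
  from has_derivative_unique[OF this trans_has_derivative[OF assms(1,1,2,2)]]
  show ?thesis by metis
qed

lemma tcoord_linear: "c \<in> A \<Longrightarrow> q \<in> cdom c \<Longrightarrow> linear (tcoord A c q)"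
  using trans_linear[OF chart_at_mem(1) _ chart_at_mem(2)] tcoord_trans by (metis ext)

lemma tcoord_self: "tcoord A (chart_at A q) q v = v"
  unfolding tcoord_trans by (rule trans_self[OF chart_at_mem])

lemma coord_field_self: "coord_field A (chart_at A q) v q = v"
  unfolding coord_field_trans by (rule trans_self[OF chart_at_mem])

lemma tcoord_coord_field:
  "c \<in> A \<Longrightarrow> d \<in> A \<Longrightarrow> q \<in> cdom c \<Longrightarrow> q \<in> cdom d \<Longrightarrow> tcoord A d q (coord_field A c a q) = transition c d q a"
  unfolding tcoord_trans coord_field_trans
  by (rule trans_trans[OF _ chart_at_mem(1) _ _ chart_at_mem(2)])

lemma coord_field_tcoord:
  assumes "c \<in> A" "q \<in> cdom c"
  shows "coord_field A c (tcoord A c q v) q = v"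
  unfolding tcoord_trans coord_field_trans
  using trans_trans[OF chart_at_mem(1) assms(1) chart_at_mem(1) chart_at_mem(2) assms(2) chart_at_mem(2)]
    trans_self[OF chart_at_mem] by metis

lemma coord_field_linear: "c \<in> A \<Longrightarrow> q \<in> cdom c \<Longrightarrow> linear (\<lambda>a. coord_field A c a q)"
  unfolding coord_field_trans by (rule trans_linear[OF _ chart_at_mem(1) _ chart_at_mem(2)])

text \<open>Smoothness in one chart covering the set suffices, since changes of charts are
  smooth.\<close>

lemma smooth_fun_of_chart:
  assumes "c \<in> A" "smooth_on (cmap c ` cdom c) (u \<circ> cinv c)"
  shows "smooth_fun A (cdom c) u"
  unfolding smooth_fun_def
proof
  fix d assume d: "d \<in> A"
  let ?S = "cmap d ` (cdom d \<inter> cdom c)"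
  have S: "open ?S" by (rule open_image[OF d open_cdom[OF assms(1)]])
  have "smooth_on ?S (\<lambda>x. (u \<circ> cinv c) ((cmap c \<circ> cinv d) x))"
  proof (rule smooth_on_compose[OF S open_range[OF assms(1)] transition_smooth[OF d assms(1)] _ assms(2)])
    show "(cmap c \<circ> cinv d) ` ?S \<subseteq> cmap c ` cdom c" using cinv_cmap[OF d] by auto
  qed
  then show "smooth_on ?S (u \<circ> cinv d)"
    by (rule smooth_on_cong[OF S, rotated]) (use cinv_cmap[OF d] cinv_cmap[OF assms(1)] in auto)
qed

text \<open>In another chart \<open>d\<close> the components are a directional derivative of the
  transition map from \<open>c\<close> to \<open>d\<close>, evaluated after the smooth transition
  back from \<open>d\<close> to \<open>c\<close>.\<close>

lemma coord_field_vfields: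
  assumes c: "c \<in> A"
  shows "coord_field A c a \<in> vfields A (cdom c)"
  unfolding vfields_def
proof (intro CollectI ballI)
  fix d assume d: "d \<in> A"
  let ?S = "cmap d ` (cdom d \<inter> cdom c)" and ?T = "cmap c ` (cdom c \<inter> cdom d)"
  have S: "open ?S" by (rule open_image[OF d open_cdom[OF c]])
  have T: "open ?T" by (rule open_image[OF c open_cdom[OF d]])
  have "smooth_on ?S (\<lambda>x. frechet_derivative (cmap d \<circ> cinv c) (at ((cmap c \<circ> cinv d) x)) a)"
  proof (rule smooth_on_compose[OF S T transition_smooth[OF d c] _
        smooth_on_frechet_derivative[OF transition_smooth[OF c d]]])
    show "(cmap c \<circ> cinv d) ` ?S \<subseteq> ?T" using cinv_cmap[OF d] by auto
  qed
  then show "smooth_on ?S (\<lambda>x. tcoord A d (cinv d x) (coord_field A c a (cinv d x)))"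
  proof (rule smooth_on_cong[OF S, rotated])
    fix x assume "x \<in> ?S"
    then have "cinv d x \<in> cdom c" "cinv d x \<in> cdom d" using cinv_cmap[OF d] by auto
    then show "frechet_derivative (cmap d \<circ> cinv c) (at ((cmap c \<circ> cinv d) x)) a =
        tcoord A d (cinv d x) (coord_field A c a (cinv d x))"
      by (simp add: tcoord_coord_field[OF c d] transition_def)
  qed
qed

lemma image_cinv: "c \<in> A \<Longrightarrow> x \<in> cmap c ` (cdom c \<inter> U) \<Longrightarrow> cinv c x \<in> cdom c \<and> cinv c x \<in> U"
  using cinv_cmap by auto

lemma vfields_scaleR:
  assumes "open U" "smooth_fun A U u" "X \<in> vfields A U"
  shows "(\<lambda>q. u q *\<^sub>R X q) \<in> vfields A U"
  unfolding vfields_def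
proof (intro CollectI ballI)
  fix c assume c: "c \<in> A"
  let ?S = "cmap c ` (cdom c \<inter> U)"
  have S: "open ?S" by (rule open_image[OF c assms(1)])
  have "smooth_on ?S (\<lambda>x. (u \<circ> cinv c) x *\<^sub>R tcoord A c (cinv c x) (X (cinv c x)))"
  proof (rule smooth_on_scaleR[OF S])
    show "smooth_on ?S (u \<circ> cinv c)" using assms(2) c unfolding smooth_fun_def by blast
    show "smooth_on ?S (\<lambda>x. tcoord A c (cinv c x) (X (cinv c x)))"
      using assms(3) c unfolding vfields_def by blast
  qed
  then show "smooth_on ?S (\<lambda>x. tcoord A c (cinv c x) (u (cinv c x) *\<^sub>R X (cinv c x)))"
    by (rule smooth_on_cong[OF S, rotated])
      (use image_cinv[OF c] linear_cmul[OF tcoord_linear[OF c]] in auto)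
qed

lemma vfields_add:
  assumes "open U" "X \<in> vfields A U" "Y \<in> vfields A U"
  shows "(\<lambda>q. X q + Y q) \<in> vfields A U"
  unfolding vfields_def
proof (intro CollectI ballI)
  fix c assume c: "c \<in> A"
  let ?S = "cmap c ` (cdom c \<inter> U)"
  have S: "open ?S" by (rule open_image[OF c assms(1)])
  have "smooth_on ?S (\<lambda>x. tcoord A c (cinv c x) (X (cinv c x)) + tcoord A c (cinv c x) (Y (cinv c x)))"
    by (rule smooth_on_add[OF S]) (use assms c in \<open>auto simp: vfields_def\<close>)
  then show "smooth_on ?S (\<lambda>x. tcoord A c (cinv c x) (X (cinv c x) + Y (cinv c x)))"
    by (rule smooth_on_cong[OF S, rotated])
      (use image_cinv[OF c] linear_add[OF tcoord_linear[OF c]] in auto)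
qed

lemma vfields_zero:
  assumes "open U" shows "(\<lambda>q. 0) \<in> vfields A U"
  unfolding vfields_def
proof (intro CollectI ballI)
  fix c assume c: "c \<in> A"
  let ?S = "cmap c ` (cdom c \<inter> U)"
  have S: "open ?S" by (rule open_image[OF c assms(1)])
  show "smooth_on ?S (\<lambda>x. tcoord A c (cinv c x) 0)"
    by (rule smooth_on_cong[OF S _ smooth_on_const[OF S, of 0]])
      (use image_cinv[OF c] linear_0[OF tcoord_linear[OF c]] in auto)
qed

lemma vfields_sum:
  assumes "open U" "finite I" "\<And>i. i \<in> I \<Longrightarrow> X i \<in> vfields A U"
  shows "(\<lambda>q. \<Sum>i\<in>I. X i q) \<in> vfields A U"
  using assms(2,3)
proof (induction I rule: finite_induct)
  case empty
  then show ?case using vfields_zero[OF assms(1)] by simp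
next
  case (insert i I)
  have "(\<lambda>q. X i q + (\<Sum>i\<in>I. X i q)) \<in> vfields A U"
    by (rule vfields_add[OF assms(1)]) (use insert in blast)+
  then show ?case using insert.hyps by simp
qed

text \<open>Constancy is asked for on \<open>U\<close> only, so that the indicator function of
  \<open>U\<close> is covered.\<close>

lemma smooth_fun_const: "open U \<Longrightarrow> (\<And>q. q \<in> U \<Longrightarrow> u q = k) \<Longrightarrow> smooth_fun A U u"
  unfolding smooth_fun_def
proof
  fix c assume c: "c \<in> A" and U: "open U" "\<And>q. q \<in> U \<Longrightarrow> u q = k"
  show "smooth_on (cmap c ` (cdom c \<inter> U)) (u \<circ> cinv c)"
    by (rule smooth_on_cong[OF open_image[OF c U(1)] _ smooth_on_const[OF open_image[OF c U(1)], of k]])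
      (use image_cinv[OF c] U(2) in simp)
qed

lemma dir_deriv_const:
  assumes "open U" "p \<in> U" "\<And>q. q \<in> U \<Longrightarrow> u q = k"
  shows "dir_deriv A p v u = 0"
  unfolding dir_deriv_def
proof (rule frechet_derivative_const_on)
  let ?c = "chart_at A p"
  show "open (cmap ?c ` (cdom ?c \<inter> U))" by (rule open_image[OF chart_at_mem(1) assms(1)])
  show "cmap ?c p \<in> cmap ?c ` (cdom ?c \<inter> U)" using chart_at_mem(2) assms(2) by blast
  show "(u \<circ> cinv ?c) y = k" if "y \<in> cmap ?c ` (cdom ?c \<inter> U)" for y
    using image_cinv[OF chart_at_mem(1) that] assms(3) by simp
qed

text \<open>Coordinate functions as test functions recover the components of a vector from its
  derivation; the torsion condition is stated through derivations only.\<close>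

lemma dir_deriv_coordinate:
  assumes "c \<in> A" "q \<in> cdom c"
  shows "dir_deriv A q v (\<lambda>p. cmap c p \<bullet> i) = tcoord A c q v \<bullet> i"
proof -
  have "((\<lambda>x. (cmap c \<circ> cinv (chart_at A q)) x \<bullet> i) has_derivative (\<lambda>v. tcoord A c q v \<bullet> i))
      (at (cmap (chart_at A q) q))"
    unfolding tcoord_trans
    by (intro bounded_linear.has_derivative[OF bounded_linear_inner_left]
        trans_has_derivative chart_at_mem assms)
  from frechet_derivative_at[OF this] show ?thesis
    unfolding dir_deriv_def by (simp add: o_def) metis
qed

lemma smooth_fun_coordinate:
  assumes "c \<in> A" shows "smooth_fun A (cdom c) (\<lambda>p. cmap c p \<bullet> i)"
proof (rule smooth_fun_of_chart[OF assms])
  have "smooth_on (cmap c ` cdom c) (\<lambda>x. x \<bullet> i)"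
    by (intro smooth_on_linear[OF bounded_linear_inner_left] smooth_on_id open_range[OF assms])
  then show "smooth_on (cmap c ` cdom c) ((\<lambda>p. cmap c p \<bullet> i) \<circ> cinv c)"
    by (rule smooth_on_cong[OF open_range[OF assms], rotated]) (use cinv_cmap[OF assms] in auto)
qed

end

section \<open>Connections in coordinates\<close>

locale levi_civita_atlas = smooth_atlas A
  for A :: "('a::{t2_space,second_countable_topology}, 'e::euclidean_space) chart set" +
  fixes g :: "'a \<Rightarrow> 'e \<Rightarrow> 'e \<Rightarrow> real" and nabla :: "'a \<Rightarrow> 'e \<Rightarrow> ('a \<Rightarrow> 'e) \<Rightarrow> 'e"
  assumes metric: "riemannian_metric A g" and levi_civita: "levi_civita A g nabla"
begin

lemma inner_form: "inner_form (g p)"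
  using metric unfolding riemannian_metric_def by unfold_locales auto

lemma connection:
  assumes "open U" "Y \<in> vfields A U" "p \<in> U"
  shows nabla_linear: "linear (\<lambda>v. nabla p v Y)"
    and nabla_add: "Z \<in> vfields A U \<Longrightarrow> nabla p v (\<lambda>q. Y q + Z q) = nabla p v Y + nabla p v Z"
    and nabla_leibniz: "smooth_fun A U u \<Longrightarrow>
      nabla p v (\<lambda>q. u q *\<^sub>R Y q) = dir_deriv A p v u *\<^sub>R Y p + u p *\<^sub>R nabla p v Y"
proof -
  have "linear_connection A nabla" using levi_civita unfolding levi_civita_def by blast
  note * = this[unfolded linear_connection_def, rule_format, OF assms(1), rule_format, OF assms(2)]
  show "linear (\<lambda>v. nabla p v Y)" using * assms(3) by blast
  show "nabla p v (\<lambda>q. Y q + Z q) = nabla p v Y + nabla p v Z" if "Z \<in> vfields A U"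
    using * assms(3) that by blast
  show "nabla p v (\<lambda>q. u q *\<^sub>R Y q) = dir_deriv A p v u *\<^sub>R Y p + u p *\<^sub>R nabla p v Y"
    if "smooth_fun A U u" using * assms(3) that by blast
qed

text \<open>The Leibniz rule for the indicator function of \<open>U\<close> shows that only the values on \<open>U\<close> matter.\<close>

lemma nabla_local:
  assumes U: "open U" "p \<in> U" and XY: "X \<in> vfields A U" "Y \<in> vfields A U"
    and eq: "\<And>q. q \<in> U \<Longrightarrow> X q = Y q"
  shows "nabla p v X = nabla p v Y"
proof -
  define u where "u q = (if q \<in> U then 1 else 0 :: real)" for q
  have u: "smooth_fun A U u" "dir_deriv A p v u = 0"
    using smooth_fun_const[OF U(1), of u 1] dir_deriv_const[OF U, of u 1] by (auto simp: u_def)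
  have "(\<lambda>q. u q *\<^sub>R X q) = (\<lambda>q. u q *\<^sub>R Y q)" using eq by (auto simp: u_def)
  then show ?thesis
    using nabla_leibniz[OF U(1) XY(1) U(2) u(1), of v] nabla_leibniz[OF U(1) XY(2) U(2) u(1), of v] u(2) U(2)
    by (simp add: u_def)
qed

lemma nabla_sum:
  assumes U: "open U" "p \<in> U" and I: "finite I" "\<And>i. i \<in> I \<Longrightarrow> X i \<in> vfields A U"
  shows "nabla p v (\<lambda>q. \<Sum>i\<in>I. X i q) = (\<Sum>i\<in>I. nabla p v (X i))"
  using I
proof (induction I rule: finite_induct)
  case empty
  \<comment> \<open>Additivity at two zero fields makes the derivative of the zero field equal to
    its double.\<close>
  then show ?case using nabla_add[OF U(1) vfields_zero[OF U(1)] U(2) vfields_zero[OF U(1)], of v] by simp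
next
  case (insert i I)
  have "nabla p v (\<lambda>q. X i q + (\<Sum>i\<in>I. X i q)) = nabla p v (X i) + nabla p v (\<lambda>q. \<Sum>i\<in>I. X i q)"
    by (rule nabla_add[OF U(1) _ U(2)]) (use insert vfields_sum[OF U(1)] in auto)
  then show ?case using insert by simp
qed

text \<open>The Christoffel symbols at \<open>p\<close> in the preferred chart at \<open>p\<close>,
  as a bilinear map. In that chart the components of a vector at \<open>p\<close> are the vector
  itself.\<close>

definition christoffel :: "'a \<Rightarrow> 'e \<Rightarrow> 'e \<Rightarrow> 'e" where
  "christoffel p v a = nabla p v (coord_field A (chart_at A p) a)"

lemma christoffel_bilinear: "bilinear (christoffel p)"
proof -
  define c where "c = chart_at A p"
  have c: "c \<in> A" "p \<in> cdom c" "open (cdom c)" unfolding c_def using chart_at_mem open_cdom by auto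
  note cf = coord_field_vfields[OF c(1)]
  have "linear (christoffel p v)" for v
  proof (rule linearI)
    fix a b r
    \<comment> \<open>The fields agree on the domain of \<open>c\<close> only, so locality of the
      connection is required before additivity.\<close>
    have "nabla p v (coord_field A c (a + b)) = nabla p v (\<lambda>q. coord_field A c a q + coord_field A c b q)"
      by (rule nabla_local[OF c(3,2) cf vfields_add[OF c(3) cf cf]])
        (rule linear_add[OF coord_field_linear[OF c(1)]])
    then show "christoffel p v (a + b) = christoffel p v a + christoffel p v b"
      unfolding christoffel_def c_def[symmetric] by (simp add: nabla_add[OF c(3) cf c(2) cf])
    have k: "smooth_fun A (cdom c) (\<lambda>q. r)" by (rule smooth_fun_const[OF c(3)]) simp
    have "nabla p v (coord_field A c (r *\<^sub>R a)) = nabla p v (\<lambda>q. r *\<^sub>R coord_field A c a q)"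
      by (rule nabla_local[OF c(3,2) cf vfields_scaleR[OF c(3) k cf]])
        (rule linear_cmul[OF coord_field_linear[OF c(1)]])
    then show "christoffel p v (r *\<^sub>R a) = r *\<^sub>R christoffel p v a"
      unfolding christoffel_def c_def[symmetric]
      by (simp add: nabla_leibniz[OF c(3) cf c(2) k] dir_deriv_const[OF c(3,2)])
  qed
  moreover have "linear (\<lambda>v. christoffel p v a)" for a
    unfolding christoffel_def c_def[symmetric] by (rule nabla_linear[OF c(3) cf c(2)])
  ultimately show ?thesis unfolding bilinear_def by blast
qed

text \<open>Expand \<open>X\<close> in coordinate fields and apply the Leibniz rule. The formula is
  solved for the derivative of the components, since components are what the chart computations
  differentiate.\<close>

lemma nabla_coord:
  assumes X: "X \<in> vfields A (cdom c)" and c_def: "c = chart_at A p"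
  shows "((\<lambda>y. tcoord A c (cinv c y) (X (cinv c y))) has_derivative
      (\<lambda>v. nabla p v X - christoffel p v (X p))) (at (cmap c p))"
proof -
  have c: "c \<in> A" "p \<in> cdom c" "open (cdom c)" unfolding c_def using chart_at_mem open_cdom by auto
  note cf = coord_field_vfields[OF c(1)]
  let ?X = "\<lambda>y. tcoord A c (cinv c y) (X (cinv c y))"
  have sm: "smooth_on (cmap c ` cdom c) ?X"
    using X c(1) unfolding vfields_def by auto
  define D where "D = frechet_derivative ?X (at (cmap c p))"
  have D: "(?X has_derivative D) (at (cmap c p))"
    unfolding D_def by (rule smooth_on_has_derivative[OF sm open_range[OF c(1)]]) (use c in blast)
  define u where "u i q = tcoord A c q (X q) \<bullet> i" for i q
  have su: "smooth_fun A (cdom c) (u i)" for i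
  proof (rule smooth_fun_of_chart[OF c(1)])
    show "smooth_on (cmap c ` cdom c) (u i \<circ> cinv c)"
      unfolding u_def o_def by (rule smooth_on_linear[OF bounded_linear_inner_left open_range[OF c(1)] sm])
  qed
  have du: "dir_deriv A p v (u i) = D v \<bullet> i" for v i
  proof -
    have "((u i \<circ> cinv c) has_derivative (\<lambda>v. D v \<bullet> i)) (at (cmap c p))"
      unfolding u_def o_def by (rule bounded_linear.has_derivative[OF bounded_linear_inner_left D])
    from frechet_derivative_at[OF this] show ?thesis
      unfolding dir_deriv_def c_def[symmetric] by metis
  qed
  have "nabla p v X = D v + christoffel p v (X p)" for v
  proof -
    have vf: "(\<lambda>q. u i q *\<^sub>R coord_field A c i q) \<in> vfields A (cdom c)" for i
      by (rule vfields_scaleR[OF c(3) su cf])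
    have "nabla p v X = nabla p v (\<lambda>q. \<Sum>i\<in>Basis. u i q *\<^sub>R coord_field A c i q)"
    proof (rule nabla_local[OF c(3,2) X vfields_sum[OF c(3) finite_Basis vf]])
      fix q assume q: "q \<in> cdom c"
      have "X q = coord_field A c (tcoord A c q (X q)) q" by (simp add: coord_field_tcoord[OF c(1) q])
      also have "\<dots> = (\<Sum>i\<in>Basis. u i q *\<^sub>R coord_field A c i q)"
        unfolding u_def by (rule linear_eq_sum_Basis[OF coord_field_linear[OF c(1) q]])
      finally show "X q = (\<Sum>i\<in>Basis. u i q *\<^sub>R coord_field A c i q)" .
    qed
    also have "\<dots> = (\<Sum>i\<in>Basis. nabla p v (\<lambda>q. u i q *\<^sub>R coord_field A c i q))"
      by (rule nabla_sum[OF c(3,2) finite_Basis vf])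
    also have "\<dots> = (\<Sum>i\<in>Basis. (D v \<bullet> i) *\<^sub>R i + (X p \<bullet> i) *\<^sub>R christoffel p v i)"
    proof (rule sum.cong[OF refl])
      fix i :: 'e
      have "coord_field A c i p = i" "tcoord A c p (X p) = X p"
        unfolding c_def by (rule coord_field_self, rule tcoord_self)
      then show "nabla p v (\<lambda>q. u i q *\<^sub>R coord_field A c i q) =
          (D v \<bullet> i) *\<^sub>R i + (X p \<bullet> i) *\<^sub>R christoffel p v i"
        unfolding nabla_leibniz[OF c(3) cf c(2) su] du
        by (simp add: u_def christoffel_def c_def[symmetric])
    qed
    also have "\<dots> = D v + christoffel p v (X p)"
      using linear_eq_sum_Basis[of "christoffel p v" "X p"] christoffel_bilinear[of p]
      unfolding sum.distrib bilinear_def by (simp add: euclidean_representation)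
    finally show ?thesis .
  qed
  then have "D = (\<lambda>v. nabla p v X - christoffel p v (X p))" by (intro ext) simp
  then show ?thesis using D by simp
qed

text \<open>The coordinate functions of the chart separate tangent vectors, and the coordinate fields
  differentiate them to constants.\<close>

lemma christoffel_sym: "christoffel p v w = christoffel p w v"
proof -
  define c where "c = chart_at A p"
  have c: "c \<in> A" "p \<in> cdom c" "open (cdom c)" unfolding c_def using chart_at_mem open_cdom by auto
  note cf = coord_field_vfields[OF c(1)]
  have tf: "torsion_free A nabla" using levi_civita unfolding levi_civita_def by blast
  have self: "coord_field A c a p = a" for a unfolding c_def by (rule coord_field_self)
  have const: "dir_deriv A q (coord_field A c a q) (\<lambda>p. cmap c p \<bullet> i) = a \<bullet> i" if "q \<in> cdom c" for q a i
    by (simp add: dir_deriv_coordinate[OF c(1) that] tcoord_coord_field[OF c(1,1) that that]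
        trans_self[OF c(1) that])
  have "(christoffel p v w - christoffel p w v) \<bullet> i = 0" for i
  proof -
    have "dir_deriv A p (nabla p (coord_field A c v p) (coord_field A c w) -
           nabla p (coord_field A c w p) (coord_field A c v)) (\<lambda>p. cmap c p \<bullet> i) =
        dir_deriv A p (coord_field A c v p) (\<lambda>q. dir_deriv A q (coord_field A c w q) (\<lambda>p. cmap c p \<bullet> i)) -
        dir_deriv A p (coord_field A c w p) (\<lambda>q. dir_deriv A q (coord_field A c v q) (\<lambda>p. cmap c p \<bullet> i))"
      using tf[unfolded torsion_free_def, rule_format, OF c(3) cf cf smooth_fun_coordinate[OF c(1)] c(2)] .
    also have "\<dots> = 0"
      using dir_deriv_const[OF c(3,2) const] by simp
    finally show ?thesis
      using tcoord_self[of p] unfolding self christoffel_def c_def[symmetric]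
      by (simp add: dir_deriv_coordinate[OF c(1,2)])
  qed
  then have "christoffel p v w - christoffel p w v = 0" by (metis inner_eq_zero_iff)
  then show ?thesis by simp
qed

lemma metric_coord:
  assumes c_def: "c = chart_at A p"
  shows "((\<lambda>y. g (cinv c y) (coord_field A c u (cinv c y)) (coord_field A c v (cinv c y))) has_derivative
      (\<lambda>w. g p (christoffel p w u) v + g p u (christoffel p w v))) (at (cmap c p))"
proof -
  have c: "c \<in> A" "p \<in> cdom c" "open (cdom c)" unfolding c_def using chart_at_mem open_cdom by auto
  note cf = coord_field_vfields[OF c(1)]
  let ?u = "\<lambda>q. g q (coord_field A c u q) (coord_field A c v q)"
  have "smooth_fun A (cdom c) ?u"
    using metric c(3) cf unfolding riemannian_metric_def by blast
  then have "smooth_on (cmap c ` (cdom c \<inter> cdom c)) (?u \<circ> cinv c)"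
    using c(1) unfolding smooth_fun_def by blast
  then have sm: "smooth_on (cmap c ` cdom c) (?u \<circ> cinv c)" by simp
  have D: "((?u \<circ> cinv c) has_derivative (\<lambda>w. dir_deriv A p w ?u)) (at (cmap c p))"
    unfolding dir_deriv_def c_def[symmetric]
    by (rule smooth_on_has_derivative[OF sm open_range[OF c(1)]]) (use c in blast)
  have "metric_connection A g nabla" using levi_civita unfolding levi_civita_def by blast
  from this[unfolded metric_connection_def, rule_format, OF c(3) cf cf c(2)]
  have "dir_deriv A p w ?u = g p (christoffel p w u) v + g p u (christoffel p w v)" for w
    using coord_field_self[of p] unfolding christoffel_def c_def[symmetric] by simp
  then show ?thesis using D unfolding o_def by simp
qed

end

section \<open>The Kenmotsu identity in coordinates\<close>

locale kenmotsu_atlas = levi_civita_atlas A g nabla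
  for A :: "('a::{t2_space,second_countable_topology}, 'e::euclidean_space) chart set" and g nabla +
  fixes \<phi> :: "'a \<Rightarrow> 'e \<Rightarrow> 'e" and \<xi> :: "'a \<Rightarrow> 'e" and \<eta> :: "'a \<Rightarrow> 'e \<Rightarrow> real"
  assumes kenmotsu: "kenmotsu A \<phi> \<xi> \<eta> g nabla"
begin

lemma almost_contact: "almost_contact_metric A \<phi> \<xi> \<eta> g"
  using kenmotsu unfolding kenmotsu_def by blast

lemma almost_contact_space: "almost_contact_space (g p) (\<phi> p) (\<xi> p) (\<eta> p)"
proof -
  interpret inner_form "g p" by (rule inner_form)
  have *: "\<forall>p. linear (\<phi> p)" "\<forall>p. linear (\<eta> p)" "\<forall>p v. \<phi> p (\<phi> p v) = - v + \<eta> p v *\<^sub>R \<xi> p"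
    "\<forall>p. \<eta> p (\<xi> p) = 1" "\<forall>p v w. g p (\<phi> p v) (\<phi> p w) = g p v w - \<eta> p v * \<eta> p w"
    using almost_contact unfolding almost_contact_metric_def by - (elim conjE, assumption)+
  show ?thesis
    by (intro almost_contact_space.intro almost_contact_space_axioms.intro inner_form_axioms *[rule_format])
qed

text \<open>The identity evaluates the covariant derivative of \<open>\<phi>\<close> applied to a
  coordinate field, and \<open>nabla_coord\<close> subtracts the Christoffel term of the resulting
  field.\<close>

lemma phi_coord:
  assumes c_def: "c = chart_at A p"
  shows "((\<lambda>y. tcoord A c (cinv c y) (\<phi> (cinv c y) (coord_field A c u (cinv c y)))) has_derivative
      (\<lambda>w. \<phi> p (christoffel p w u) + (g p (\<phi> p w) u *\<^sub>R \<xi> p - \<eta> p u *\<^sub>R \<phi> p w)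
          - christoffel p w (\<phi> p u))) (at (cmap c p))"
proof -
  have c: "c \<in> A" "p \<in> cdom c" "open (cdom c)" unfolding c_def using chart_at_mem open_cdom by auto
  note cf = coord_field_vfields[OF c(1)]
  have self: "coord_field A c a p = a" for a unfolding c_def by (rule coord_field_self)
  have X: "(\<lambda>q. \<phi> q (coord_field A c u q)) \<in> vfields A (cdom c)"
    using almost_contact c(3) cf unfolding almost_contact_metric_def by blast
  have "nabla p w (\<lambda>q. \<phi> q (coord_field A c u q)) =
      \<phi> p (christoffel p w u) + (g p (\<phi> p w) u *\<^sub>R \<xi> p - \<eta> p u *\<^sub>R \<phi> p w)" for w
    using kenmotsu[unfolded kenmotsu_def, THEN conjunct2, THEN conjunct2, rule_format,
        OF c(3) cf[of w] cf[of u] c(2)]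
    unfolding self christoffel_def c_def[symmetric] by (simp add: algebra_simps)
  then show ?thesis using nabla_coord[OF X c_def] unfolding self by simp
qed

end

section \<open>Product atlases\<close>

lemma smooth_on_prod:
  fixes f :: "'x::euclidean_space \<Rightarrow> 'u::euclidean_space" and g :: "'y::euclidean_space \<Rightarrow> 'v::euclidean_space"
  assumes S: "open S" and T: "open T" and f: "smooth_on S f" and g: "smooth_on T g"
  shows "smooth_on (S \<times> T) (\<lambda>z. (f (fst z), g (snd z)))"
proof -
  have ST: "open (S \<times> T)" by (rule open_Times[OF S T])
  have "smooth_on (S \<times> T) (\<lambda>z. f (fst z))"
    by (rule smooth_on_compose[OF ST S smooth_on_linear[OF bounded_linear_fst ST smooth_on_id[OF ST]] _ f]) auto
  then have 1: "smooth_on (S \<times> T) (\<lambda>z. (f (fst z), 0 :: 'v))"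
    by (rule smooth_on_linear[OF bounded_linear_Pair[OF bounded_linear_ident bounded_linear_zero] ST])
  have "smooth_on (S \<times> T) (\<lambda>z. g (snd z))"
    by (rule smooth_on_compose[OF ST T smooth_on_linear[OF bounded_linear_snd ST smooth_on_id[OF ST]] _ g]) auto
  then have 2: "smooth_on (S \<times> T) (\<lambda>z. (0 :: 'u, g (snd z)))"
    by (rule smooth_on_linear[OF bounded_linear_Pair[OF bounded_linear_zero bounded_linear_ident] ST])
  show ?thesis using smooth_on_add[OF ST 1 2] by simp
qed

definition prod_chart :: "('a, 'e) chart \<Rightarrow> ('b, 'f) chart \<Rightarrow> ('a \<times> 'b, 'e \<times> 'f) chart" where
  "prod_chart c d = (cdom c \<times> cdom d, map_prod (cmap c) (cmap d))"

lemma prod_atlas_eq: "prod_atlas A B = (\<lambda>(c, d). prod_chart c d) ` (A \<times> B)"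
  unfolding prod_atlas_def prod_chart_def ..

lemma prod_chart_simps [simp]:
  "cdom (prod_chart c d) = cdom c \<times> cdom d" "cmap (prod_chart c d) p = (cmap c (fst p), cmap d (snd p))"
  unfolding prod_chart_def by (simp_all add: map_prod_def split_beta)

lemma is_chart_inj: "is_chart c \<Longrightarrow> inj_on (cmap c) (cdom c)"
  by (metis inj_on_inverseI is_chart_cinv)

text \<open>Restricted to the product of the images, since \<open>inv_into\<close> has no meaningful
  value elsewhere; every later comparison with a pair of inverses is therefore made on an open
  set.\<close>

lemma cinv_prod_chart:
  assumes "is_chart c" "is_chart d" "z \<in> cmap c ` cdom c \<times> cmap d ` cdom d"
  shows "cinv (prod_chart c d) z = (cinv c (fst z), cinv d (snd z))"
proof -
  obtain x y where xy: "x \<in> cdom c" "y \<in> cdom d" "z = (cmap c x, cmap d y)" using assms(3) by blast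
  have "inj_on (cmap (prod_chart c d)) (cdom (prod_chart c d))"
    using is_chart_inj[OF assms(1)] is_chart_inj[OF assms(2)] by (auto simp: inj_on_def)
  then have "cinv (prod_chart c d) z = (x, y)"
    by (rule inv_into_f_eq) (use xy in auto)
  then show ?thesis using is_chart_cinv[OF assms(1) xy(1)] is_chart_cinv[OF assms(2) xy(2)] xy(3) by simp
qed

lemma prod_chart_image: "cmap (prod_chart c d) ` (X \<times> Y) = cmap c ` X \<times> cmap d ` Y"
  by force

lemma is_chart_prod:
  assumes c: "is_chart c" and d: "is_chart d"
  shows "is_chart (prod_chart c d)"
proof -
  have h: "homeomorphism (cdom c) (cmap c ` cdom c) (cmap c) (cinv c)"
    "homeomorphism (cdom d) (cmap d ` cdom d) (cmap d) (cinv d)"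
    and o: "open (cdom c)" "open (cdom d)" "open (cmap c ` cdom c)" "open (cmap d ` cdom d)"
    using c d unfolding is_chart_def by auto
  let ?p = "prod_chart c d"
  have im: "cmap ?p ` cdom ?p = cmap c ` cdom c \<times> cmap d ` cdom d"
    unfolding prod_chart_simps(1) by (rule prod_chart_image)
  have inv: "cinv ?p (cmap ?p x) = x" if "x \<in> cdom ?p" for x
  proof -
    have "cmap ?p x \<in> cmap c ` cdom c \<times> cmap d ` cdom d" using that im by blast
    from cinv_prod_chart[OF c d this] show ?thesis
      using that is_chart_cinv[OF c] is_chart_cinv[OF d] by auto
  qed
  have c1: "continuous_on (cdom ?p) (cmap ?p)"
  proof -
    have "continuous_on (cdom c \<times> cdom d) (\<lambda>z. (cmap c (fst z), cmap d (snd z)))"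
      by (intro continuous_on_Pair continuous_on_compose2[OF homeomorphism_cont1[OF h(1)]]
          continuous_on_compose2[OF homeomorphism_cont1[OF h(2)]] continuous_on_fst continuous_on_snd continuous_on_id) auto
    then show ?thesis unfolding prod_chart_simps(1) by (rule continuous_on_eq) simp
  qed
  have c2: "continuous_on (cmap ?p ` cdom ?p) (cinv ?p)"
  proof -
    have "continuous_on (cmap c ` cdom c \<times> cmap d ` cdom d) (\<lambda>z. (cinv c (fst z), cinv d (snd z)))"
      by (intro continuous_on_Pair continuous_on_compose2[OF homeomorphism_cont2[OF h(1)]]
          continuous_on_compose2[OF homeomorphism_cont2[OF h(2)]] continuous_on_fst continuous_on_snd continuous_on_id) auto
    then show ?thesis unfolding im
      by (rule continuous_on_eq) (rule cinv_prod_chart[OF c d, symmetric])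
  qed
  have "homeomorphism (cdom ?p) (cmap ?p ` cdom ?p) (cmap ?p) (cinv ?p)"
    unfolding homeomorphism_def
  proof (intro conjI ballI refl c1 c2)
    show "cinv ?p (cmap ?p x) = x" if "x \<in> cdom ?p" for x by (rule inv[OF that])
    show "cinv ?p ` cmap ?p ` cdom ?p = cdom ?p" unfolding image_image using inv by (simp cong: image_cong)
    show "cmap ?p (cinv ?p y) = y" if y: "y \<in> cmap ?p ` cdom ?p" for y
    proof -
      obtain x where x: "x \<in> cdom ?p" "y = cmap ?p x" using y by blast
      show ?thesis unfolding x(2) inv[OF x(1)] ..
    qed
  qed
  then show ?thesis unfolding is_chart_def im using o by (simp add: open_Times im)
qed

locale two_atlases = B: smooth_atlas AB + F: smooth_atlas AF
  for AB :: "('b::{t2_space,second_countable_topology}, 'e::euclidean_space) chart set"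
    and AF :: "('f::{t2_space,second_countable_topology}, 'd::euclidean_space) chart set"
begin

abbreviation "AM \<equiv> prod_atlas AB AF"

lemma prod_chart_mem: "c \<in> AB \<Longrightarrow> d \<in> AF \<Longrightarrow> prod_chart c d \<in> AM"
  unfolding prod_atlas_eq by (rule image_eqI[of _ _ "(c, d)"]) auto

lemma AM_cases:
  assumes "b \<in> AM" obtains c d where "c \<in> AB" "d \<in> AF" "b = prod_chart c d"
  using assms unfolding prod_atlas_eq by auto

lemma transition_prod:
  assumes "c \<in> AB" "c' \<in> AB" "d \<in> AF" "d' \<in> AF" "z \<in> cmap c ` (cdom c \<inter> cdom c') \<times> cmap d ` (cdom d \<inter> cdom d')"
  shows "(cmap (prod_chart c' d') \<circ> cinv (prod_chart c d)) z
     = ((cmap c' \<circ> cinv c) (fst z), (cmap d' \<circ> cinv d) (snd z))"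
proof -
  have "z \<in> cmap c ` cdom c \<times> cmap d ` cdom d" using assms(5) by blast
  from cinv_prod_chart[OF B.chart[OF assms(1)] F.chart[OF assms(3)] this] show ?thesis by simp
qed

lemma smooth_manifold_prod: "smooth_manifold AM"
  unfolding smooth_manifold_def
proof (intro conjI ballI)
  show "is_chart b" if "b \<in> AM" for b
    using that by (elim AM_cases) (simp add: is_chart_prod B.chart F.chart)
  show "(\<Union>b\<in>AM. cdom b) = UNIV"
  proof (intro set_eqI iffI UNIV_I)
    fix p :: "'b \<times> 'f"
    show "p \<in> (\<Union>b\<in>AM. cdom b)"
    proof (rule UN_I)
      show "prod_chart (chart_at AB (fst p)) (chart_at AF (snd p)) \<in> AM"
        by (intro prod_chart_mem B.chart_at_mem F.chart_at_mem)
      show "p \<in> cdom (prod_chart (chart_at AB (fst p)) (chart_at AF (snd p)))"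
        using B.chart_at_mem(2)[of "fst p"] F.chart_at_mem(2)[of "snd p"] by (cases p) simp
    qed
  qed
next
  fix b b' assume "b \<in> AM" "b' \<in> AM"
  obtain c d where b: "c \<in> AB" "d \<in> AF" "b = prod_chart c d" using \<open>b \<in> AM\<close> by (rule AM_cases)
  obtain c' d' where b': "c' \<in> AB" "d' \<in> AF" "b' = prod_chart c' d'" using \<open>b' \<in> AM\<close> by (rule AM_cases)
  let ?S = "cmap c ` (cdom c \<inter> cdom c')" and ?T = "cmap d ` (cdom d \<inter> cdom d')"
  have S: "open ?S" "open ?T" using B.open_image F.open_image B.open_cdom F.open_cdom b b' by auto
  have "cdom b \<inter> cdom b' = (cdom c \<inter> cdom c') \<times> (cdom d \<inter> cdom d')" unfolding b b' by auto
  then have im: "cmap b ` (cdom b \<inter> cdom b') = ?S \<times> ?T" unfolding b(3) by (simp only: prod_chart_image)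
  show "smooth_on (cmap b ` (cdom b \<inter> cdom b')) (cmap b' \<circ> cinv b)"
    unfolding im
    by (rule smooth_on_cong[OF open_Times[OF S] _ smooth_on_prod[OF S B.transition_smooth[OF b(1) b'(1)]
            F.transition_smooth[OF b(2) b'(2)]]])
      (unfold b(3) b'(3), rule transition_prod[symmetric, OF b(1) b'(1) b(2) b'(2)])
qed

sublocale M: smooth_atlas AM
  by (unfold_locales, rule smooth_manifold_prod)

text \<open>In product coordinates a projection followed by a factor chart is the factor transition
  after \<open>fst\<close> or \<open>snd\<close>.\<close>

lemma proj_trans:
  assumes c: "c \<in> AB" "c' \<in> AB" "d \<in> AF" "d' \<in> AF" and q: "fst q \<in> cdom c" "fst q \<in> cdom c'" "snd q \<in> cdom d"
    "snd q \<in> cdom d'"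
  shows fst_has_derivative: "((cmap c' \<circ> fst \<circ> cinv (prod_chart c d)) has_derivative (\<lambda>v. transition c c' (fst q) (fst v)))
       (at (cmap (prod_chart c d) q))"
    and snd_has_derivative: "((cmap d' \<circ> snd \<circ> cinv (prod_chart c d)) has_derivative (\<lambda>v. transition d d' (snd q) (snd v)))
       (at (cmap (prod_chart c d) q))"
    and trans_prod: "transition (prod_chart c d) (prod_chart c' d') q v = (transition c c' (fst q) (fst v), transition d d' (snd q) (snd v))"
proof -
  let ?S = "cmap c ` (cdom c \<inter> cdom c') \<times> cmap d ` (cdom d \<inter> cdom d')"
  have S: "open ?S" using B.open_image F.open_image B.open_cdom F.open_cdom c by (intro open_Times) auto
  have mem: "cmap (prod_chart c d) q \<in> ?S" using q by auto
  have 1: "((\<lambda>z. (cmap c' \<circ> cinv c) (fst z)) has_derivative (\<lambda>v. transition c c' (fst q) (fst v))) (at (cmap (prod_chart c d) q))"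
    by (rule has_derivative_compose[OF bounded_linear.has_derivative[OF bounded_linear_fst has_derivative_ident]])
      (use B.trans_has_derivative[OF c(1,2) q(1,2)] in \<open>simp add: o_def\<close>)
  have 2: "((\<lambda>z. (cmap d' \<circ> cinv d) (snd z)) has_derivative (\<lambda>v. transition d d' (snd q) (snd v))) (at (cmap (prod_chart c d) q))"
    by (rule has_derivative_compose[OF bounded_linear.has_derivative[OF bounded_linear_snd has_derivative_ident]])
      (use F.trans_has_derivative[OF c(3,4) q(3,4)] in \<open>simp add: o_def\<close>)
  have cz: "cinv (prod_chart c d) z = (cinv c (fst z), cinv d (snd z))" if "z \<in> ?S" for z
    by (rule cinv_prod_chart[OF B.chart[OF c(1)] F.chart[OF c(3)]]) (use that in blast)
  show "((cmap c' \<circ> fst \<circ> cinv (prod_chart c d)) has_derivative (\<lambda>v. transition c c' (fst q) (fst v)))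
       (at (cmap (prod_chart c d) q))"
    by (rule has_derivative_transform_within_open[OF 1 S mem]) (simp only: cz o_apply fst_conv)
  show "((cmap d' \<circ> snd \<circ> cinv (prod_chart c d)) has_derivative (\<lambda>v. transition d d' (snd q) (snd v)))
       (at (cmap (prod_chart c d) q))"
    by (rule has_derivative_transform_within_open[OF 2 S mem]) (simp only: cz o_apply snd_conv)
  have D: "((cmap (prod_chart c' d') \<circ> cinv (prod_chart c d)) has_derivative
      (\<lambda>v. (transition c c' (fst q) (fst v), transition d d' (snd q) (snd v)))) (at (cmap (prod_chart c d) q))"
    by (rule has_derivative_transform_within_open[OF has_derivative_Pair[OF 1 2] S mem])
      (rule transition_prod[symmetric, OF c])
  have "(\<lambda>v. (transition c c' (fst q) (fst v), transition d d' (snd q) (snd v)))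
      = transition (prod_chart c d) (prod_chart c' d') q"
    unfolding transition_def[of "prod_chart c d"] by (rule frechet_derivative_at[OF D])
  from fun_cong[OF this[symmetric]]
  show "transition (prod_chart c d) (prod_chart c' d') q v = (transition c c' (fst q) (fst v), transition d d' (snd q) (snd v))" .
qed

text \<open>Projections send constant fields of a product chart to constant fields of the factor.
  The preferred chart of the product at \<open>q\<close> need not be built from the preferred charts
  of the factors; the cocycle rule absorbs the difference.\<close>

lemma tangent_proj:
  assumes c: "c \<in> AB" "d \<in> AF" and q: "fst q \<in> cdom c" "snd q \<in> cdom d"
  shows tangent_fst: "tangent_map AM AB fst q (coord_field AM (prod_chart c d) u q) = coord_field AB c (fst u) (fst q)"
    and tangent_snd: "tangent_map AM AF snd q (coord_field AM (prod_chart c d) u q) = coord_field AF d (snd u) (snd q)"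
proof -
  obtain c' d' where b: "c' \<in> AB" "d' \<in> AF" "chart_at AM q = prod_chart c' d'"
    using M.chart_at_mem(1) by (rule AM_cases)
  then have q': "fst q \<in> cdom c'" "snd q \<in> cdom d'" using M.chart_at_mem(2)[of q] by auto
  have cf: "coord_field AM (prod_chart c d) u q = (transition c c' (fst q) (fst u), transition d d' (snd q) (snd u))"
    unfolding coord_field_trans b(3) by (rule trans_prod[OF c(1) b(1) c(2) b(2) q(1) q'(1) q(2) q'(2)])
  note mB = B.chart_at_mem[of "fst q"] and mF = F.chart_at_mem[of "snd q"]
  show "tangent_map AM AB fst q (coord_field AM (prod_chart c d) u q) = coord_field AB c (fst u) (fst q)"
    unfolding tangent_map_def b(3) cf unfolding coord_field_trans
      frechet_derivative_at[OF fst_has_derivative[OF b(1) mB(1) b(2) b(2) q'(1) mB(2) q'(2,2)], symmetric]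
    using B.trans_trans[OF c(1) b(1) mB(1) q(1) q'(1) mB(2)] by simp
  show "tangent_map AM AF snd q (coord_field AM (prod_chart c d) u q) = coord_field AF d (snd u) (snd q)"
    unfolding tangent_map_def b(3) cf unfolding coord_field_trans
      frechet_derivative_at[OF snd_has_derivative[OF b(1) b(1) b(2) mF(1) q'(1,1,2) mF(2)], symmetric]
    using F.trans_trans[OF c(2) b(2) mF(1) q(2) q'(2) mF(2)] by simp
qed

end

section \<open>Derivatives along an immersion\<close>

locale submanifold_point = M: smooth_atlas AM + N: kenmotsu_atlas AN g nabla \<phi> \<xi> \<eta>
  for AM :: "('a::{t2_space,second_countable_topology}, 'm::euclidean_space) chart set"
    and AN :: "('b::{t2_space,second_countable_topology}, 'n::euclidean_space) chart set"
    and g nabla \<phi> \<xi> \<eta> +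
  fixes \<iota> :: "'a \<Rightarrow> 'b" and p :: 'a
  assumes smooth_map: "smooth_map AM AN \<iota>"
begin

section \<open>The immersion in the preferred charts at the point and at its image\<close>

definition "b = chart_at AM p"
definition "c = chart_at AN (\<iota> p)"
definition "x0 = cmap b p"
definition "J = cmap c \<circ> \<iota> \<circ> cinv b"
definition "Ob = cmap b ` (cdom b \<inter> \<iota> -` cdom c)"
definition "DJ x = frechet_derivative J (at x)"
definition "DDJ w u = frechet_derivative (\<lambda>x. DJ x u) (at x0) w"

abbreviation "d\<iota> \<equiv> tangent_map AM AN \<iota>"
abbreviation "\<Gamma> \<equiv> N.christoffel (\<iota> p)"

lemma b: "b \<in> AM" "p \<in> cdom b" "open (cdom b)"
  unfolding b_def using M.chart_at_mem M.open_cdom by auto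

lemma c: "c \<in> AN" "\<iota> p \<in> cdom c" "open (cdom c)"
  unfolding c_def using N.chart_at_mem N.open_cdom by auto

lemma open_vimage_iota: "open U \<Longrightarrow> open (\<iota> -` U)"
  using smooth_map unfolding smooth_map_def by (metis continuous_on_open_vimage open_UNIV Int_UNIV_right)

lemma open_O: "open Ob"
  unfolding Ob_def by (rule M.open_image[OF b(1) open_vimage_iota[OF c(3)]])

lemma x0_O: "x0 \<in> Ob"
  unfolding Ob_def x0_def using b c by blast

lemma O_cinv: "x \<in> Ob \<Longrightarrow> cinv b x \<in> cdom b" "x \<in> Ob \<Longrightarrow> \<iota> (cinv b x) \<in> cdom c"
  "x \<in> Ob \<Longrightarrow> cmap b (cinv b x) = x"
  unfolding Ob_def using M.cinv_cmap[OF b(1)] by auto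

lemma cinv_x0: "cinv b x0 = p"
  unfolding x0_def by (rule M.cinv_cmap[OF b(1,2)])

lemma smooth_J: "smooth_on Ob J"
  unfolding Ob_def J_def using smooth_map b(1) c(1) unfolding smooth_map_def by blast

lemma J_x0: "J x0 = cmap c (\<iota> p)"
  unfolding J_def by (simp add: cinv_x0)

lemma cinv_J: "x \<in> Ob \<Longrightarrow> cinv c (J x) = \<iota> (cinv b x)"
  unfolding J_def using O_cinv(2) N.cinv_cmap[OF c(1)] by simp

lemma J_has_derivative: "x \<in> Ob \<Longrightarrow> (J has_derivative DJ x) (at x)"
  unfolding DJ_def by (rule smooth_on_has_derivative[OF smooth_J open_O])

lemma DJ_linear: "x \<in> Ob \<Longrightarrow> linear (DJ x)"
  by (rule has_derivative_linear[OF J_has_derivative])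

lemma DJ_has_derivative: "((\<lambda>x. DJ x u) has_derivative (\<lambda>w. DDJ w u)) (at x0)"
  unfolding DDJ_def DJ_def
  by (rule smooth_on_has_derivative[OF smooth_on_frechet_derivative[OF smooth_J] open_O x0_O])

lemma DDJ_sym: "DDJ w u = DDJ u w"
  using second_derivative_symmetric[where f = J and f' = DJ, OF open_O x0_O _ DJ_has_derivative[of u] DJ_has_derivative[of w]]
    J_has_derivative by blast

lemma DDJ_linear: "linear (\<lambda>w. DDJ w u)" "linear (DDJ w)"
proof -
  show *: "linear (\<lambda>w. DDJ w u)" for u by (rule has_derivative_linear[OF DJ_has_derivative])
  have "DDJ w = (\<lambda>u. DDJ u w)" by (rule ext) (rule DDJ_sym)
  then show "linear (DDJ w)" using *[of w] by (simp only:)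
qed

text \<open>True without conversion because \<open>b\<close> and \<open>c\<close> are the preferred
  charts at this very point; at nearby points the next lemmas convert components.\<close>

lemma d\<iota>_p: "d\<iota> p = DJ x0"
  unfolding tangent_map_def[abs_def] DJ_def J_def x0_def b_def c_def ..

lemma tangent_map_has_derivative:
  "((cmap (chart_at AN (\<iota> q)) \<circ> \<iota> \<circ> cinv (chart_at AM q)) has_derivative d\<iota> q)
     (at (cmap (chart_at AM q) q))"
  unfolding tangent_map_def[abs_def]
proof (rule smooth_on_has_derivative)
  let ?b = "chart_at AM q" and ?c = "chart_at AN (\<iota> q)"
  show "smooth_on (cmap ?b ` (cdom ?b \<inter> \<iota> -` cdom ?c)) (cmap ?c \<circ> \<iota> \<circ> cinv ?b)"
    using smooth_map M.chart_at_mem(1) N.chart_at_mem(1) unfolding smooth_map_def by blast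
  show "open (cmap ?b ` (cdom ?b \<inter> \<iota> -` cdom ?c))"
    by (rule M.open_image[OF M.chart_at_mem(1) open_vimage_iota[OF N.open_cdom[OF N.chart_at_mem(1)]]])
  show "cmap ?b q \<in> cmap ?b ` (cdom ?b \<inter> \<iota> -` cdom ?c)"
    using M.chart_at_mem(2)[of q] N.chart_at_mem(2)[of "\<iota> q"] by blast
qed

lemma d\<iota>_linear: "linear (d\<iota> q)"
  by (rule has_derivative_linear[OF tangent_map_has_derivative])

text \<open>Both sides come from the derivative of one map, the chart \<open>c\<close> after the
  immersion after the inverse of the preferred chart at \<open>q\<close>, factored once through the
  preferred chart at the image and once through \<open>J\<close>.\<close>

lemma tcoord_d\<iota>:
  assumes x: "x \<in> Ob" and q: "q = cinv b x"
  shows "tcoord AN c (\<iota> q) (d\<iota> q v) = DJ x (tcoord AM b q v)"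
proof -
  define b' where "b' = chart_at AM q"
  define c' where "c' = chart_at AN (\<iota> q)"
  have b': "b' \<in> AM" "q \<in> cdom b'" "open (cdom b')" unfolding b'_def using M.chart_at_mem M.open_cdom by auto
  have c': "c' \<in> AN" "\<iota> q \<in> cdom c'" "open (cdom c')" unfolding c'_def using N.chart_at_mem N.open_cdom by auto
  have qb: "q \<in> cdom b" "\<iota> q \<in> cdom c" "cmap b q = x" using O_cinv[OF x] q by auto
  let ?x = "cmap b' q"
  have e1: "(cmap c' \<circ> \<iota> \<circ> cinv b') ?x = cmap c' (\<iota> q)" using M.cinv_cmap[OF b'(1,2)] by simp
  have D1: "((cmap c \<circ> cinv c') \<circ> (cmap c' \<circ> \<iota> \<circ> cinv b') has_derivative transition c' c (\<iota> q) \<circ> d\<iota> q) (at ?x)"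
    by (rule diff_chain_at[OF tangent_map_has_derivative[of q, folded b'_def c'_def]])
      (unfold e1, rule N.trans_has_derivative[OF c'(1) c(1) c'(2) qb(2)])
  have e2: "(cmap b \<circ> cinv b') ?x = x" using M.cinv_cmap[OF b'(1,2)] qb(3) by simp
  have D2: "(J \<circ> (cmap b \<circ> cinv b') has_derivative DJ x \<circ> transition b' b q) (at ?x)"
    by (rule diff_chain_at[OF M.trans_has_derivative[OF b'(1) b(1) b'(2) qb(1)]])
      (unfold e2, rule J_has_derivative[OF x])
  let ?S = "cmap b' ` (cdom b' \<inter> (cdom b \<inter> \<iota> -` (cdom c \<inter> cdom c')))"
  have S: "open ?S"
    by (rule M.open_image[OF b'(1) open_Int[OF b(3) open_vimage_iota[OF open_Int[OF c(3) c'(3)]]]])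
  have xS: "?x \<in> ?S" using b' c' qb by blast
  have "(J \<circ> (cmap b \<circ> cinv b') has_derivative transition c' c (\<iota> q) \<circ> d\<iota> q) (at ?x)"
  proof (rule has_derivative_transform_within_open[OF D1 S xS])
    fix y assume "y \<in> ?S"
    then obtain r where r: "r \<in> cdom b'" "r \<in> cdom b" "\<iota> r \<in> cdom c" "\<iota> r \<in> cdom c'" "y = cmap b' r" by blast
    show "(cmap c \<circ> cinv c' \<circ> (cmap c' \<circ> \<iota> \<circ> cinv b')) y = (J \<circ> (cmap b \<circ> cinv b')) y"
      unfolding J_def r(5) by (simp add: M.cinv_cmap[OF b'(1) r(1)] M.cinv_cmap[OF b(1) r(2)] N.cinv_cmap[OF c'(1) r(4)])
  qed
  from fun_cong[OF has_derivative_unique[OF this D2], of v] show ?thesis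
    unfolding tcoord_trans b'_def[symmetric] c'_def[symmetric] by simp
qed

lemma d\<iota>_coord_field:
  assumes x: "x \<in> Ob" and q: "q = cinv b x"
  shows "d\<iota> q (coord_field AM b u q) = coord_field AN c (DJ x u) (\<iota> q)"
proof -
  have qb: "q \<in> cdom b" "\<iota> q \<in> cdom c" using O_cinv[OF x] q by auto
  have "tcoord AN c (\<iota> q) (d\<iota> q (coord_field AM b u q)) = DJ x u"
    unfolding tcoord_d\<iota>[OF x q] by (simp add: M.tcoord_coord_field[OF b(1,1) qb(1,1)] M.trans_self[OF b(1) qb(1)])
  then show ?thesis using N.coord_field_tcoord[OF c(1) qb(2)] by metis
qed

section \<open>Covariant derivatives of tangent fields along the immersion\<close>

definition "S w u = DDJ w u + \<Gamma> (d\<iota> p w) (d\<iota> p u)"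

lemma \<Gamma>_linear: "linear (\<Gamma> w)" "linear (\<lambda>w. \<Gamma> w u)"
  using N.christoffel_bilinear unfolding bilinear_def by auto

lemma S_sym: "S w u = S u w"
  unfolding S_def by (simp add: DDJ_sym[of w] N.christoffel_sym[of _ "d\<iota> p w"])

lemma S_bilinear: "bilinear S"
proof -
  have "linear (S w)" for w
    unfolding S_def
    by (rule linearI) (simp_all add: linear_add[OF DDJ_linear(2)] linear_cmul[OF DDJ_linear(2)]
        linear_add[OF d\<iota>_linear] linear_cmul[OF d\<iota>_linear] linear_add[OF \<Gamma>_linear(1)]
        linear_cmul[OF \<Gamma>_linear(1)] algebra_simps)
  moreover have "(\<lambda>w. S w u) = S u" for u by (rule ext) (rule S_sym)
  ultimately show ?thesis unfolding bilinear_def by simp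
qed

text \<open>The derivative of the components of \<open>Y\<close> enters only through
  \<open>DJ x0\<close>, hence tangentially. So the normal part depends on the value of
  \<open>Y\<close> at \<open>p\<close> alone, and \<open>h\<close> is well defined.\<close>

lemma covariant_along_tangent:
  assumes U: "open U" "p \<in> U" and Y: "Y \<in> vfields AM U"
  shows "\<exists>z. covariant_along AM AN \<iota> nabla p x (\<lambda>q. d\<iota> q (Y q)) = S x (Y p) + d\<iota> p z"
proof -
  let ?Y = "\<lambda>y. tcoord AM b (cinv b y) (Y (cinv b y))"
  let ?T = "cmap b ` (cdom b \<inter> U)"
  have T: "open ?T" "x0 \<in> ?T" using M.open_image[OF b(1) U(1)] b(2) U(2) unfolding x0_def by auto
  have "smooth_on ?T ?Y" using Y b(1) unfolding vfields_def by blast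
  then have DY: "(?Y has_derivative frechet_derivative ?Y (at x0)) (at x0)"
    by (rule smooth_on_has_derivative[OF _ T])
  have Y0: "?Y x0 = Y p" unfolding cinv_x0 unfolding b_def by (rule M.tcoord_self)
  have "((\<lambda>y. DJ y (?Y y)) has_derivative (\<lambda>w. DDJ w (?Y x0) + DJ x0 (frechet_derivative ?Y (at x0) w))) (at x0)"
    by (rule has_derivative_apply_family[OF open_O x0_O DJ_linear DJ_has_derivative DY DDJ_linear(2)])
  then have "((\<lambda>y. tcoord AN c (\<iota> (cinv b y)) (d\<iota> (cinv b y) (Y (cinv b y)))) has_derivative
      (\<lambda>w. DDJ w (?Y x0) + DJ x0 (frechet_derivative ?Y (at x0) w))) (at x0)"
    by (rule has_derivative_transform_within_open[OF _ open_O x0_O]) (rule tcoord_d\<iota>[symmetric], simp_all)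
  note fd = frechet_derivative_at[OF this, symmetric]
  have "covariant_along AM AN \<iota> nabla p x (\<lambda>q. d\<iota> q (Y q)) =
      DDJ x (Y p) + DJ x0 (frechet_derivative ?Y (at x0) x) + \<Gamma> (d\<iota> p x) (d\<iota> p (Y p))"
    unfolding covariant_along_def Let_def b_def[symmetric] c_def[symmetric] x0_def[symmetric] fd Y0
    by (simp add: N.christoffel_def c_def)
  then show ?thesis
    unfolding S_def d\<iota>_p by (intro exI[of _ "frechet_derivative ?Y (at x0) x"]) simp
qed

lemma coord_field_p: "coord_field AM b v p = v"
  unfolding b_def by (rule M.coord_field_self)

text \<open>The metric and \<open>\<phi>\<close> of the ambient manifold in the chart \<open>c\<close>, pulled back to the chart \<open>b\<close>.\<close>

definition "gJ x u v = g (\<iota> (cinv b x)) (coord_field AN c u (\<iota> (cinv b x))) (coord_field AN c v (\<iota> (cinv b x)))"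
definition "\<phi>J x u = tcoord AN c (\<iota> (cinv b x)) (\<phi> (\<iota> (cinv b x)) (coord_field AN c u (\<iota> (cinv b x))))"

lemma gJ_DJ:
  "x \<in> Ob \<Longrightarrow> q = cinv b x \<Longrightarrow> gJ x (DJ x u) (DJ x v) = g (\<iota> q) (d\<iota> q (coord_field AM b u q)) (d\<iota> q (coord_field AM b v q))"
  unfolding gJ_def by (simp add: d\<iota>_coord_field)

lemma gJ_linear: "x \<in> Ob \<Longrightarrow> linear (\<lambda>u. gJ x u v)" "x \<in> Ob \<Longrightarrow> linear (gJ x u)"
proof -
  assume x: "x \<in> Ob"
  interpret inner_form "g (\<iota> (cinv b x))" by (rule N.inner_form)
  note lin = N.coord_field_linear[OF c(1) O_cinv(2)[OF x]]
  show "linear (\<lambda>u. gJ x u v)" "linear (gJ x u)"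
    unfolding gJ_def by (rule linearI; simp add: linear_add[OF lin] linear_cmul[OF lin] form_simps)+
qed

lemma \<phi>J_linear: "x \<in> Ob \<Longrightarrow> linear (\<phi>J x)"
proof -
  assume x: "x \<in> Ob"
  interpret almost_contact_space "g (\<iota> (cinv b x))" "\<phi> (\<iota> (cinv b x))" "\<xi> (\<iota> (cinv b x))" "\<eta> (\<iota> (cinv b x))"
    by (rule N.almost_contact_space)
  note lin = N.coord_field_linear[OF c(1) O_cinv(2)[OF x]] N.tcoord_linear[OF c(1) O_cinv(2)[OF x]] phi_linear
  show "linear (\<phi>J x)"
    unfolding \<phi>J_def by (rule linearI; simp add: linear_add[OF lin(1)] linear_cmul[OF lin(1)] linear_add[OF lin(2)]
        linear_cmul[OF lin(2)] linear_add[OF lin(3)] linear_cmul[OF lin(3)])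
qed

lemma gJ_x0: "gJ x0 u v = g (\<iota> p) u v"
  unfolding gJ_def cinv_x0 unfolding c_def by (simp add: N.coord_field_self)

lemma \<phi>J_x0: "\<phi>J x0 u = \<phi> (\<iota> p) u"
  unfolding \<phi>J_def cinv_x0 unfolding c_def by (simp add: N.coord_field_self N.tcoord_self)

lemma gJ_has_derivative_const:
  "((\<lambda>x. gJ x u v) has_derivative (\<lambda>w. g (\<iota> p) (\<Gamma> (d\<iota> p w) u) v + g (\<iota> p) u (\<Gamma> (d\<iota> p w) v))) (at x0)"
proof -
  have "((\<lambda>y. g (cinv c y) (coord_field AN c u (cinv c y)) (coord_field AN c v (cinv c y))) has_derivative
      (\<lambda>w. g (\<iota> p) (\<Gamma> w u) v + g (\<iota> p) u (\<Gamma> w v))) (at (J x0))"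
    unfolding J_x0 by (rule N.metric_coord[OF c_def])
  from has_derivative_compose[OF J_has_derivative[OF x0_O] this]
  show ?thesis unfolding d\<iota>_p
    by (rule has_derivative_transform_within_open[OF _ open_O x0_O]) (simp add: gJ_def cinv_J)
qed

lemma \<phi>J_has_derivative_const:
  "((\<lambda>x. \<phi>J x u) has_derivative (\<lambda>w. \<phi> (\<iota> p) (\<Gamma> (d\<iota> p w) u)
      + (g (\<iota> p) (\<phi> (\<iota> p) (d\<iota> p w)) u *\<^sub>R \<xi> (\<iota> p) - \<eta> (\<iota> p) u *\<^sub>R \<phi> (\<iota> p) (d\<iota> p w))
      - \<Gamma> (d\<iota> p w) (\<phi> (\<iota> p) u))) (at x0)"
proof -
  have "((\<lambda>y. tcoord AN c (cinv c y) (\<phi> (cinv c y) (coord_field AN c u (cinv c y)))) has_derivative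
      (\<lambda>w. \<phi> (\<iota> p) (\<Gamma> w u) + (g (\<iota> p) (\<phi> (\<iota> p) w) u *\<^sub>R \<xi> (\<iota> p) - \<eta> (\<iota> p) u *\<^sub>R \<phi> (\<iota> p) w)
          - \<Gamma> w (\<phi> (\<iota> p) u))) (at (J x0))"
    unfolding J_x0 by (rule N.phi_coord[OF c_def])
  from has_derivative_compose[OF J_has_derivative[OF x0_O] this]
  show ?thesis unfolding d\<iota>_p
    by (rule has_derivative_transform_within_open[OF _ open_O x0_O]) (simp add: \<phi>J_def cinv_J)
qed

text \<open>The product rule for families is applied in each argument in turn; the Christoffel terms
  complete the derivatives of \<open>A\<close> and \<open>B\<close> to covariant ones.\<close>

lemma gJ_has_derivative:
  assumes A: "(A has_derivative A') (at x0)" and B: "(B has_derivative B') (at x0)"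
  shows "((\<lambda>x. gJ x (A x) (B x)) has_derivative (\<lambda>w. g (\<iota> p) (A' w + \<Gamma> (d\<iota> p w) (A x0)) (B x0)
     + g (\<iota> p) (A x0) (B' w + \<Gamma> (d\<iota> p w) (B x0)))) (at x0)"
proof -
  interpret inner_form "g (\<iota> p)" by (rule N.inner_form)
  have lin: "linear (\<lambda>v. g (\<iota> p) (\<Gamma> w u) v + g (\<iota> p) u (\<Gamma> w v))" for w u
    by (rule linearI) (simp_all add: linear_add[OF \<Gamma>_linear(1)] linear_cmul[OF \<Gamma>_linear(1)] form_simps algebra_simps)
  have 1: "((\<lambda>x. gJ x u (B x)) has_derivative (\<lambda>w. (g (\<iota> p) (\<Gamma> (d\<iota> p w) u) (B x0)
      + g (\<iota> p) u (\<Gamma> (d\<iota> p w) (B x0))) + gJ x0 u (B' w))) (at x0)" for u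
    by (rule has_derivative_apply_family[where F = "\<lambda>x v. gJ x u v", OF open_O x0_O gJ_linear(2) gJ_has_derivative_const B lin])
  have lin2: "linear (\<lambda>u. (g (\<iota> p) (\<Gamma> w u) z + g (\<iota> p) u (\<Gamma> w z)) + gJ x0 u z')" for w z z'
    unfolding gJ_x0
    by (rule linearI) (simp_all add: linear_add[OF \<Gamma>_linear(1)] linear_cmul[OF \<Gamma>_linear(1)] form_simps algebra_simps)
  have "((\<lambda>x. gJ x (A x) (B x)) has_derivative (\<lambda>w. ((g (\<iota> p) (\<Gamma> (d\<iota> p w) (A x0)) (B x0)
      + g (\<iota> p) (A x0) (\<Gamma> (d\<iota> p w) (B x0))) + gJ x0 (A x0) (B' w)) + gJ x0 (A' w) (B x0))) (at x0)"
    by (rule has_derivative_apply_family[where F = "\<lambda>x u. gJ x u (B x)", OF open_O x0_O gJ_linear(1) 1 A lin2])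
  then show ?thesis by (simp add: gJ_x0 form_simps algebra_simps)
qed

text \<open>For a field \<open>u\<close> with constant components, this is the ambient covariant derivative of \<open>\<phi>(d\<iota> u)\<close> in
  direction \<open>d\<iota> w\<close>, rewritten by the Kenmotsu identity.\<close>

definition "C w u = \<phi> (\<iota> p) (S w u) + g (\<iota> p) (\<phi> (\<iota> p) (d\<iota> p w)) (d\<iota> p u) *\<^sub>R \<xi> (\<iota> p)
    - \<eta> (\<iota> p) (d\<iota> p u) *\<^sub>R \<phi> (\<iota> p) (d\<iota> p w)"

text \<open>The Christoffel term is kept on the right so that it cancels against the one added by
  \<open>gJ_has_derivative\<close>, leaving \<open>C w u\<close>.\<close>

lemma \<phi>J_has_derivative:
  "((\<lambda>x. \<phi>J x (DJ x u)) has_derivative (\<lambda>w. C w u - \<Gamma> (d\<iota> p w) (\<phi> (\<iota> p) (d\<iota> p u)))) (at x0)"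
proof -
  interpret almost_contact_space "g (\<iota> p)" "\<phi> (\<iota> p)" "\<xi> (\<iota> p)" "\<eta> (\<iota> p)" by (rule N.almost_contact_space)
  have lin: "linear (\<lambda>u. \<phi> (\<iota> p) (\<Gamma> w u)
      + (g (\<iota> p) z u *\<^sub>R \<xi> (\<iota> p) - \<eta> (\<iota> p) u *\<^sub>R z) - \<Gamma> w (\<phi> (\<iota> p) u))" for w z
    by (rule linearI) (simp_all add: linear_add[OF \<Gamma>_linear(1)] linear_cmul[OF \<Gamma>_linear(1)] form_simps
        linear_add[OF phi_linear] linear_cmul[OF phi_linear] linear_add[OF eta_linear] linear_cmul[OF eta_linear] algebra_simps)
  have "((\<lambda>x. \<phi>J x (DJ x u)) has_derivative (\<lambda>w. (\<phi> (\<iota> p) (\<Gamma> (d\<iota> p w) (DJ x0 u))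
      + (g (\<iota> p) (\<phi> (\<iota> p) (d\<iota> p w)) (DJ x0 u) *\<^sub>R \<xi> (\<iota> p) - \<eta> (\<iota> p) (DJ x0 u) *\<^sub>R \<phi> (\<iota> p) (d\<iota> p w))
      - \<Gamma> (d\<iota> p w) (\<phi> (\<iota> p) (DJ x0 u))) + \<phi>J x0 (DDJ w u))) (at x0)"
    by (rule has_derivative_apply_family[where F = \<phi>J, OF open_O x0_O \<phi>J_linear \<phi>J_has_derivative_const DJ_has_derivative lin])
  moreover have "C w u - \<Gamma> (d\<iota> p w) (\<phi> (\<iota> p) (d\<iota> p u)) = (\<phi> (\<iota> p) (\<Gamma> (d\<iota> p w) (DJ x0 u))
      + (g (\<iota> p) (\<phi> (\<iota> p) (d\<iota> p w)) (DJ x0 u) *\<^sub>R \<xi> (\<iota> p) - \<eta> (\<iota> p) (DJ x0 u) *\<^sub>R \<phi> (\<iota> p) (d\<iota> p w))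
      - \<Gamma> (d\<iota> p w) (\<phi> (\<iota> p) (DJ x0 u))) + \<phi>J x0 (DDJ w u)" for w
    unfolding C_def S_def \<phi>J_x0 d\<iota>_p by (simp add: linear_add[OF phi_linear] algebra_simps)
  ultimately show ?thesis by simp
qed

section \<open>Derivatives of the three pulled-back products\<close>

lemma metric_derivative:
  "((\<lambda>x. gJ x (DJ x u) (DJ x v)) has_derivative
     (\<lambda>w. g (\<iota> p) (S w u) (d\<iota> p v) + g (\<iota> p) (d\<iota> p u) (S w v))) (at x0)"
  using gJ_has_derivative[OF DJ_has_derivative DJ_has_derivative, of u v] unfolding S_def d\<iota>_p .

lemma metric_phi_derivative:
  "((\<lambda>x. gJ x (\<phi>J x (DJ x u)) (DJ x v)) has_derivative
     (\<lambda>w. g (\<iota> p) (C w u) (d\<iota> p v) + g (\<iota> p) (\<phi> (\<iota> p) (d\<iota> p u)) (S w v))) (at x0)"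
  using gJ_has_derivative[OF \<phi>J_has_derivative DJ_has_derivative, of u v]
  unfolding S_def \<phi>J_x0 d\<iota>_p diff_add_cancel .

lemma metric_phi_phi_derivative:
  "((\<lambda>x. gJ x (\<phi>J x (DJ x u)) (\<phi>J x (DJ x v))) has_derivative
     (\<lambda>w. g (\<iota> p) (C w u) (\<phi> (\<iota> p) (d\<iota> p v)) + g (\<iota> p) (\<phi> (\<iota> p) (d\<iota> p u)) (C w v))) (at x0)"
  using gJ_has_derivative[OF \<phi>J_has_derivative \<phi>J_has_derivative, of u v]
  unfolding \<phi>J_x0 d\<iota>_p diff_add_cancel .

lemma coord_field_\<phi>J:
  assumes x: "x \<in> Ob" and q: "q = cinv b x"
  shows "coord_field AN c (\<phi>J x (DJ x u)) (\<iota> q) = \<phi> (\<iota> q) (d\<iota> q (coord_field AM b u q))"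
  unfolding \<phi>J_def q[symmetric] d\<iota>_coord_field[OF x q]
  by (rule N.coord_field_tcoord[OF c(1)]) (use O_cinv(2)[OF x] q in simp)

end

section \<open>Warped product submanifolds\<close>

locale warped_submanifold_point = two_atlases AB AF +
    submanifold_point "prod_atlas AB AF" AN g nabla \<phi> \<xi> \<eta> \<iota> p
  for AB :: "('b::{t2_space,second_countable_topology}, 'eb::euclidean_space) chart set"
    and AF :: "('f::{t2_space,second_countable_topology}, 'ef::euclidean_space) chart set"
    and AN :: "('n::{t2_space,second_countable_topology}, 'en::euclidean_space) chart set"
    and g nabla \<phi> \<xi> \<eta> \<iota> p +
  fixes gB :: "'b \<Rightarrow> 'eb \<Rightarrow> 'eb \<Rightarrow> real" and gF :: "'f \<Rightarrow> 'ef \<Rightarrow> 'ef \<Rightarrow> real" and f :: "'b \<Rightarrow> real"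
    and \<theta> :: "'b \<times> 'f \<Rightarrow> real" and m2 :: nat
  assumes metric_B: "riemannian_metric AB gB" and metric_F: "riemannian_metric AF gF"
    and f_smooth: "smooth_fun AB UNIV f" and f_pos: "\<And>x. f x > 0"
    and warped: "induced_metric AM AN \<iota> g = warped_metric AB AF gB gF f"
    and semi_slant: "pointwise_semi_slant AM AN \<iota> \<phi> g (base_tangent AB AF) (fiber_tangent AB AF) \<theta>"
    and proper: "\<And>q. 0 < \<theta> q \<and> \<theta> q < pi / 2"
    and xi_tangent: "\<And>q. \<xi> (\<iota> q) \<in> range (tangent_map AM AN \<iota> q)"
    and dims: "DIM('en) = DIM('eb \<times> 'ef) + 2 * m2" "\<And>q. dim (fiber_tangent AB AF q) = 2 * m2"
begin

section \<open>Base and fibre directions in the product chart\<close>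

abbreviation "D1 \<equiv> base_tangent AB AF"
abbreviation "D2 \<equiv> fiber_tangent AB AF"

lemma gB_zero: "gB x u 0 = 0" "gB x 0 u = 0" and gF_zero: "gF y v 0 = 0" "gF y 0 v = 0"
proof -
  have "bilinear (gB x)" "bilinear (gF y)"
    using metric_B metric_F unfolding riemannian_metric_def by simp_all
  then show "gB x u 0 = 0" "gB x 0 u = 0" "gF y v 0 = 0" "gF y 0 v = 0"
    by (simp_all add: bilinear_rzero bilinear_lzero)
qed

lemma coord_field_zero: "cc \<in> AB \<Longrightarrow> x \<in> cdom cc \<Longrightarrow> coord_field AB cc 0 x = 0"
    "d \<in> AF \<Longrightarrow> y \<in> cdom d \<Longrightarrow> coord_field AF d 0 y = 0"
  by (rule linear_0[OF B.coord_field_linear], assumption+) (rule linear_0[OF F.coord_field_linear], assumption+)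

text \<open>A chart in the product atlas is a product chart, but its factors have to be chosen;
  \<open>b1\<close> and \<open>b2\<close> come from the same choice of a pair.\<close>

definition "b1 = fst (SOME z. fst z \<in> AB \<and> snd z \<in> AF \<and> b = prod_chart (fst z) (snd z))"
definition "b2 = snd (SOME z. fst z \<in> AB \<and> snd z \<in> AF \<and> b = prod_chart (fst z) (snd z))"

lemma b12: "b1 \<in> AB" "b2 \<in> AF" "b = prod_chart b1 b2"
proof -
  obtain c' d' where "c' \<in> AB" "d' \<in> AF" "b = prod_chart c' d'" using b(1) by (rule AM_cases)
  then have "\<exists>z. fst z \<in> AB \<and> snd z \<in> AF \<and> b = prod_chart (fst z) (snd z)"
    by (intro exI[of _ "(c', d')"]) simp
  from someI_ex[OF this] show "b1 \<in> AB" "b2 \<in> AF" "b = prod_chart b1 b2"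
    unfolding b1_def b2_def by auto
qed

lemma mem_b: "q \<in> cdom b \<Longrightarrow> fst q \<in> cdom b1" "q \<in> cdom b \<Longrightarrow> snd q \<in> cdom b2"
  unfolding b12(3) by auto

lemma cinv_b:
  assumes x: "x \<in> Ob"
  shows "fst (cinv b x) = cinv b1 (fst x)" "snd (cinv b x) = cinv b2 (snd x)"
    and "cinv b1 (fst x) \<in> cdom b1" "cinv b2 (snd x) \<in> cdom b2"
proof -
  define q where "q = cinv b x"
  have q: "q \<in> cdom b" "cmap b q = x" unfolding q_def using O_cinv[OF x] by auto
  have x': "x = (cmap b1 (fst q), cmap b2 (snd q))" unfolding q(2)[symmetric] b12(3) by simp
  have "cinv b1 (fst x) = fst q" "cinv b2 (snd x) = snd q"
    unfolding x' using B.cinv_cmap[OF b12(1) mem_b(1)[OF q(1)]] F.cinv_cmap[OF b12(2) mem_b(2)[OF q(1)]] by simp_all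
  then show "fst (cinv b x) = cinv b1 (fst x)" "snd (cinv b x) = cinv b2 (snd x)"
    "cinv b1 (fst x) \<in> cdom b1" "cinv b2 (snd x) \<in> cdom b2"
    using mem_b[OF q(1)] unfolding q_def by simp_all
qed

lemma tangent_fst_b: "q \<in> cdom b \<Longrightarrow> tangent_map AM AB fst q (coord_field AM b u q) = coord_field AB b1 (fst u) (fst q)"
  unfolding b12(3) by (rule tangent_fst[OF b12(1,2)]) auto

lemma tangent_snd_b: "q \<in> cdom b \<Longrightarrow> tangent_map AM AF snd q (coord_field AM b u q) = coord_field AF b2 (snd u) (snd q)"
  unfolding b12(3) by (rule tangent_snd[OF b12(1,2)]) auto

lemma coord_field_D1: "q \<in> cdom b \<Longrightarrow> snd u = 0 \<Longrightarrow> coord_field AM b u q \<in> D1 q"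
  unfolding base_tangent_def by (simp add: tangent_snd_b coord_field_zero b12(1,2) mem_b)

lemma coord_field_D2: "q \<in> cdom b \<Longrightarrow> fst u = 0 \<Longrightarrow> coord_field AM b u q \<in> D2 q"
  unfolding fiber_tangent_def by (simp add: tangent_fst_b coord_field_zero b12(1,2) mem_b)

text \<open>With \<open>coord_field_D1\<close> this extends a vector of \<open>D1 p\<close> with
  constant components to a field that stays in \<open>D1\<close>; \<open>D2_p\<close> does the same
  for the fibre.\<close>

lemma D1_p: "u \<in> D1 p \<Longrightarrow> snd u = 0"
proof -
  assume "u \<in> D1 p"
  then have "coord_field AF b2 (snd u) (snd p) = 0"
    using tangent_snd_b[OF b(2), of u] unfolding base_tangent_def coord_field_p by simp
  then show "snd u = 0"
    using F.tcoord_coord_field[OF b12(2,2) mem_b(2)[OF b(2)] mem_b(2)[OF b(2)], of "snd u"]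
      F.trans_self[OF b12(2) mem_b(2)[OF b(2)]] linear_0[OF F.tcoord_linear[OF b12(2) mem_b(2)[OF b(2)]]]
    by simp
qed

lemma D2_p: "u \<in> D2 p \<Longrightarrow> fst u = 0"
proof -
  assume "u \<in> D2 p"
  then have "coord_field AB b1 (fst u) (fst p) = 0"
    using tangent_fst_b[OF b(2), of u] unfolding fiber_tangent_def coord_field_p by simp
  then show "fst u = 0"
    using B.tcoord_coord_field[OF b12(1,1) mem_b(1)[OF b(2)] mem_b(1)[OF b(2)], of "fst u"]
      B.trans_self[OF b12(1) mem_b(1)[OF b(2)]] linear_0[OF B.tcoord_linear[OF b12(1) mem_b(1)[OF b(2)]]]
    by simp
qed

text \<open>The model space of the fibre has a nonempty basis, and a purely fibre vector projects to
  zero on the base.\<close>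

lemma D2_nontrivial: "D2 q \<noteq> {0}"
proof -
  obtain e :: 'ef where e: "e \<in> Basis" using nonempty_Basis by blast
  obtain c' d' where b': "c' \<in> AB" "d' \<in> AF" "chart_at AM q = prod_chart c' d'"
    using M.chart_at_mem(1) by (rule AM_cases)
  then have q: "fst q \<in> cdom c'" "snd q \<in> cdom d'" using M.chart_at_mem(2)[of q] by auto
  have "(0, e) = coord_field AM (prod_chart c' d') (0, e) q"
    unfolding b'(3)[symmetric] by (simp add: M.coord_field_self)
  then have "tangent_map AM AB fst q (0, e) = 0"
    using tangent_fst[OF b'(1,2) q, of "(0, e)"] by (simp add: coord_field_zero b' q)
  then have "(0, e) \<in> D2 q" unfolding fiber_tangent_def by simp
  then show ?thesis using e nonzero_Basis by (auto simp: zero_prod_def)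
qed

text \<open>Needed at every point \<open>q\<close>, because orthogonality relations must hold in a
  neighbourhood before they can be differentiated at \<open>p\<close>.\<close>

lemma semi_slant_space:
  "semi_slant_space (g (\<iota> q)) (\<phi> (\<iota> q)) (\<xi> (\<iota> q)) (\<eta> (\<iota> q)) (tangent_map AM AN \<iota> q) (D1 q) (D2 q) (\<theta> q)"
proof -
  interpret almost_contact_space "g (\<iota> q)" "\<phi> (\<iota> q)" "\<xi> (\<iota> q)" "\<eta> (\<iota> q)" by (rule N.almost_contact_space)
  have ss: "immersion AM AN \<iota>" "distribution AM D1"
    "\<forall>q. D2 q = {w. \<forall>v\<in>D1 q. induced_metric AM AN \<iota> g q v w = 0}"
    "\<forall>q. D1 q \<inter> D2 q = {0} \<and> {v + w | v w. v \<in> D1 q \<and> w \<in> D2 q} = UNIV"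
    "\<forall>q. \<phi> (\<iota> q) ` d\<iota> q ` D1 q \<subseteq> d\<iota> q ` D1 q"
    "\<forall>q. \<forall>X\<in>D2 q. X \<noteq> 0 \<longrightarrow> subspace_angle (g (\<iota> q)) (\<phi> (\<iota> q) (d\<iota> q X)) (d\<iota> q ` D2 q) = \<theta> q"
    using semi_slant unfolding pointwise_semi_slant_def by - (elim conjE, assumption)+
  show ?thesis
  proof (intro semi_slant_space.intro semi_slant_space_axioms.intro almost_contact_space_axioms)
    show "linear (d\<iota> q)" by (rule d\<iota>_linear)
    show "inj (d\<iota> q)" using ss(1) unfolding immersion_def by (elim conjE) (erule spec)
    show "subspace (D1 q)" using ss(2) unfolding distribution_def by (elim exE allE[of _ q] conjE)
    show "D2 q = {w. \<forall>v\<in>D1 q. g (\<iota> q) (d\<iota> q v) (d\<iota> q w) = 0}"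
      using ss(3)[rule_format, of q] unfolding induced_metric_def .
    show "{v + w | v w. v \<in> D1 q \<and> w \<in> D2 q} = UNIV" using ss(4)[rule_format, of q] by (rule conjunct2)
    show "D2 q \<noteq> {0}" by (rule D2_nontrivial)
    show "\<phi> (\<iota> q) ` d\<iota> q ` D1 q \<subseteq> d\<iota> q ` D1 q" by (rule ss(5)[rule_format])
    show "subspace_angle (g (\<iota> q)) (\<phi> (\<iota> q) (d\<iota> q X)) (d\<iota> q ` D2 q) = \<theta> q"
      if "X \<in> D2 q" "X \<noteq> 0" for X by (rule ss(6)[rule_format, OF that])
    show "0 < \<theta> q" "\<theta> q < pi / 2" using proper by auto
    show "\<xi> (\<iota> q) \<in> range (d\<iota> q)" by (rule xi_tangent)
  qed
qed

lemma gJ_warped: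
  assumes x: "x \<in> Ob"
  shows "gJ x (DJ x u) (DJ x v) =
    gB (cinv b1 (fst x)) (coord_field AB b1 (fst u) (cinv b1 (fst x))) (coord_field AB b1 (fst v) (cinv b1 (fst x)))
    + (f (cinv b1 (fst x)))\<^sup>2 *
    gF (cinv b2 (snd x)) (coord_field AF b2 (snd u) (cinv b2 (snd x))) (coord_field AF b2 (snd v) (cinv b2 (snd x)))"
proof -
  define q where "q = cinv b x"
  have q: "q \<in> cdom b" unfolding q_def by (rule O_cinv(1)[OF x])
  have fq: "fst q = cinv b1 (fst x)" "snd q = cinv b2 (snd x)"
    unfolding q_def by (rule cinv_b[OF x])+
  have "gJ x (DJ x u) (DJ x v) = induced_metric AM AN \<iota> g q (coord_field AM b u q) (coord_field AM b v q)"
    unfolding gJ_DJ[OF x q_def] induced_metric_def ..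
  then show ?thesis
    unfolding warped warped_metric_def tangent_fst_b[OF q] tangent_snd_b[OF q] fq .
qed

lemma fst_x0: "fst x0 = cmap b1 (fst p)"
  unfolding x0_def b12(3) by simp

section \<open>The differential of ln f at the point\<close>

definition "l w = dir_deriv AM p w (\<lambda>q. ln (f (fst q)))"
definition "f' = frechet_derivative (f \<circ> cinv b1) (at (fst x0))"

lemma f_has_derivative: "((f \<circ> cinv b1) has_derivative f') (at (fst x0))"
  unfolding f'_def
proof (rule smooth_on_has_derivative)
  show "smooth_on (cmap b1 ` cdom b1) (f \<circ> cinv b1)"
    using f_smooth b12(1) unfolding smooth_fun_def by auto
  show "open (cmap b1 ` cdom b1)" by (rule B.open_range[OF b12(1)])
  show "fst x0 \<in> cmap b1 ` cdom b1" using mem_b(1)[OF b(2)] fst_x0 by simp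
qed

lemma f_x0: "(f \<circ> cinv b1) (fst x0) = f (fst p)"
  using B.cinv_cmap[OF b12(1) mem_b(1)[OF b(2)]] unfolding fst_x0 by simp

lemma l_eq: "l w = f' (fst w) / f (fst p)"
proof -
  have "((\<lambda>x. (f \<circ> cinv b1) (fst x)) has_derivative (\<lambda>w. f' (fst w))) (at x0)"
    by (rule has_derivative_compose[OF bounded_linear.has_derivative[OF bounded_linear_fst has_derivative_ident] f_has_derivative])
  from has_derivative_ln[OF _ this]
  have "((\<lambda>x. ln ((f \<circ> cinv b1) (fst x))) has_derivative (\<lambda>w. f' (fst w) * inverse (f (fst p)))) (at x0)"
    unfolding f_x0 using f_pos by blast
  then have "(((\<lambda>q. ln (f (fst q))) \<circ> cinv b) has_derivative (\<lambda>w. f' (fst w) * inverse (f (fst p)))) (at x0)"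
  proof (rule has_derivative_transform_within_open[OF _ open_O x0_O])
    fix x assume x: "x \<in> Ob"
    show "ln ((f \<circ> cinv b1) (fst x)) = ((\<lambda>q. ln (f (fst q))) \<circ> cinv b) x"
      unfolding o_apply cinv_b(1)[OF x] ..
  qed
  from fun_cong[OF frechet_derivative_at[OF this], of w] show ?thesis
    unfolding l_def dir_deriv_def b_def[symmetric] x0_def[symmetric] by (simp add: divide_inverse)
qed

lemma derivative_zero:
  assumes "(F has_derivative F') (at x0)" and "\<And>x. x \<in> Ob \<Longrightarrow> F x = (0::real)"
  shows "F' w = 0"
proof -
  have "((\<lambda>x. 0) has_derivative F') (at x0)"
    by (rule has_derivative_transform_within_open[OF assms(1) open_O x0_O]) (rule assms(2))
  from has_derivative_unique[OF this has_derivative_const] show ?thesis by simp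
qed

lemma warped_semi_slant_space:
  "warped_semi_slant_space (g (\<iota> p)) (\<phi> (\<iota> p)) (\<xi> (\<iota> p)) (\<eta> (\<iota> p)) (tangent_map AM AN \<iota> p) (D1 p) (D2 p) (\<theta> p) S l"
proof -
  interpret semi_slant_space "g (\<iota> p)" "\<phi> (\<iota> p)" "\<xi> (\<iota> p)" "\<eta> (\<iota> p)" "d\<iota> p" "D1 p" "D2 p" "\<theta> p"
    by (rule semi_slant_space)
  have lf: "linear f'" by (rule has_derivative_linear[OF f_has_derivative])
  show ?thesis
  proof (intro warped_semi_slant_space.intro warped_semi_slant_space_axioms.intro semi_slant_space_axioms)
    show "bilinear S" by (rule S_bilinear)
    show "S x y = S y x" for x y by (rule S_sym)
    show "linear l"
      unfolding l_eq by (rule linearI) (simp_all add: linear_add[OF lf] linear_cmul[OF lf] add_divide_distrib)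
    show "l z = 0" if "z \<in> D2 p" for z unfolding l_eq D2_p[OF that] by (simp add: linear_0[OF lf])
  next
    fix x z w assume x: "x \<in> D1 p" and z: "z \<in> D2 p"
    \<comment> \<open>Constant components keep \<open>x\<close> in \<open>D1\<close> and
      \<open>z\<close> in \<open>D2\<close> at all nearby points, so the product vanishes
      identically and may be differentiated in any direction.\<close>
    have "gJ y (DJ y x) (DJ y z) = 0" if y: "y \<in> Ob" for y
    proof -
      interpret Q: semi_slant_space "g (\<iota> (cinv b y))" "\<phi> (\<iota> (cinv b y))" "\<xi> (\<iota> (cinv b y))" "\<eta> (\<iota> (cinv b y))"
        "d\<iota> (cinv b y)" "D1 (cinv b y)" "D2 (cinv b y)" "\<theta> (cinv b y)" by (rule semi_slant_space)
      show ?thesis unfolding gJ_DJ[OF y refl]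
        using Q.D_orth(1)[OF coord_field_D1[OF O_cinv(1)[OF y] D1_p[OF x]] coord_field_D2[OF O_cinv(1)[OF y] D2_p[OF z]]]
        unfolding Q.G_def .
    qed
    from derivative_zero[OF metric_derivative this]
    show "g (\<iota> p) (S w x) (d\<iota> p z) + g (\<iota> p) (d\<iota> p x) (S w z) = 0" .
  next
    fix x y z assume x: "x \<in> D1 p" and y: "y \<in> D1 p" and z: "z \<in> D2 p"
    \<comment> \<open>Moving in the fibre direction \<open>z\<close> fixes the base point, so the
      metric on base vectors keeps this value.\<close>
    let ?k = "gB (cinv b1 (fst x0)) (coord_field AB b1 (fst x) (cinv b1 (fst x0))) (coord_field AB b1 (fst y) (cinv b1 (fst x0)))"
    show "g (\<iota> p) (S z x) (d\<iota> p y) + g (\<iota> p) (d\<iota> p x) (S z y) = 0"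
    proof (rule has_derivative_along_line[OF metric_derivative])
      show "((\<lambda>t. ?k) has_real_derivative 0) (at 0)" by (rule DERIV_const)
      show "\<forall>\<^sub>F t in nhds 0. gJ (x0 + t *\<^sub>R z) (DJ (x0 + t *\<^sub>R z) x) (DJ (x0 + t *\<^sub>R z) y) = ?k"
        using line_in_open[OF open_O x0_O, of z]
      proof eventually_elim
        case (elim t)
        note mem = cinv_b(4)[OF elim]
        have fx: "fst (x0 + t *\<^sub>R z) = fst x0" using D2_p[OF z] by simp
        show ?case
          unfolding gJ_warped[OF elim] D1_p[OF x] D1_p[OF y] coord_field_zero(2)[OF b12(2) mem] gF_zero fx
          by simp
      qed
    qed
  next
    fix x z w assume x: "x \<in> D1 p" and z: "z \<in> D2 p" and w: "w \<in> D2 p"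
    let ?K = "gF (cinv b2 (snd x0)) (coord_field AF b2 (snd z) (cinv b2 (snd x0))) (coord_field AF b2 (snd w) (cinv b2 (snd x0)))"
    have fib: "gJ y (DJ y z) (DJ y w) = (f (cinv b1 (fst y)))\<^sup>2 *
        gF (cinv b2 (snd y)) (coord_field AF b2 (snd z) (cinv b2 (snd y))) (coord_field AF b2 (snd w) (cinv b2 (snd y)))"
      if y: "y \<in> Ob" for y
      unfolding gJ_warped[OF y] D2_p[OF z] D2_p[OF w] coord_field_zero(1)[OF b12(1) cinv_b(3)[OF y]] gB_zero by simp
    have gzw: "g (\<iota> p) (d\<iota> p z) (d\<iota> p w) = (f (fst p))\<^sup>2 * ?K"
      using fib[OF x0_O] f_x0 unfolding gJ_x0 d\<iota>_p by simp
    show "g (\<iota> p) (S x z) (d\<iota> p w) + g (\<iota> p) (d\<iota> p z) (S x w) = 2 * l x * g (\<iota> p) (d\<iota> p z) (d\<iota> p w)"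
    proof (rule has_derivative_along_line[OF metric_derivative])
      \<comment> \<open>Moving in the base direction \<open>x\<close> changes only the squared
        warping factor, whose logarithmic derivative is \<open>2 * l x\<close>.\<close>
      let ?k = "\<lambda>t. ((f \<circ> cinv b1) (fst x0 + t *\<^sub>R fst x))\<^sup>2 * ?K"
      have 1: "((\<lambda>t. fst x0 + t *\<^sub>R fst x) has_derivative (\<lambda>t. t *\<^sub>R fst x)) (at (0::real))"
        by (auto intro!: derivative_eq_intros)
      have "((\<lambda>t. (f \<circ> cinv b1) (fst x0 + t *\<^sub>R fst x)) has_derivative (\<lambda>t. f' (t *\<^sub>R fst x))) (at 0)"
        by (rule has_derivative_compose[OF 1]) (use f_has_derivative in \<open>simp add: o_def\<close>)
      moreover have "(\<lambda>t. f' (t *\<^sub>R fst x)) = (\<lambda>t. f' (fst x) * t)"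
        by (simp add: linear_cmul[OF lf] mult.commute)
      ultimately have 2: "((\<lambda>t. (f \<circ> cinv b1) (fst x0 + t *\<^sub>R fst x)) has_real_derivative f' (fst x)) (at 0)"
        unfolding has_field_derivative_def by (simp only:)
      have "(?k has_real_derivative (2 * (f (fst p)) * f' (fst x)) * ?K) (at 0)"
        using DERIV_cmult_right[OF DERIV_power[OF 2, of 2], of ?K] f_x0 by (simp add: mult_ac)
      moreover have "2 * (f (fst p)) * f' (fst x) * ?K = 2 * l x * g (\<iota> p) (d\<iota> p z) (d\<iota> p w)"
        unfolding gzw l_eq using f_pos[of "fst p"] by (simp add: power2_eq_square)
      ultimately show "(?k has_real_derivative 2 * l x * g (\<iota> p) (d\<iota> p z) (d\<iota> p w)) (at 0)" by simp
      show "\<forall>\<^sub>F t in nhds 0. gJ (x0 + t *\<^sub>R x) (DJ (x0 + t *\<^sub>R x) z) (DJ (x0 + t *\<^sub>R x) w) = ?k t"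
        using line_in_open[OF open_O x0_O, of x]
      proof eventually_elim
        case (elim t)
        have sx: "snd (x0 + t *\<^sub>R x) = snd x0" using D1_p[OF x] by simp
        show ?case unfolding fib[OF elim] sx by simp
      qed
    qed
  next
    fix x z w assume x: "x \<in> D1 p" and z: "z \<in> D2 p"
    \<comment> \<open>The second product differs from the product of the fields themselves by a term
      with \<open>\<eta>\<close> of a \<open>D2\<close> vector, which is zero.\<close>
    have 0: "gJ y (\<phi>J y (DJ y x)) (DJ y z) = 0 \<and> gJ y (\<phi>J y (DJ y x)) (\<phi>J y (DJ y z)) = 0" if y: "y \<in> Ob" for y
    proof -
      define q where "q = cinv b y"
      interpret Q: semi_slant_space "g (\<iota> q)" "\<phi> (\<iota> q)" "\<xi> (\<iota> q)" "\<eta> (\<iota> q)"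
        "d\<iota> q" "D1 q" "D2 q" "\<theta> q" by (rule semi_slant_space)
      have q: "q \<in> cdom b" unfolding q_def by (rule O_cinv(1)[OF y])
      have D: "coord_field AM b x q \<in> D1 q" "coord_field AM b z q \<in> D2 q"
        by (rule coord_field_D1[OF q D1_p[OF x]], rule coord_field_D2[OF q D2_p[OF z]])
      show ?thesis
        unfolding gJ_def q_def[symmetric] coord_field_\<phi>J[OF y q_def] d\<iota>_coord_field[OF y q_def, symmetric]
        using Q.g_phi_D1_D2[OF D] Q.D_orth(1)[OF D] Q.eta_D2[OF D(2)] by (simp add: Q.g_phi_phi Q.G_def)
    qed
    show "g (\<iota> p) (\<phi> (\<iota> p) (S w x) + g (\<iota> p) (\<phi> (\<iota> p) (d\<iota> p w)) (d\<iota> p x) *\<^sub>R \<xi> (\<iota> p)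
        - \<eta> (\<iota> p) (d\<iota> p x) *\<^sub>R \<phi> (\<iota> p) (d\<iota> p w)) (d\<iota> p z) + g (\<iota> p) (\<phi> (\<iota> p) (d\<iota> p x)) (S w z) = 0"
      using derivative_zero[OF metric_phi_derivative conjunct1[OF 0]] unfolding C_def .
    show "g (\<iota> p) (\<phi> (\<iota> p) (S w x) + g (\<iota> p) (\<phi> (\<iota> p) (d\<iota> p w)) (d\<iota> p x) *\<^sub>R \<xi> (\<iota> p)
        - \<eta> (\<iota> p) (d\<iota> p x) *\<^sub>R \<phi> (\<iota> p) (d\<iota> p w)) (\<phi> (\<iota> p) (d\<iota> p z))
      + g (\<iota> p) (\<phi> (\<iota> p) (d\<iota> p x)) (\<phi> (\<iota> p) (S w z) + g (\<iota> p) (\<phi> (\<iota> p) (d\<iota> p w)) (d\<iota> p z) *\<^sub>R \<xi> (\<iota> p)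
        - \<eta> (\<iota> p) (d\<iota> p z) *\<^sub>R \<phi> (\<iota> p) (d\<iota> p w)) = 0"
      using derivative_zero[OF metric_phi_phi_derivative conjunct2[OF 0]] unfolding C_def .
  qed
qed

sublocale P: warped_semi_slant_space "g (\<iota> p)" "\<phi> (\<iota> p)" "\<xi> (\<iota> p)" "\<eta> (\<iota> p)" "d\<iota> p" "D1 p" "D2 p" "\<theta> p" S l
  by (rule warped_semi_slant_space)

section \<open>Evaluating the descriptions in the definitions of normal part, second fundamental
  form and gradient\<close>

lemma induced_metric_P: "induced_metric AM AN \<iota> g p = P.G"
  unfolding P.G_def[abs_def] induced_metric_def[abs_def] ..

lemma normal_part_eq: "normal_part AM AN \<iota> g p V = P.nor_part V"
  unfolding normal_part_def
proof (rule the_equality)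
  show "P.nor_part V \<in> normal_vectors AM AN \<iota> g p \<and> V - P.nor_part V \<in> range (d\<iota> p)"
    unfolding normal_vectors_def using P.nor_part_orth(1) by (simp add: P.nor_part_def)
  show "W = P.nor_part V" if "W \<in> normal_vectors AM AN \<iota> g p \<and> V - W \<in> range (d\<iota> p)" for W
    by (rule P.nor_part_unique) (use that in \<open>auto simp: normal_vectors_def\<close>)
qed

text \<open>Every extension of \<open>y\<close> gives the same normal part; the coordinate field
  shows that an extension exists, without which the description would not determine a value.\<close>

lemma second_fundamental_form_eq: "second_fundamental_form AM AN \<iota> g nabla p x y = P.h x y"
proof -
  have *: "normal_part AM AN \<iota> g p (covariant_along AM AN \<iota> nabla p x (\<lambda>q. d\<iota> q (Y q))) = P.h x (Y p)"
    if U: "open U" "p \<in> U" "Y \<in> vfields AM U" for U Y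
  proof -
    obtain z where z: "covariant_along AM AN \<iota> nabla p x (\<lambda>q. d\<iota> q (Y q)) = S x (Y p) + d\<iota> p z"
      using covariant_along_tangent[OF U] by blast
    show ?thesis
      unfolding normal_part_eq z linear_add[OF P.nor_part_linear] P.nor_part_L P.h_def by simp
  qed
  show ?thesis
    unfolding second_fundamental_form_def
  proof (rule the_equality)
    show "\<forall>U Y. open U \<longrightarrow> p \<in> U \<longrightarrow> Y \<in> vfields AM U \<longrightarrow> Y p = y \<longrightarrow>
        P.h x y = normal_part AM AN \<iota> g p (covariant_along AM AN \<iota> nabla p x (\<lambda>q. d\<iota> q (Y q)))"
      by (simp add: *)
    fix w assume w: "\<forall>U Y. open U \<longrightarrow> p \<in> U \<longrightarrow> Y \<in> vfields AM U \<longrightarrow> Y p = y \<longrightarrow>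
        w = normal_part AM AN \<iota> g p (covariant_along AM AN \<iota> nabla p x (\<lambda>q. d\<iota> q (Y q)))"
    show "w = P.h x y"
      using w[rule_format, OF b(3,2) M.coord_field_vfields[OF b(1)] coord_field_p[of y]]
        *[OF b(3,2) M.coord_field_vfields[OF b(1), of y]] unfolding coord_field_p by simp
  qed
qed

text \<open>The Riesz vector of \<open>l\<close> is built from an orthonormal basis; nondegeneracy
  makes it the only candidate.\<close>

lemma gradient_eq:
  defines "\<gamma> \<equiv> gradient AM (induced_metric AM AN \<iota> g) (\<lambda>q. ln (f (fst q))) p"
  shows "P.G \<gamma> v = l v"
proof -
  obtain E where E: "P.T.onb UNIV E" using P.T.onb_exists subspace_UNIV by blast
  define \<gamma>0 where "\<gamma>0 = (\<Sum>e\<in>E. l e *\<^sub>R e)"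
  have *: "P.G \<gamma>0 w = l w" for w
  proof -
    have "l w = l (\<Sum>e\<in>E. P.G w e *\<^sub>R e)" using P.T.onb_expand[OF E, of w] by simp
    also have "\<dots> = P.G \<gamma>0 w"
      unfolding \<gamma>0_def P.T.sum_left linear_sum[OF P.l_linear]
      by (rule sum.cong) (simp_all add: P.T.scale_left linear_cmul[OF P.l_linear] P.T.sym[of w])
    finally show ?thesis by simp
  qed
  have "\<gamma> = \<gamma>0"
    unfolding \<gamma>_def gradient_def induced_metric_P l_def[symmetric]
  proof (rule the_equality)
    show "\<forall>w. P.G \<gamma>0 w = l w" by (simp add: *)
    show "v = \<gamma>0" if "\<forall>w. P.G v w = l w" for v by (rule P.form_eqI) (simp only: that[rule_format] *)
  qed
  then show ?thesis using * by simp
qed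

text \<open>The remainder \<open>r\<close> is the \<open>D2\<close>-\<open>D2\<close> block. Its
  sign gives the inequality, its vanishing the equality case, both at a single point.\<close>

lemma sff_norm_sq_eq:
  defines "\<gamma> \<equiv> gradient AM (induced_metric AM AN \<iota> g) (\<lambda>q. ln (f (fst q))) p"
  shows "\<exists>r\<ge>0. sff_norm_sq AM AN \<iota> g nabla p =
      4 * real m2 * ((1 / sin (\<theta> p))\<^sup>2 + (cot (\<theta> p))\<^sup>2) *
        g (\<iota> p) (\<phi> (\<iota> p) (d\<iota> p \<gamma>)) (\<phi> (\<iota> p) (d\<iota> p \<gamma>)) + r \<and>
    (r = 0 \<longleftrightarrow> (\<forall>Z\<in>D2 p. \<forall>W\<in>D2 p. \<forall>V\<in>normal_vectors AM AN \<iota> g p.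
        g (\<iota> p) (second_fundamental_form AM AN \<iota> g nabla p Z W) V = 0))"
proof -
  obtain E2 where E2: "P.T.onb (D2 p) E2" using P.T.onb_exists[OF P.D2_subspace] by blast
  define r where "r = (\<Sum>z\<in>E2. \<Sum>w\<in>E2. g (\<iota> p) (P.h z w) (P.h z w))"
  define E where "E = (SOME E. orthonormal_basis P.G E)"
  have E: "orthonormal_basis P.G E"
    unfolding E_def by (rule someI_ex) (metis P.T.onb_UNIV P.T.onb_exists subspace_UNIV)
  have dim: "DIM('en) = DIM('eb \<times> 'ef) + dim (D2 p)" using dims by simp
  have "sff_norm_sq AM AN \<iota> g nabla p = (\<Sum>x\<in>E. \<Sum>y\<in>E. g (\<iota> p) (P.h x y) (P.h x y))"
    unfolding sff_norm_sq_def Let_def induced_metric_P E_def[symmetric] second_fundamental_form_eq ..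
  also have "\<dots> = 2 * real (dim (D2 p)) * ((1 / sin (\<theta> p))\<^sup>2 + (cot (\<theta> p))\<^sup>2) *
      g (\<iota> p) (\<phi> (\<iota> p) (d\<iota> p \<gamma>)) (\<phi> (\<iota> p) (d\<iota> p \<gamma>)) + r"
    unfolding r_def by (rule P.norm_h[OF dim E _ E2]) (unfold \<gamma>_def, rule gradient_eq)
  also have "2 * real (dim (D2 p)) = 4 * real m2" by (simp add: dims(2))
  finally have 1: "sff_norm_sq AM AN \<iota> g nabla p = 4 * real m2 * ((1 / sin (\<theta> p))\<^sup>2 + (cot (\<theta> p))\<^sup>2) *
      g (\<iota> p) (\<phi> (\<iota> p) (d\<iota> p \<gamma>)) (\<phi> (\<iota> p) (d\<iota> p \<gamma>)) + r" .
  have 2: "r \<ge> 0" unfolding r_def by (intro sum_nonneg P.nonneg)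
  have 3: "r = 0 \<longleftrightarrow> (\<forall>Z\<in>D2 p. \<forall>W\<in>D2 p. \<forall>V\<in>normal_vectors AM AN \<iota> g p.
        g (\<iota> p) (second_fundamental_form AM AN \<iota> g nabla p Z W) V = 0)"
    unfolding r_def P.h_D2_sum_eq_0_iff[OF E2] second_fundamental_form_eq normal_vectors_def by simp
  show ?thesis using 1 2 3 by blast
qed

end

section \<open>The inequality and its equality case\<close>

theorem theorem10p3:
  fixes AN :: "('n::{t2_space,second_countable_topology}, 'en::euclidean_space) chart set"
    and \<phi> :: "'n \<Rightarrow> 'en \<Rightarrow> 'en"
    and \<xi> :: "'n \<Rightarrow> 'en"
    and \<eta> :: "'n \<Rightarrow> 'en \<Rightarrow> real"
    and g :: "'n \<Rightarrow> 'en \<Rightarrow> 'en \<Rightarrow> real"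
    and nabla :: "'n \<Rightarrow> 'en \<Rightarrow> ('n \<Rightarrow> 'en) \<Rightarrow> 'en"
    and AB :: "('b::{t2_space,second_countable_topology}, 'eb::euclidean_space) chart set"
    and gB :: "'b \<Rightarrow> 'eb \<Rightarrow> 'eb \<Rightarrow> real"
    and AF :: "('f::{t2_space,second_countable_topology}, 'ef::euclidean_space) chart set"
    and gF :: "'f \<Rightarrow> 'ef \<Rightarrow> 'ef \<Rightarrow> real"
    and f :: "'b \<Rightarrow> real"
    and AM :: "('b \<times> 'f, 'eb \<times> 'ef) chart set"
    and \<iota> :: "'b \<times> 'f \<Rightarrow> 'n"
    and D1 D2 :: "'b \<times> 'f \<Rightarrow> ('eb \<times> 'ef) set"
    and \<theta> :: "'b \<times> 'f \<Rightarrow> real"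
    and h :: "'b \<times> 'f \<Rightarrow> 'eb \<times> 'ef \<Rightarrow> 'eb \<times> 'ef \<Rightarrow> 'en"
    and grad_ln_f :: "'b \<times> 'f \<Rightarrow> 'eb \<times> 'ef"
    and n m m1 m2 :: nat
  assumes kenmotsu: "kenmotsu AN \<phi> \<xi> \<eta> g nabla"
    and dim_N: "DIM('en) = 2 * n + 1"
    and base: "riemannian_manifold AB gB"
    and fiber: "riemannian_manifold AF gF"
    and f_smooth: "smooth_fun AB UNIV f"
    and f_pos: "\<forall>b. f b > 0"
    and nontrivial: "\<not> f constant_on UNIV"
    and AM: "AM = prod_atlas AB AF"
    and dim_M: "DIM('eb \<times> 'ef) = m"
    and warped: "induced_metric AM AN \<iota> g = warped_metric AB AF gB gF f"
    and semi_slant: "pointwise_semi_slant AM AN \<iota> \<phi> g D1 D2 \<theta>"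
    and proper: "\<forall>p. 0 < \<theta> p \<and> \<theta> p < pi / 2"
    and D1: "D1 = base_tangent AB AF"
    and D2: "D2 = fiber_tangent AB AF"
    and \<xi>_tangent: "\<forall>p. \<xi> (\<iota> p) \<in> range (tangent_map AM AN \<iota> p)"
    and dim_D1: "\<forall>p. dim (D1 p) = 2 * m1 + 1"
    and dim_D2: "\<forall>p. dim (D2 p) = 2 * m2"
    and n_eq: "n = m1 + 2 * m2"
    and h: "h = second_fundamental_form AM AN \<iota> g nabla"
    and grad: "grad_ln_f = gradient AM (induced_metric AM AN \<iota> g) (\<lambda>p. ln (f (fst p)))"
  shows "(\<forall>p. sff_norm_sq AM AN \<iota> g nabla p \<ge>
           4 * real m2 * ((1 / sin (\<theta> p))\<^sup>2 + (cot (\<theta> p))\<^sup>2) *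
           g (\<iota> p) (\<phi> (\<iota> p) (tangent_map AM AN \<iota> p (grad_ln_f p)))
                   (\<phi> (\<iota> p) (tangent_map AM AN \<iota> p (grad_ln_f p)))) \<and>
         ((\<forall>p. sff_norm_sq AM AN \<iota> g nabla p =
           4 * real m2 * ((1 / sin (\<theta> p))\<^sup>2 + (cot (\<theta> p))\<^sup>2) *
           g (\<iota> p) (\<phi> (\<iota> p) (tangent_map AM AN \<iota> p (grad_ln_f p)))
                   (\<phi> (\<iota> p) (tangent_map AM AN \<iota> p (grad_ln_f p)))) \<longleftrightarrow>
          (\<forall>p. \<forall>Z\<in>D2 p. \<forall>W\<in>D2 p. \<forall>V\<in>normal_vectors AM AN \<iota> g p.
             g (\<iota> p) (h p Z W) V = 0))"
proof -
  have "almost_contact_metric AN \<phi> \<xi> \<eta> g" "levi_civita AN g nabla"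
    using kenmotsu unfolding kenmotsu_def by - (elim conjE, assumption)+
  moreover from this(1) have "smooth_manifold AN" "riemannian_metric AN g"
    unfolding almost_contact_metric_def riemannian_manifold_def by - (elim conjE, assumption)+
  ultimately interpret N: kenmotsu_atlas AN g nabla \<phi> \<xi> \<eta>
    using kenmotsu
    by (intro kenmotsu_atlas.intro kenmotsu_atlas_axioms.intro levi_civita_atlas.intro
        levi_civita_atlas_axioms.intro smooth_atlas.intro)
  have BF: "smooth_manifold AB" "riemannian_metric AB gB" "smooth_manifold AF" "riemannian_metric AF gF"
    using base fiber unfolding riemannian_manifold_def by simp_all
  interpret two_atlases AB AF
    by (intro two_atlases.intro smooth_atlas.intro BF)
  have ss: "immersion AM AN \<iota>" "distribution AM D1"
    "\<forall>p. D2 p = {w. \<forall>v\<in>D1 p. induced_metric AM AN \<iota> g p v w = 0}"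
    "\<forall>p. D1 p \<inter> D2 p = {0} \<and> {v + w | v w. v \<in> D1 p \<and> w \<in> D2 p} = UNIV"
    using semi_slant unfolding pointwise_semi_slant_def by - (elim conjE, assumption)+
  have "smooth_map AM AN \<iota>" using ss(1) unfolding immersion_def by (rule conjunct1)
  then have sm: "submanifold_point (prod_atlas AB AF) AN g nabla \<phi> \<xi> \<eta> \<iota>"
    unfolding AM
    by (intro submanifold_point.intro submanifold_point_axioms.intro M.smooth_atlas_axioms N.kenmotsu_atlas_axioms)
  \<comment> \<open>At an arbitrary point the direct sum gives dimension 2 * m1 + 1 + 2 * m2 for the
    submanifold. With n = m1 + 2 * m2 its codimension is the dimension of \<open>D2\<close>, as
    \<open>parseval_normal\<close> demands.\<close>
  have "DIM('en) = DIM('eb \<times> 'ef) + 2 * m2"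
  proof -
    fix p :: "'b \<times> 'f"
    interpret submanifold_point "prod_atlas AB AF" AN g nabla \<phi> \<xi> \<eta> \<iota> p by (rule sm)
    interpret almost_contact_space "g (\<iota> p)" "\<phi> (\<iota> p)" "\<xi> (\<iota> p)" "\<eta> (\<iota> p)" by (rule N.almost_contact_space)
    have "subspace (D1 p)" using ss(2) unfolding distribution_def by (elim exE allE[of _ p] conjE)
    moreover have "subspace (D2 p)"
      unfolding ss(3)[rule_format] induced_metric_def AM
      by (rule subspaceI) (simp_all add: linear_0[OF d\<iota>_linear] linear_add[OF d\<iota>_linear]
          linear_cmul[OF d\<iota>_linear] form_simps)
    ultimately have "dim {v + w | v w. v \<in> D1 p \<and> w \<in> D2 p} + dim (D1 p \<inter> D2 p) = dim (D1 p) + dim (D2 p)"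
      by (rule dim_sums_Int)
    then have "DIM('eb \<times> 'ef) = dim (D1 p) + dim (D2 p)"
      unfolding ss(4)[rule_format, THEN conjunct1] ss(4)[rule_format, THEN conjunct2] dim_UNIV by simp
    also have "\<dots> = 2 * m1 + 1 + 2 * m2" unfolding dim_D1[rule_format] dim_D2[rule_format] ..
    finally show ?thesis using dim_N n_eq by simp
  qed
  then have wp: "warped_submanifold_point AB AF AN g nabla \<phi> \<xi> \<eta> \<iota> gB gF f \<theta> m2"
    using BF(2,4) f_smooth f_pos warped semi_slant proper \<xi>_tangent dim_D2
    unfolding AM D1 D2
    by (intro warped_submanifold_point.intro warped_submanifold_point_axioms.intro two_atlases_axioms sm) blast+
  have main: "\<exists>r\<ge>0. sff_norm_sq AM AN \<iota> g nabla p =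
      4 * real m2 * ((1 / sin (\<theta> p))\<^sup>2 + (cot (\<theta> p))\<^sup>2) *
        g (\<iota> p) (\<phi> (\<iota> p) (tangent_map AM AN \<iota> p (grad_ln_f p)))
                (\<phi> (\<iota> p) (tangent_map AM AN \<iota> p (grad_ln_f p))) + r \<and>
    (r = 0 \<longleftrightarrow> (\<forall>Z\<in>D2 p. \<forall>W\<in>D2 p. \<forall>V\<in>normal_vectors AM AN \<iota> g p. g (\<iota> p) (h p Z W) V = 0))" for p
    unfolding AM D2 h grad by (rule warped_submanifold_point.sff_norm_sq_eq[OF wp])
  show ?thesis
  proof (intro conjI allI iffI)
    fix p
    show "sff_norm_sq AM AN \<iota> g nabla p \<ge>
           4 * real m2 * ((1 / sin (\<theta> p))\<^sup>2 + (cot (\<theta> p))\<^sup>2) *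
           g (\<iota> p) (\<phi> (\<iota> p) (tangent_map AM AN \<iota> p (grad_ln_f p)))
                   (\<phi> (\<iota> p) (tangent_map AM AN \<iota> p (grad_ln_f p)))"
      using main[of p] by (elim exE conjE) simp
  next
    fix p
    assume "\<forall>p. sff_norm_sq AM AN \<iota> g nabla p =
           4 * real m2 * ((1 / sin (\<theta> p))\<^sup>2 + (cot (\<theta> p))\<^sup>2) *
           g (\<iota> p) (\<phi> (\<iota> p) (tangent_map AM AN \<iota> p (grad_ln_f p)))
                   (\<phi> (\<iota> p) (tangent_map AM AN \<iota> p (grad_ln_f p)))"
    then show "\<forall>Z\<in>D2 p. \<forall>W\<in>D2 p. \<forall>V\<in>normal_vectors AM AN \<iota> g p. g (\<iota> p) (h p Z W) V = 0"
      using main[of p] by (elim exE conjE allE[of _ p]) linarith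
  next
    fix p
    assume "\<forall>p. \<forall>Z\<in>D2 p. \<forall>W\<in>D2 p. \<forall>V\<in>normal_vectors AM AN \<iota> g p. g (\<iota> p) (h p Z W) V = 0"
    then show "sff_norm_sq AM AN \<iota> g nabla p =
           4 * real m2 * ((1 / sin (\<theta> p))\<^sup>2 + (cot (\<theta> p))\<^sup>2) *
           g (\<iota> p) (\<phi> (\<iota> p) (tangent_map AM AN \<iota> p (grad_ln_f p)))
                   (\<phi> (\<iota> p) (tangent_map AM AN \<iota> p (grad_ln_f p)))"
      using main[of p] by (elim exE conjE allE[of _ p]) linarith
  qed
qed

end
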